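(* Let $f:Y\to X$ be a nonconstant holomorphic map of compact connected Riemann surfaces, let $L_*$ be a parabolic line bundle of parabolic degree $0$ on $(X,D)$, let $(E_*,\phi)$ be an $L_*$-valued parabolic symplectic (respectively, parabolic orthogonal) vector bundle on $(X,D)$, and let $\theta$ be a Higgs field on $(E_*,\phi)$. Then the pullback $f^*\theta$ is a Higgs field on the parabolic symplectic (respectively, parabolic orthogonal) vector bundle $(f^*E_*,f^*\phi)$ on $Y$.
   Context: **Parabolic bundles.** $X$ is a compact connected Riemann surface, $D=\{x_1,\dots,x_\ell\}\subset X$ a finite subset (also a reduced divisor), $K_X(D)=K_X\otimes\mathcal O_X(D)$. A parabolic vector bundle $E_*$ on $(X,D)$ is a holomorphic vector bundle $E$ on $X$ with, for each $i$, a filtration $E_{x_i}=E_i^1\supsetneq\cdots\supsetneq E_i^{n_i}\supsetneq E_i^{n_i+1}=0$ and weights $0\le\alpha_{i,1}<\cdots<\alpha_{i,n_i}<1$. Parabolic degree: $\deg E+\sum_{i,j}\alpha_{i,j}\dim(E_i^j/E_i^{j+1})$. Equivalently: for $x=x_i$ with local coordinate $z$ and $t\in[0,1)$, $E_{x,t}$ is the module of germs $s$ of sections of $E$ at $x$ with $s(x)\in E_i^j$, $j$ the smallest index with $\alpha_{i,j}\ge t$ ($j=n_i+1$ if none); $E_{x,t+1}=zE_{x,t}$ for all $t\in\mathbb R$. The $t=0$ terms recover $E$ and the jumps recover the weights. Homomorphisms are bundle maps with $E_{x,t}\to E'_{x,t}$. $(E_*\otimes E'_* )_{x,t}=\sum_{a+b=t}E_{x,a}\otimes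 E'_{x,b}$; $(E_*^* )_{x,t}$ consists of germs of meromorphic functionals (poles only at $x$) mapping $E_{x,a}$ to $z^{\lceil a+t\rceil}\mathcal O_{X,x}$ for all $a$. **Structures.** For $L_*$ a parabolic line bundle of parabolic degree $0$, a homomorphism $\phi:E_*\otimes E_*\to L_*$ is an $L_*$-valued parabolic orthogonal (respectively, symplectic) structure if $\phi|_{X\setminus D}$ is symmetric (respectively, anti-symmetric) and $\widehat\phi:E_*\to E_*^*\otimes L_*$, $u\mapsto\phi(u\otimes\cdot)$, is an isomorphism of parabolic vector bundles; then $(E_*,\phi)$ is a parabolic orthogonal (symplectic) vector bundle. **Higgs fields.** A parabolic Higgs field on $E_*$ is a trace-free holomorphic section $\theta$ of $\mathrm{End}(E)\otimes K_X(D)$ preserving each $E_i^j$ over $x_i$. A Higgs field on $(E_*,\phi)$ is a parabolic Higgs field compatible with $\phi$: $(\phi\otimes\mathrm{Id})(\theta(u)\otimes v)+(\phi\otimes\mathrm{Id})(u\otimes\theta(v))=0$ for all local sections $u,v$ of $E$. **Pullback.** Let $B=f^{-1}(D)_{\rm red}\subset Y$. The parabolic bundle $f^*E_*$ on $(Y,B)$ restricts to $f^*(E|_{X\setminus D})$ on $Y\setminus B$, and for $y\in B$ with local coordinate $w$ and multiplicity $m_y$ of $f$ at $y$, $(f^*E_* )_{y,s}$ is the $\mathcal O_{Y,y}$-module generated by $w^kf^*u$ with $u\in E_{f(y),t}$, $k\in\mathbb Z$, $t\in\mathbb R$, $m_yt+k\ge s$. $f^*\phi:f^*E_*\otimes f^*E_*\to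 f^*L_*$ is the $f^*L_*$-valued symplectic (orthogonal) structure extending the usual pullback of $\phi|_{X\setminus D}$, and $f^*\theta$ is the parabolic Higgs field on $f^*E_*$ extending the usual pullback of $\theta|_{X\setminus D}$. *)

theory Defs
  imports "HOL-Complex_Analysis.Complex_Analysis"
begin

section \<open>Riemann surfaces\<close>

text \<open>
  The underlying space of a Riemann surface is a Hausdorff type; the complex structure is an
  atlas of charts \<open>(U, z)\<close>. The values of \<open>z\<close> outside \<open>U\<close> are irrelevant. Second countability
  is automatic in the compact case.
\<close>

type_synonym 'x chart = "'x set \<times> ('x \<Rightarrow> complex)"

definition riemann_surface :: "'x::t2_space chart set \<Rightarrow> bool" where
  "riemann_surface A \<longleftrightarrow>
     (\<Union>(U, z)\<in>A. U) = UNIV \<and>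
     (\<forall>(U, z)\<in>A. open U \<and> open (z ` U) \<and> homeomorphism U (z ` U) z (inv_into U z)) \<and>
     (\<forall>(U, z)\<in>A. \<forall>(V, w)\<in>A. (w \<circ> inv_into U z) holomorphic_on z ` (U \<inter> V))"

definition compact_riemann_surface :: "'x::t2_space chart set \<Rightarrow> bool" where
  "compact_riemann_surface A \<longleftrightarrow>
     riemann_surface A \<and> compact (UNIV :: 'x set) \<and> connected (UNIV :: 'x set)"

definition hol_fun :: "'x::t2_space chart set \<Rightarrow> 'x set \<Rightarrow> ('x \<Rightarrow> complex) \<Rightarrow> bool" where
  "hol_fun A W h \<longleftrightarrow> (\<forall>(U, z)\<in>A. (h \<circ> inv_into U z) holomorphic_on z ` (U \<inter> W))"

definition hol_matrix ::
  "'x::t2_space chart set \<Rightarrow> 'x set \<Rightarrow> ('x \<Rightarrow> complex^'n^'m) \<Rightarrow> bool" where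
  "hol_matrix A W M \<longleftrightarrow> (\<forall>i j. hol_fun A W (\<lambda>p. M p $ i $ j))"

definition hol_germ :: "'x::t2_space chart set \<Rightarrow> 'x \<Rightarrow> ('x \<Rightarrow> complex) \<Rightarrow> bool" where
  "hol_germ A x h \<longleftrightarrow> (\<exists>W. open W \<and> x \<in> W \<and> hol_fun A W h)"

definition holomorphic_map ::
  "'y::t2_space chart set \<Rightarrow> 'x::t2_space chart set \<Rightarrow> ('y \<Rightarrow> 'x) \<Rightarrow> bool" where
  "holomorphic_map AY AX f \<longleftrightarrow> continuous_on UNIV f \<and>
     (\<forall>(V, w)\<in>AY. \<forall>(U, z)\<in>AX. (z \<circ> f \<circ> inv_into V w) holomorphic_on w ` (V \<inter> f -` U))"

text \<open>The multiplicity does not depend on the charts.\<close>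

definition map_mult ::
  "'y::t2_space chart set \<Rightarrow> 'x::t2_space chart set \<Rightarrow> ('y \<Rightarrow> 'x) \<Rightarrow> 'y \<Rightarrow> int" where
  "map_mult AY AX f y =
     (SOME m. \<exists>(V, w)\<in>AY. \<exists>(U, z)\<in>AX. y \<in> V \<and> f y \<in> U \<and>
        m = zorder (\<lambda>\<zeta>. z (f (inv_into V w \<zeta>)) - z (f y)) (w y))"

section \<open>Holomorphic vector bundles\<close>

text \<open>
  A vector bundle of rank \<open>CARD('n)\<close>: every fibre is, as a vector space only, identified with
  \<open>complex^'n\<close> by an arbitrary choice of basis (no compatibility between different points). The
  holomorphic structure is carried by the local trivialisations \<open>(U, g)\<close>, where \<open>g x\<close> is the
  linear isomorphism from the fibre over \<open>x\<close> to the model fibre.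
\<close>

type_synonym ('x, 'n) triv = "'x set \<times> ('x \<Rightarrow> complex^'n^'n)"

definition holomorphic_bundle ::
  "'x::t2_space chart set \<Rightarrow> ('x, 'n::finite) triv set \<Rightarrow> bool" where
  "holomorphic_bundle A G \<longleftrightarrow>
     (\<Union>(U, g)\<in>G. U) = UNIV \<and>
     (\<forall>(U, g)\<in>G. open U \<and> (\<forall>x\<in>U. invertible (g x))) \<and>
     (\<forall>(U, g)\<in>G. \<forall>(V, h)\<in>G. hol_matrix A (U \<inter> V) (\<lambda>x. h x ** matrix_inv (g x)))"

definition hol_section ::
  "'x::t2_space chart set \<Rightarrow> ('x, 'n::finite) triv set \<Rightarrow> 'x set \<Rightarrow> ('x \<Rightarrow> complex^'n) \<Rightarrow> bool" where
  "hol_section A G W s \<longleftrightarrow> (\<forall>(U, g)\<in>G. \<forall>i. hol_fun A (U \<inter> W) (\<lambda>p. (g p *v s p) $ i))"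

text \<open>Holomorphic bundle maps over \<open>W\<close>; \<open>h p\<close> maps the fibre over \<open>p\<close> to the fibre over \<open>p\<close>.\<close>

definition hol_bundle_map ::
  "'x::t2_space chart set \<Rightarrow> ('x, 'n::finite) triv set \<Rightarrow> ('x, 'm::finite) triv set \<Rightarrow> 'x set
     \<Rightarrow> ('x \<Rightarrow> complex^'n^'m) \<Rightarrow> bool" where
  "hol_bundle_map A G H W h \<longleftrightarrow>
     (\<forall>(U, g)\<in>G. \<forall>(V, k)\<in>H. hol_matrix A (U \<inter> V \<inter> W) (\<lambda>p. k p ** h p ** matrix_inv (g p)))"

definition dual_trivs :: "('x, 'n::finite) triv set \<Rightarrow> ('x, 'n) triv set" where
  "dual_trivs G = {(U, \<lambda>x. transpose (matrix_inv (g x))) | U g. (U, g) \<in> G}"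

definition vtensor :: "complex^'n \<Rightarrow> complex^'m \<Rightarrow> complex^('n \<times> 'm)"  (infixl \<open>\<otimes>\<^sub>v\<close> 75) where
  "u \<otimes>\<^sub>v v = (\<chi> q. u $ fst q * v $ snd q)"

definition kronecker ::
  "complex^'n^'n \<Rightarrow> complex^'m^'m \<Rightarrow> complex^('n \<times> 'm)^('n \<times> 'm)" where
  "kronecker g h = (\<chi> q r. g $ fst q $ fst r * h $ snd q $ snd r)"

definition tensor_trivs ::
  "('x, 'n::finite) triv set \<Rightarrow> ('x, 'm::finite) triv set \<Rightarrow> ('x, 'n \<times> 'm) triv set" where
  "tensor_trivs G H =
     {(U \<inter> V, \<lambda>x. kronecker (g x) (h x)) | U V g h. (U, g) \<in> G \<and> (V, h) \<in> H}"

text \<open>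
  \<open>has_degree A G d\<close>: the bundle has degree \<open>d\<close>, computed as the degree of the divisor of a
  nonzero meromorphic section \<open>\<sigma>\<close> of the determinant bundle (trivialised by \<open>det g\<close>). On a compact
  Riemann surface such a section exists and \<open>d\<close> does not depend on it; the divisor \<open>ord\<close> has
  finite support. The values of \<open>\<sigma>\<close> at its poles are irrelevant.
\<close>

definition has_degree ::
  "'x::t2_space chart set \<Rightarrow> ('x, 'n::finite) triv set \<Rightarrow> int \<Rightarrow> bool" where
  "has_degree A G d \<longleftrightarrow>
     (\<exists>\<sigma> ord.
        (\<forall>(U, g)\<in>G. \<forall>(V, z)\<in>A. \<forall>x\<in>U \<inter> V.
           let h = (\<lambda>\<zeta>. det (g (inv_into V z \<zeta>)) * \<sigma> (inv_into V z \<zeta>))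
           in h meromorphic_on {z x} \<and> (\<exists>\<^sub>F \<zeta> in at (z x). h \<zeta> \<noteq> 0) \<and> zorder h (z x) = ord x) \<and>
        d = (\<Sum>x | ord x \<noteq> 0. ord x))"

section \<open>Parabolic bundles\<close>

text \<open>
  \<open>flag E x j\<close> and \<open>weight E x j\<close> are the \<open>j\<close>-th filtration step and weight at \<open>x\<close>, with \<open>j\<close>
  starting from 1; \<open>len E x\<close> is the number of weights at \<open>x\<close>. Only \<open>x \<in> D\<close> matters.
\<close>

record ('x, 'n) pbundle =
  trivs :: "('x, 'n::finite) triv set"
  len :: "'x \<Rightarrow> nat"
  flag :: "'x \<Rightarrow> nat \<Rightarrow> (complex^'n) set"
  weight :: "'x \<Rightarrow> nat \<Rightarrow> real"

definition parabolic_bundle ::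
  "'x::t2_space chart set \<Rightarrow> 'x set \<Rightarrow> ('x, 'n::finite) pbundle \<Rightarrow> bool" where
  "parabolic_bundle A D E \<longleftrightarrow>
     finite D \<and> holomorphic_bundle A (trivs E) \<and>
     (\<forall>x\<in>D.
        flag E x 1 = UNIV \<and> flag E x (len E x + 1) = {0} \<and>
        (\<forall>j\<in>{1..len E x + 1}. vec.subspace (flag E x j)) \<and>
        (\<forall>j\<in>{1..len E x}. flag E x (j + 1) \<subset> flag E x j) \<and>
        (\<forall>j\<in>{1..len E x}. 0 \<le> weight E x j \<and> weight E x j < 1) \<and>
        strict_mono_on {1..len E x} (weight E x))"

definition has_parabolic_degree ::
  "'x::t2_space chart set \<Rightarrow> 'x set \<Rightarrow> ('x, 'n::finite) pbundle \<Rightarrow> real \<Rightarrow> bool" where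
  "has_parabolic_degree A D E d \<longleftrightarrow>
     (\<exists>k. has_degree A (trivs E) k \<and>
        d = of_int k + (\<Sum>x\<in>D. \<Sum>j=1..len E x.
              weight E x j * (real (vec.dim (flag E x j)) - real (vec.dim (flag E x (j + 1))))))"

text \<open>
  The step \<open>flag E x j\<close> with \<open>j\<close> the smallest index such that \<open>weight E x j \<ge> t\<close>, and
  \<open>j = len E x + 1\<close> if there is none.
\<close>

definition flag_at :: "('x, 'n::finite) pbundle \<Rightarrow> 'x \<Rightarrow> real \<Rightarrow> (complex^'n) set" where
  "flag_at E x t = flag E x (LEAST j. 1 \<le> j \<and> (j \<le> len E x \<longrightarrow> t \<le> weight E x j))"

text \<open>
  The modules \<open>E\<^bsub>x,t\<^esub>\<close>. A germ is represented by all functions that agree with it on a punctured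
  neighbourhood of \<open>x\<close>; the value at \<open>x\<close> of a representative is irrelevant (it may be a pole).
  For \<open>0 \<le> t < 1\<close> the power of the local coordinate \<open>z - z x\<close> is trivial, and the general case
  is \<open>E\<^bsub>x,t+1\<^esub> = z E\<^bsub>x,t\<^esub>\<close>.
\<close>

definition par_germs ::
  "'x::t2_space chart set \<Rightarrow> ('x, 'n::finite) pbundle \<Rightarrow> 'x \<Rightarrow> real \<Rightarrow> ('x \<Rightarrow> complex^'n) set" where
  "par_germs A E x t =
     {s. \<exists>(U, z)\<in>A. \<exists>W s'. x \<in> U \<and> open W \<and> x \<in> W \<and> hol_section A (trivs E) W s' \<and>
           s' x \<in> flag_at E x (frac t) \<and>
           (\<forall>\<^sub>F p in at x. s p = ((z p - z x) powi \<lfloor>t\<rfloor>) *s s' p)}"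

text \<open>
  Since a parabolic homomorphism is determined by its restriction to the complement of \<open>D\<close>,
  tensor products and duals are represented by a bundle on the complement of \<open>D\<close> (trivialisations
  are only used there) together with the modules of germs at the points of \<open>D\<close>.
\<close>

record ('x, 'n) filtered_bundle =
  ftrivs :: "('x, 'n::finite) triv set"
  fgerms :: "'x \<Rightarrow> real \<Rightarrow> ('x \<Rightarrow> complex^'n) set"

definition filtered ::
  "'x::t2_space chart set \<Rightarrow> ('x, 'n::finite) pbundle \<Rightarrow> ('x, 'n) filtered_bundle" where
  "filtered A E = \<lparr>ftrivs = trivs E, fgerms = par_germs A E\<rparr>"

definition par_tensor ::
  "('x::t2_space, 'n::finite) filtered_bundle \<Rightarrow> ('x, 'm::finite) filtered_bundle
     \<Rightarrow> ('x, 'n \<times> 'm) filtered_bundle" where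
  "par_tensor V W =
     \<lparr>ftrivs = tensor_trivs (ftrivs V) (ftrivs W),
      fgerms = (\<lambda>x t. {T. \<exists>(N::nat) a b u v.
         (\<forall>i<N. a i + b i = t \<and> u i \<in> fgerms V x (a i) \<and> v i \<in> fgerms W x (b i)) \<and>
         (\<forall>\<^sub>F p in at x. T p = (\<Sum>i<N. u i p \<otimes>\<^sub>v v i p))})\<rparr>"

definition mero_germs ::
  "'x::t2_space chart set \<Rightarrow> ('x, 'n::finite) triv set \<Rightarrow> 'x \<Rightarrow> ('x \<Rightarrow> complex^'n) set" where
  "mero_germs A G x =
     {s. \<exists>(U, z)\<in>A. \<exists>W s' k. x \<in> U \<and> open W \<and> x \<in> W \<and> hol_section A G W s' \<and>
           (\<forall>\<^sub>F p in at x. s p = ((z p - z x) powi k) *s s' p)}"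

text \<open>A functional is given by its coefficients: \<open>\<psi>\<close> sends \<open>s\<close> to \<open>\<Sum>i. \<psi> p $ i * s p $ i\<close>.\<close>

definition par_dual ::
  "'x::t2_space chart set \<Rightarrow> ('x, 'n::finite) pbundle \<Rightarrow> ('x, 'n) filtered_bundle" where
  "par_dual A E =
     \<lparr>ftrivs = dual_trivs (trivs E),
      fgerms = (\<lambda>x t. {\<psi>. \<psi> \<in> mero_germs A (dual_trivs (trivs E)) x \<and>
         (\<forall>a. \<forall>s\<in>par_germs A E x a. \<exists>(U, z)\<in>A. \<exists>h. x \<in> U \<and> hol_germ A x h \<and>
            (\<forall>\<^sub>F p in at x. (\<Sum>i\<in>UNIV. \<psi> p $ i * s p $ i) = (z p - z x) powi \<lceil>a + t\<rceil> * h p))})\<rparr>"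

definition par_hom ::
  "'x::t2_space chart set \<Rightarrow> 'x set \<Rightarrow> ('x, 'n::finite) filtered_bundle
     \<Rightarrow> ('x, 'm::finite) filtered_bundle \<Rightarrow> ('x \<Rightarrow> complex^'n^'m) \<Rightarrow> bool" where
  "par_hom A D V W h \<longleftrightarrow>
     hol_bundle_map A (ftrivs V) (ftrivs W) (- D) h \<and>
     (\<forall>x\<in>D. \<forall>t. \<forall>s\<in>fgerms V x t. (\<lambda>p. h p *v s p) \<in> fgerms W x t)"

definition par_iso ::
  "'x::t2_space chart set \<Rightarrow> 'x set \<Rightarrow> ('x, 'n::finite) filtered_bundle
     \<Rightarrow> ('x, 'm::finite) filtered_bundle \<Rightarrow> ('x \<Rightarrow> complex^'n^'m) \<Rightarrow> bool" where
  "par_iso A D V W h \<longleftrightarrow> par_hom A D V W h \<and>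
     (\<exists>k. par_hom A D W V k \<and> (\<forall>p\<in>- D. k p ** h p = mat 1 \<and> h p ** k p = mat 1))"

section \<open>Orthogonal and symplectic structures\<close>

text \<open>
  A line bundle is a bundle with index type \<open>1\<close>. As in \<open>par_dual\<close>, a functional is given by its
  coefficients, so \<open>form_hat \<phi> p\<close> is the matrix of \<open>u \<mapsto> \<phi>(u \<otimes> \<cdot>)\<close>.
\<close>

definition form_hat :: "('x \<Rightarrow> complex^('n \<times> 'n)^1) \<Rightarrow> 'x \<Rightarrow> complex^'n^('n \<times> 1)" where
  "form_hat \<phi> p = (\<chi> q i. \<phi> p $ snd q $ (i, fst q))"

datatype form_kind = Orthogonal | Symplectic

definition parabolic_structure ::
  "form_kind \<Rightarrow> 'x::t2_space chart set \<Rightarrow> 'x set \<Rightarrow> ('x, 1) pbundle \<Rightarrow> ('x, 'n::finite) pbundle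
     \<Rightarrow> ('x \<Rightarrow> complex^('n \<times> 'n)^1) \<Rightarrow> bool" where
  "parabolic_structure \<kappa> A D L E \<phi> \<longleftrightarrow>
     parabolic_bundle A D L \<and> has_parabolic_degree A D L 0 \<and> parabolic_bundle A D E \<and>
     par_hom A D (par_tensor (filtered A E) (filtered A E)) (filtered A L) \<phi> \<and>
     (\<forall>p\<in>- D. \<forall>u v. \<phi> p *v (u \<otimes>\<^sub>v v) =
        (case \<kappa> of Orthogonal \<Rightarrow> \<phi> p *v (v \<otimes>\<^sub>v u) | Symplectic \<Rightarrow> - (\<phi> p *v (v \<otimes>\<^sub>v u)))) \<and>
     par_iso A D (filtered A E) (par_tensor (par_dual A E) (filtered A L)) (form_hat \<phi>)"

section \<open>Higgs fields\<close>

text \<open>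
  A section of \<open>End(E) \<otimes> K\<^sub>X(D)\<close> is a section \<open>\<theta>\<close> of \<open>End(E) \<otimes> K\<^sub>X\<close> on the complement of \<open>D\<close>
  with at most simple poles at \<open>D\<close>. For a chart \<open>c = (U, z)\<close>, \<open>\<theta> c\<close> is the coefficient of \<open>dz\<close>.
  Near \<open>x \<in> D\<close> we have \<open>\<theta> = M dz / (z - z x)\<close> with \<open>M\<close> a holomorphic endomorphism, and \<open>M x\<close> is
  the value of \<open>\<theta>\<close> at \<open>x\<close> with respect to the generator \<open>dz / (z - z x)\<close> of the fibre of \<open>K\<^sub>X(D)\<close>.
\<close>

definition parabolic_higgs ::
  "'x::t2_space chart set \<Rightarrow> 'x set \<Rightarrow> ('x, 'n::finite) pbundle
     \<Rightarrow> ('x chart \<Rightarrow> 'x \<Rightarrow> complex^'n^'n) \<Rightarrow> bool" where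
  "parabolic_higgs A D E \<theta> \<longleftrightarrow>
     (\<forall>(U, z)\<in>A. \<forall>(V, w)\<in>A. \<forall>p\<in>U \<inter> V - D.
        \<theta> (U, z) p = map_matrix ((*) (deriv (w \<circ> inv_into U z) (z p))) (\<theta> (V, w) p)) \<and>
     (\<forall>(U, z)\<in>A. hol_bundle_map A (trivs E) (trivs E) (U - D) (\<theta> (U, z))) \<and>
     (\<forall>(U, z)\<in>A. \<forall>p\<in>U - D. trace (\<theta> (U, z) p) = 0) \<and>
     (\<forall>x\<in>D. \<forall>(U, z)\<in>A. x \<in> U \<longrightarrow>
        (\<exists>W M. open W \<and> x \<in> W \<and> hol_bundle_map A (trivs E) (trivs E) W M \<and>
           (\<forall>\<^sub>F p in at x. M p = map_matrix ((*) (z p - z x)) (\<theta> (U, z) p)) \<and>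
           (\<forall>j\<in>{1..len E x}. \<forall>v\<in>flag E x j. M x *v v \<in> flag E x j)))"

text \<open>
  The identity \<open>(\<phi> \<otimes> Id)(\<theta>(u) \<otimes> v) + (\<phi> \<otimes> Id)(u \<otimes> \<theta>(v)) = 0\<close> is one between meromorphic sections of
  \<open>L \<otimes> K\<^sub>X(D)\<close>, hence it is tested outside \<open>D\<close>.
\<close>

definition higgs_compatible ::
  "'x::t2_space chart set \<Rightarrow> 'x set \<Rightarrow> ('x, 'n::finite) pbundle
     \<Rightarrow> ('x \<Rightarrow> complex^('n \<times> 'n)^1) \<Rightarrow> ('x chart \<Rightarrow> 'x \<Rightarrow> complex^'n^'n) \<Rightarrow> bool" where
  "higgs_compatible A D E \<phi> \<theta> \<longleftrightarrow>
     (\<forall>W u v. open W \<and> hol_section A (trivs E) W u \<and> hol_section A (trivs E) W v \<longrightarrow>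
        (\<forall>(U, z)\<in>A. \<forall>p\<in>U \<inter> W - D.
           \<phi> p *v ((\<theta> (U, z) p *v u p) \<otimes>\<^sub>v v p) + \<phi> p *v (u p \<otimes>\<^sub>v (\<theta> (U, z) p *v v p)) = 0))"

definition higgs_field ::
  "'x::t2_space chart set \<Rightarrow> 'x set \<Rightarrow> ('x, 'n::finite) pbundle
     \<Rightarrow> ('x \<Rightarrow> complex^('n \<times> 'n)^1) \<Rightarrow> ('x chart \<Rightarrow> 'x \<Rightarrow> complex^'n^'n) \<Rightarrow> bool" where
  "higgs_field A D E \<phi> \<theta> \<longleftrightarrow> parabolic_higgs A D E \<theta> \<and> higgs_compatible A D E \<phi> \<theta>"

section \<open>Pullback\<close>

definition pullback_germs ::
  "'y::t2_space chart set \<Rightarrow> 'x::t2_space chart set \<Rightarrow> ('y \<Rightarrow> 'x) \<Rightarrow> ('x, 'n::finite) pbundle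
     \<Rightarrow> 'y \<Rightarrow> real \<Rightarrow> ('y \<Rightarrow> complex^'n) set" where
  "pullback_germs AY AX f E y s =
     {v. \<exists>(V, w)\<in>AY. \<exists>(N::nat) c k t u. y \<in> V \<and>
           (\<forall>i<N. hol_germ AY y (c i) \<and> u i \<in> par_germs AX E (f y) (t i) \<and>
                  of_int (map_mult AY AX f y) * t i + of_int (k i) \<ge> s) \<and>
           (\<forall>\<^sub>F p in at y. v p = (\<Sum>i<N. (c i p * (w p - w y) powi k i) *s u i (f p)))}"

text \<open>
  \<open>F\<close> is a pullback of \<open>E\<close>. Outside \<open>f -` D\<close> the fibre of \<open>F\<close> over \<open>y\<close> is the fibre of \<open>E\<close> over
  \<open>f y\<close>, and the trivialisations of \<open>F\<close> are holomorphically compatible with those of the usual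
  pullback; the modules of germs at the points of \<open>f -` D\<close> are the prescribed ones. In this way
  \<open>F\<close> is determined up to unique isomorphism (its fibres over \<open>f -` D\<close> are only defined through
  the germs).
\<close>

definition parabolic_pullback ::
  "'y::t2_space chart set \<Rightarrow> 'x::t2_space chart set \<Rightarrow> ('y \<Rightarrow> 'x) \<Rightarrow> 'x set
     \<Rightarrow> ('x, 'n::finite) pbundle \<Rightarrow> ('y, 'n) pbundle \<Rightarrow> bool" where
  "parabolic_pullback AY AX f D E F \<longleftrightarrow>
     parabolic_bundle AY (f -` D) F \<and>
     (\<forall>(V, h)\<in>trivs F. \<forall>(U, g)\<in>trivs E.
        hol_matrix AY (V \<inter> f -` U - f -` D) (\<lambda>y. h y ** matrix_inv (g (f y)))) \<and>
     (\<forall>y\<in>f -` D. \<forall>s. par_germs AY F y s = pullback_germs AY AX f E y s)"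

text \<open>
  The usual pullback of \<open>\<theta>\<close> outside \<open>f -` D\<close>: if \<open>\<theta> = \<theta>\<^sub>z dz\<close> near \<open>f y\<close>, its coefficient of \<open>dw\<close> at \<open>y\<close> is
  \<open>d(z \<circ> f)/dw\<close> times \<open>\<theta>\<^sub>z (f y)\<close>; this does not depend on the chosen chart around \<open>f y\<close>. The form
  \<open>\<phi>\<close> is pulled back to \<open>\<phi> \<circ> f\<close>.
\<close>

definition pullback_higgs ::
  "'x::t2_space chart set \<Rightarrow> ('y::t2_space \<Rightarrow> 'x) \<Rightarrow> ('x chart \<Rightarrow> 'x \<Rightarrow> complex^'n^'n)
     \<Rightarrow> 'y chart \<Rightarrow> 'y \<Rightarrow> complex^'n^'n" where
  "pullback_higgs AX f \<theta> = (\<lambda>(V, w) y.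
     let (U, z) = (SOME c. c \<in> AX \<and> f y \<in> fst c)
     in map_matrix ((*) (deriv (z \<circ> f \<circ> inv_into V w) (w y))) (\<theta> (U, z) (f y)))"

end

theory Submission
  imports Defs
begin

text \<open>
  Near a parabolic point \<open>x\<close> every parabolic bundle has an adapted frame: a frame \<open>e\<^sub>i\<close> together with
  real numbers \<open>\<gamma>\<^sub>i\<close> such that \<open>E\<^bsub>x,t\<^esub>\<close> consists of the combinations of the \<open>e\<^sub>i\<close> whose \<open>i\<close>-th
  coefficient has order at least \<open>\<lceil>t - \<gamma>\<^sub>i\<rceil>\<close>. Duals and tensor products have the adapted frames
  with the numbers \<open>- \<gamma>\<^sub>i\<close> and \<open>\<gamma>\<^sub>i + \<delta>\<^sub>j\<close>, and if \<open>f\<close> has multiplicity \<open>m\<close> at \<open>y\<close>, then the frame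
  \<open>e\<^sub>i \<circ> f\<close> with the numbers \<open>m \<gamma>\<^sub>i\<close> is adapted to the pullback. A bundle map respects the
  filtrations iff its matrix entries have order at least \<open>\<lceil>\<gamma>\<^sub>i - \<delta>\<^sub>j\<rceil>\<close>, and since
  \<open>m \<lceil>a\<rceil> \<ge> \<lceil>m a\<rceil>\<close> this property passes to the pullback; it is applied to \<open>\<phi>\<close>, to the isomorphism
  it induces and its inverse, and to the residue of \<open>\<theta>\<close>. The parabolic degree is multiplied
  by the degree of \<open>f\<close>, because the order of a meromorphic section of \<open>L\<close> plus the weight gets multiplied
  by \<open>m\<close>, and the sum of the multiplicities over a fibre is constant.
\<close>

section \<open>Germs of holomorphic functions\<close>

text \<open>The claim concerns every bundle \<open>F\<close> with the prescribed germs, so over the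
  preimage of \<open>D\<close> its fibres, trivialisations and flags are known only through the
  modules of germs. All conditions there are therefore turned into orders of matrix entries in a
  frame on a punctured neighbourhood, and what must be regular at the point, such as the residue of
  the pulled-back Higgs field with its action on the flag, is recovered from its action on germs.
  The numbers attached to a frame have to be arbitrary reals: duals change their sign, tensor
  products add them and a map of multiplicity \<open>m\<close> multiplies them by \<open>m\<close>,
  so the range [0, 1) of weights is left at once. It is restored only where a pullback is
  constructed, by twisting the frame with integral powers of the coordinate. The calculus rests on
  \<lceil>a + b\<rceil> \<le> \<lceil>a\<rceil> + \<lceil>b\<rceil>. For a line bundle the weight of
  the pullback is \<open>m\<close> times the old weight only up to an integer, which the order of a
  section compensates; degree and weights thus cannot be treated separately.\<close>

locale surface =
  fixes A :: "'x::t2_space chart set"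
  assumes surface: "riemann_surface A"
begin

lemma chartD:
  assumes "(U, z) \<in> A"
  shows "open U" "open (z ` U)" "continuous_on U z" "continuous_on (z ` U) (inv_into U z)"
    "\<And>p. p \<in> U \<Longrightarrow> inv_into U z (z p) = p" "\<And>\<zeta>. \<zeta> \<in> z ` U \<Longrightarrow> z (inv_into U z \<zeta>) = \<zeta>"
    "\<And>\<zeta>. \<zeta> \<in> z ` U \<Longrightarrow> inv_into U z \<zeta> \<in> U" "inj_on z U"
proof -
  from assms surface have *: "open U" "open (z ` U)" "homeomorphism U (z ` U) z (inv_into U z)"
    unfolding riemann_surface_def by fast+
  then show "open U" "open (z ` U)" "continuous_on U z" "continuous_on (z ` U) (inv_into U z)"
    by (auto simp: homeomorphism_def)
  show inv: "inv_into U z (z p) = p" if "p \<in> U" for p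
    using * that by (auto simp: homeomorphism_def)
  show "z (inv_into U z \<zeta>) = \<zeta>" if "\<zeta> \<in> z ` U" for \<zeta> using that by (rule f_inv_into_f)
  show "inv_into U z \<zeta> \<in> U" if "\<zeta> \<in> z ` U" for \<zeta> using that by (rule inv_into_into)
  show "inj_on z U" by (metis inv inj_on_inverseI)
qed

lemma open_chart_image:
  assumes "(U, z) \<in> A" "open W"
  shows "open (z ` (U \<inter> W))"
proof -
  have "z ` (U \<inter> W) = z ` U \<inter> inv_into U z -` W"
    using chartD(5,6,7)[OF assms(1)] by force
  moreover have "open (z ` U \<inter> inv_into U z -` W)"
    using chartD(2,4)[OF assms(1)] assms(2) by (simp add: continuous_on_open_vimage Int_commute)
  ultimately show ?thesis by simp
qed

lemma open_chart_vimage: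
  assumes "(U, z) \<in> A" "open T"
  shows "open (U \<inter> z -` T)"
  using chartD(1,3)[OF assms(1)] assms(2) by (simp add: continuous_on_open_vimage Int_commute)

lemma chart_ex: "\<exists>U z. (U, z) \<in> A \<and> x \<in> U"
  using surface unfolding riemann_surface_def by fast

lemma eventually_nhds_chart:
  assumes c: "(U, z) \<in> A" and x: "x \<in> U"
  shows "(\<forall>\<^sub>F p in nhds x. P p) \<longleftrightarrow> (\<forall>\<^sub>F \<zeta> in nhds (z x). P (inv_into U z \<zeta>))"
proof
  assume "\<forall>\<^sub>F p in nhds x. P p"
  then obtain S where S: "open S" "x \<in> S" "\<And>p. p \<in> S \<Longrightarrow> P p" by (auto simp: eventually_nhds)
  show "\<forall>\<^sub>F \<zeta> in nhds (z x). P (inv_into U z \<zeta>)"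
    unfolding eventually_nhds
    by (rule exI[of _ "z ` (U \<inter> S)"]) (use S x chartD(5)[OF c] open_chart_image[OF c] in auto)
next
  assume "\<forall>\<^sub>F \<zeta> in nhds (z x). P (inv_into U z \<zeta>)"
  then obtain T where T: "open T" "z x \<in> T" "\<And>\<zeta>. \<zeta> \<in> T \<Longrightarrow> P (inv_into U z \<zeta>)"
    by (auto simp: eventually_nhds)
  show "\<forall>\<^sub>F p in nhds x. P p"
    unfolding eventually_nhds
    by (rule exI[of _ "U \<inter> z -` T"])
      (use T x chartD(5)[OF c] open_chart_vimage[OF c] in \<open>auto, metis\<close>)
qed

text \<open>Injectivity of the chart makes \<open>\<zeta> \<noteq> z x\<close> equivalent to
  \<open>inv_into U z \<zeta> \<noteq> x\<close>, but only on the image of \<open>U\<close>, since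
  \<open>inv_into\<close> is arbitrary elsewhere.\<close>

lemma eventually_at_chart:
  assumes c: "(U, z) \<in> A" and x: "x \<in> U"
  shows "(\<forall>\<^sub>F p in at x. P p) \<longleftrightarrow> (\<forall>\<^sub>F \<zeta> in at (z x). P (inv_into U z \<zeta>))"
proof -
  have "(\<forall>\<^sub>F p in at x. P p) \<longleftrightarrow> (\<forall>\<^sub>F \<zeta> in nhds (z x). inv_into U z \<zeta> \<noteq> x \<longrightarrow> P (inv_into U z \<zeta>))"
    by (simp add: eventually_at_filter eventually_nhds_chart[OF c x])
  also have "\<dots> \<longleftrightarrow> (\<forall>\<^sub>F \<zeta> in nhds (z x). \<zeta> \<noteq> z x \<longrightarrow> P (inv_into U z \<zeta>))"
  proof (rule eventually_cong)
    show "\<forall>\<^sub>F \<zeta> in nhds (z x). \<zeta> \<in> z ` U"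
      using chartD(2)[OF c] x by (auto intro: eventually_nhds_in_open)
  qed (use chartD(5,6)[OF c] x in metis)
  finally show ?thesis by (simp add: eventually_at_filter)
qed

text \<open>A surface has no isolated points. Limits along punctured neighbourhoods are therefore
  unique, and a holomorphic germ is determined at \<open>x\<close> by its values off
  \<open>x\<close>.\<close>

lemma at_neq_bot [simp]: "at (x::'x) \<noteq> bot"
proof -
  obtain U z where c: "(U, z) \<in> A" "x \<in> U" using chart_ex by blast
  have "\<not> (\<forall>\<^sub>F p in at x. False)" by (simp add: eventually_at_chart[OF c])
  then show ?thesis by auto
qed

lemma hol_transition:
  assumes "(U, z) \<in> A" "(V, w) \<in> A"
  shows "(w \<circ> inv_into U z) holomorphic_on z ` (U \<inter> V)"
  using surface assms unfolding riemann_surface_def by fast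

text \<open>One chart suffices: holomorphy in every other chart follows by composing with the
  transition function.\<close>

lemma hol_germ_iff:
  assumes c: "(U, z) \<in> A" and x: "x \<in> U"
  shows "hol_germ A x h \<longleftrightarrow> (\<lambda>\<zeta>. h (inv_into U z \<zeta>)) analytic_on {z x}"
proof
  assume "hol_germ A x h"
  then obtain W where W: "open W" "x \<in> W" "hol_fun A W h" unfolding hol_germ_def by blast
  then have "(h \<circ> inv_into U z) holomorphic_on z ` (U \<inter> W)"
    using c unfolding hol_fun_def by fast
  then show "(\<lambda>\<zeta>. h (inv_into U z \<zeta>)) analytic_on {z x}"
    unfolding analytic_at using open_chart_image[OF c W(1)] W(2) x by (auto simp: o_def)
next
  assume "(\<lambda>\<zeta>. h (inv_into U z \<zeta>)) analytic_on {z x}"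
  then obtain S where S: "open S" "z x \<in> S" "(\<lambda>\<zeta>. h (inv_into U z \<zeta>)) holomorphic_on S"
    unfolding analytic_at by auto
  let ?W = "U \<inter> z -` S"
  have "(h \<circ> inv_into V w) holomorphic_on w ` (V \<inter> ?W)" if d: "(V, w) \<in> A" for V w
  proof -
    have "(z \<circ> inv_into V w) holomorphic_on w ` (V \<inter> ?W)"
      using hol_transition[OF d c] by (rule holomorphic_on_subset) auto
    moreover have "(z \<circ> inv_into V w) ` w ` (V \<inter> ?W) \<subseteq> S" using chartD(5)[OF d] by auto
    ultimately have "((\<lambda>\<zeta>. h (inv_into U z \<zeta>)) \<circ> (z \<circ> inv_into V w)) holomorphic_on w ` (V \<inter> ?W)"
      using S(3) holomorphic_on_compose_gen by blast
    then show ?thesis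
      by (rule holomorphic_transform) (use chartD(5)[OF d] chartD(5)[OF c] in auto)
  qed
  then show "hol_germ A x h"
    unfolding hol_germ_def hol_fun_def
    by (intro exI[of _ ?W]) (use open_chart_vimage[OF c S(1)] x S(2) in auto)
qed

text \<open>Holomorphy on an open set is a property of germs. In this form the definitions, which
  quantify over all charts, can be combined point by point.\<close>

lemma hol_fun_iff:
  assumes "open W"
  shows "hol_fun A W h \<longleftrightarrow> (\<forall>p\<in>W. hol_germ A p h)"
proof
  assume "hol_fun A W h" then show "\<forall>p\<in>W. hol_germ A p h"
    using assms unfolding hol_germ_def by blast
next
  assume *: "\<forall>p\<in>W. hol_germ A p h"
  have "(h \<circ> inv_into U z) holomorphic_on z ` (U \<inter> W)" if c: "(U, z) \<in> A" for U z
    unfolding o_def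
  proof (intro analytic_imp_holomorphic, subst analytic_on_analytic_at, clarify)
    fix p assume "p \<in> U" "p \<in> W"
    with * show "(\<lambda>\<zeta>. h (inv_into U z \<zeta>)) analytic_on {z p}"
      using hol_germ_iff[OF c \<open>p \<in> U\<close>, of h] by blast
  qed
  then show "hol_fun A W h" unfolding hol_fun_def by blast
qed

lemma hol_germ_cong:
  assumes "\<forall>\<^sub>F p in nhds x. h p = k p"
  shows "hol_germ A x h \<longleftrightarrow> hol_germ A x k"
proof -
  obtain U z where c: "(U, z) \<in> A" "x \<in> U" using chart_ex by blast
  show ?thesis unfolding hol_germ_iff[OF c]
    by (rule analytic_at_cong) (use assms eventually_nhds_chart[OF c] in simp_all)
qed

lemma hol_germ_nhds:
  assumes "hol_germ A x h" shows "\<forall>\<^sub>F p in nhds x. hol_germ A p h"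
proof -
  obtain W where W: "open W" "x \<in> W" "hol_fun A W h" using assms unfolding hol_germ_def by blast
  then have "\<forall>p\<in>W. hol_germ A p h" using hol_fun_iff[OF W(1)] by blast
  with W show ?thesis unfolding eventually_nhds by (intro exI[of _ W]) simp
qed

lemma hol_germ_const [simp, intro]: "hol_germ A x (\<lambda>_. c)"
proof -
  obtain U z where c: "(U, z) \<in> A" "x \<in> U" using chart_ex by blast
  show ?thesis unfolding hol_germ_iff[OF c] by (rule analytic_on_const)
qed

lemma hol_germ_add [intro]: "hol_germ A x h \<Longrightarrow> hol_germ A x k \<Longrightarrow> hol_germ A x (\<lambda>p. h p + k p)"
  and hol_germ_diff [intro]: "hol_germ A x h \<Longrightarrow> hol_germ A x k \<Longrightarrow> hol_germ A x (\<lambda>p. h p - k p)"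
  and hol_germ_mult [intro]: "hol_germ A x h \<Longrightarrow> hol_germ A x k \<Longrightarrow> hol_germ A x (\<lambda>p. h p * k p)"
  and hol_germ_power [intro]: "hol_germ A x h \<Longrightarrow> hol_germ A x (\<lambda>p. h p ^ n)"
  and hol_germ_inverse: "hol_germ A x h \<Longrightarrow> h x \<noteq> 0 \<Longrightarrow> hol_germ A x (\<lambda>p. inverse (h p))"
proof -
  obtain U z where c: "(U, z) \<in> A" "x \<in> U" using chart_ex by blast
  note [simp] = hol_germ_iff[OF c] chartD(5)[OF c]
  show "hol_germ A x h \<Longrightarrow> hol_germ A x k \<Longrightarrow> hol_germ A x (\<lambda>p. h p + k p)"
    "hol_germ A x h \<Longrightarrow> hol_germ A x k \<Longrightarrow> hol_germ A x (\<lambda>p. h p - k p)"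
    "hol_germ A x h \<Longrightarrow> hol_germ A x k \<Longrightarrow> hol_germ A x (\<lambda>p. h p * k p)"
    "hol_germ A x h \<Longrightarrow> hol_germ A x (\<lambda>p. h p ^ n)"
    "hol_germ A x h \<Longrightarrow> h x \<noteq> 0 \<Longrightarrow> hol_germ A x (\<lambda>p. inverse (h p))"
    by (auto intro!: analytic_intros)
qed

lemma hol_germ_divide:
  "hol_germ A x h \<Longrightarrow> hol_germ A x k \<Longrightarrow> k x \<noteq> 0 \<Longrightarrow> hol_germ A x (\<lambda>p. h p / k p)"
  unfolding divide_inverse by (intro hol_germ_mult hol_germ_inverse)

lemma hol_germ_sum [intro]: "(\<And>i. i \<in> I \<Longrightarrow> hol_germ A x (h i)) \<Longrightarrow> hol_germ A x (\<lambda>p. \<Sum>i\<in>I. h i p)"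
  by (induction I rule: infinite_finite_induct) auto

lemma hol_germ_prod [intro]: "(\<And>i. i \<in> I \<Longrightarrow> hol_germ A x (h i)) \<Longrightarrow> hol_germ A x (\<lambda>p. \<Prod>i\<in>I. h i p)"
  by (induction I rule: infinite_finite_induct) auto

lemma hol_germ_power_int:
  "hol_germ A x h \<Longrightarrow> h x \<noteq> 0 \<Longrightarrow> hol_germ A x (\<lambda>p. h p powi k)"
  unfolding power_int_def by (cases "0 \<le> k") (simp_all add: hol_germ_power hol_germ_inverse)

lemma hol_germ_isCont: "hol_germ A x h \<Longrightarrow> isCont h x"
proof -
  assume h: "hol_germ A x h"
  obtain U z where c: "(U, z) \<in> A" "x \<in> U" using chart_ex by blast
  have "isCont (\<lambda>\<zeta>. h (inv_into U z \<zeta>)) (z x)"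
    using h hol_germ_iff[OF c] analytic_at_imp_isCont by blast
  moreover have "isCont z x" using chartD(1,3)[OF c(1)] c(2) continuous_on_eq_continuous_at by blast
  ultimately have "isCont (\<lambda>p. h (inv_into U z (z p))) x"
    using isCont_o2 by blast
  moreover have "\<forall>\<^sub>F p in nhds x. h (inv_into U z (z p)) = h p"
    using eventually_nhds_in_open[OF chartD(1)[OF c(1)] c(2)]
    by eventually_elim (use chartD(5)[OF c(1)] in auto)
  ultimately show ?thesis by (simp add: isCont_cong)
qed

lemma hol_germ_nonzero: "hol_germ A x h \<Longrightarrow> h x \<noteq> 0 \<Longrightarrow> \<forall>\<^sub>F p in nhds x. h p \<noteq> 0"
proof -
  assume h: "hol_germ A x h" "h x \<noteq> 0"
  then have "(h \<longlongrightarrow> h x) (nhds x)"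
    using hol_germ_isCont isCont_def tendsto_at_iff_tendsto_nhds by blast
  then show ?thesis using h(2) by (rule tendsto_imp_eventually_ne)
qed

text \<open>Both germs are continuous at \<open>x\<close>. Identities known only on a punctured
  neighbourhood are carried over to the point in this way.\<close>

lemma hol_germ_eq_at:
  assumes "hol_germ A x h" "hol_germ A x k" "\<forall>\<^sub>F p in at x. h p = k p"
  shows "h x = k x"
proof (rule tendsto_unique[of "at x"])
  show "(h \<longlongrightarrow> h x) (at x)" using hol_germ_isCont[OF assms(1)] isCont_def by blast
  have "(k \<longlongrightarrow> k x) (at x)" using hol_germ_isCont[OF assms(2)] isCont_def by blast
  then show "(h \<longlongrightarrow> k x) (at x)" using assms(3) by (simp add: tendsto_cong)
qed simp

section \<open>Orders of zeros and poles at a point\<close>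

definition chart_at :: "'x \<Rightarrow> 'x chart" where
  "chart_at x = (SOME c. c \<in> A \<and> x \<in> fst c)"

text \<open>A local coordinate centred at \<open>x\<close>, from a choice of chart made once and for
  all. At \<open>f y\<close> this is also the chart that \<open>pullback_higgs\<close> selects,
  because \<open>chart_at\<close> is the same \<open>SOME\<close>-term.\<close>

definition coord :: "'x \<Rightarrow> 'x \<Rightarrow> complex" where
  "coord x p = snd (chart_at x) p - snd (chart_at x) x"

lemma chart_at: "chart_at x \<in> A" "x \<in> fst (chart_at x)"
proof -
  obtain U z where "(U, z) \<in> A" "x \<in> U" using chart_ex by blast
  then have "\<exists>c. c \<in> A \<and> x \<in> fst c" by force
  then have "chart_at x \<in> A \<and> x \<in> fst (chart_at x)" unfolding chart_at_def by (rule someI_ex)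
  then show "chart_at x \<in> A" "x \<in> fst (chart_at x)" by auto
qed

lemma hol_germ_chart:
  assumes c: "(U, z) \<in> A" and x: "x \<in> U" shows "hol_germ A x z"
proof -
  have "(\<lambda>\<zeta>. z (inv_into U z \<zeta>)) analytic_on {z x} \<longleftrightarrow> (\<lambda>\<zeta>. \<zeta>) analytic_on {z x}"
  proof (rule analytic_at_cong)
    show "\<forall>\<^sub>F \<zeta> in nhds (z x). z (inv_into U z \<zeta>) = \<zeta>"
      using eventually_nhds_in_open[OF chartD(2)[OF c], of "z x"] x chartD(6)[OF c]
      by (auto elim: eventually_mono)
  qed simp
  then show ?thesis using hol_germ_iff[OF c x] by simp
qed

lemma chart_neq: "(U, z) \<in> A \<Longrightarrow> x \<in> U \<Longrightarrow> \<forall>\<^sub>F p in at x. z p \<noteq> z x"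
  unfolding eventually_at_filter
  by (rule eventually_mono[OF eventually_nhds_in_open[of U]])
    (use chartD(1,8) in \<open>auto simp: inj_on_def\<close>)

lemma hol_germ_coord [simp, intro]: "hol_germ A x (coord x)"
  unfolding coord_def using chart_at[of x]
  by (cases "chart_at x") (simp add: hol_germ_diff hol_germ_chart)

lemma coord_self [simp]: "coord x x = 0"
  by (simp add: coord_def)

lemma coord_neq: "\<forall>\<^sub>F p in at x. coord x p \<noteq> 0"
  using chart_at[of x] chart_neq[of "fst (chart_at x)" "snd (chart_at x)" x]
  by (auto simp: coord_def)

lemma hol_germ_comp_chart:
  assumes c: "(U, z) \<in> A" and x: "x \<in> U" and q: "q analytic_on {z x}"
  shows "hol_germ A x (\<lambda>p. q (z p))"
proof -
  have "\<forall>\<^sub>F \<zeta> in nhds (z x). q (z (inv_into U z \<zeta>)) = q \<zeta>"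
    using eventually_nhds_in_open[OF chartD(2)[OF c], of "z x"] x chartD(6)[OF c]
    by (auto elim: eventually_mono)
  then show ?thesis unfolding hol_germ_iff[OF c x] using q analytic_at_cong[OF _ refl] by metis
qed

text \<open>Division by the coordinate: the difference quotient, completed by the derivative at the
  centre, is analytic by removability of the singularity.\<close>

lemma hol_germ_zero_chart_factor:
  assumes c: "(U, z) \<in> A" and x: "x \<in> U" and h: "hol_germ A x h" "h x = 0"
  shows "\<exists>k. hol_germ A x k \<and> (\<forall>\<^sub>F p in nhds x. h p = (z p - z x) * k p)"
proof -
  define g where "g = (\<lambda>\<zeta>. h (inv_into U z \<zeta>))"
  define q where "q = (\<lambda>\<zeta>. if \<zeta> = z x then deriv g (z x) else g \<zeta> / (\<zeta> - z x))"
  have g: "g analytic_on {z x}" "g (z x) = 0"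
    using h hol_germ_iff[OF c x] chartD(5)[OF c x] by (auto simp: g_def)
  have gq: "g \<zeta> = (\<zeta> - z x) * q \<zeta>" for \<zeta> using g(2) by (simp add: q_def)
  have q: "q analytic_on {z x}"
    by (rule pole_theorem_analytic_0[OF g(1), where a = "z x"])
      (use gq g(2) in \<open>auto simp: q_def intro!: exI[of _ 1]\<close>)
  have ev: "\<forall>\<^sub>F p in nhds x. inv_into U z (z p) = p"
    using eventually_nhds_in_open[OF chartD(1)[OF c] x] by eventually_elim (use chartD(5)[OF c] in auto)
  have "hol_germ A x (\<lambda>p. q (z p))" by (rule hol_germ_comp_chart[OF c x q])
  moreover have "\<forall>\<^sub>F p in nhds x. h p = (z p - z x) * q (z p)"
    using ev by eventually_elim (metis g_def gq)
  ultimately show ?thesis by blast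
qed

lemma hol_germ_zero_factor:
  assumes h: "hol_germ A x h" "h x = 0"
  shows "\<exists>k. hol_germ A x k \<and> (\<forall>\<^sub>F p in nhds x. h p = coord x p * k p)"
  using hol_germ_zero_chart_factor[of "fst (chart_at x)" "snd (chart_at x)" x, OF _ _ h] chart_at[of x]
  by (simp add: coord_def)

text \<open>Orders are defined for functions known only on a punctured neighbourhood, with poles
  allowed. The zero germ satisfies \<open>ordge\<close> for every \<open>k\<close> and
  \<open>ordeq\<close> for none.\<close>

definition ordge :: "'x \<Rightarrow> int \<Rightarrow> ('x \<Rightarrow> complex) \<Rightarrow> bool" where
  "ordge x k h \<longleftrightarrow> (\<exists>c. hol_germ A x c \<and> (\<forall>\<^sub>F p in at x. h p = coord x p powi k * c p))"

definition ordeq :: "'x \<Rightarrow> int \<Rightarrow> ('x \<Rightarrow> complex) \<Rightarrow> bool" where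
  "ordeq x k h \<longleftrightarrow> (\<exists>c. hol_germ A x c \<and> c x \<noteq> 0 \<and> (\<forall>\<^sub>F p in at x. h p = coord x p powi k * c p))"

lemma ordeq_imp_ordge: "ordeq x k h \<Longrightarrow> ordge x k h"
  unfolding ordeq_def ordge_def by blast

lemma ordge_cong: "\<forall>\<^sub>F p in at x. h p = h' p \<Longrightarrow> ordge x k h \<longleftrightarrow> ordge x k h'"
proof -
  assume "\<forall>\<^sub>F p in at x. h p = h' p"
  then have "(\<forall>\<^sub>F p in at x. h p = c p) \<longleftrightarrow> (\<forall>\<^sub>F p in at x. h' p = c p)" for c
    by (rule eventually_cong) simp
  then show ?thesis unfolding ordge_def by simp
qed

lemma ordeq_cong: "\<forall>\<^sub>F p in at x. h p = h' p \<Longrightarrow> ordeq x k h \<longleftrightarrow> ordeq x k h'"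
proof -
  assume "\<forall>\<^sub>F p in at x. h p = h' p"
  then have "(\<forall>\<^sub>F p in at x. h p = c p) \<longleftrightarrow> (\<forall>\<^sub>F p in at x. h' p = c p)" for c
    by (rule eventually_cong) simp
  then show ?thesis unfolding ordeq_def by simp
qed

lemma ordge_mult: "ordge x k g \<Longrightarrow> ordge x l h \<Longrightarrow> ordge x (k + l) (\<lambda>p. g p * h p)"
proof -
  assume "ordge x k g" "ordge x l h"
  then obtain c d where c: "hol_germ A x c" "\<forall>\<^sub>F p in at x. g p = coord x p powi k * c p"
    and d: "hol_germ A x d" "\<forall>\<^sub>F p in at x. h p = coord x p powi l * d p" unfolding ordge_def by blast
  have "\<forall>\<^sub>F p in at x. g p * h p = coord x p powi (k + l) * (c p * d p)"
    using c(2) d(2) coord_neq by eventually_elim (simp add: power_int_add)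
  then show ?thesis unfolding ordge_def using c(1) d(1) by blast
qed

lemma ordeq_mult: "ordeq x k g \<Longrightarrow> ordeq x l h \<Longrightarrow> ordeq x (k + l) (\<lambda>p. g p * h p)"
proof -
  assume "ordeq x k g" "ordeq x l h"
  then obtain c d where c: "hol_germ A x c" "c x \<noteq> 0" "\<forall>\<^sub>F p in at x. g p = coord x p powi k * c p"
    and d: "hol_germ A x d" "d x \<noteq> 0" "\<forall>\<^sub>F p in at x. h p = coord x p powi l * d p"
    unfolding ordeq_def by blast
  have "\<forall>\<^sub>F p in at x. g p * h p = coord x p powi (k + l) * (c p * d p)"
    using c(3) d(3) coord_neq by eventually_elim (simp add: power_int_add)
  then show ?thesis unfolding ordeq_def
    by (intro exI[of _ "\<lambda>p. c p * d p"]) (use c(1,2) d(1,2) in auto)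
qed

lemma ordeq_powi: "ordeq x k g \<Longrightarrow> ordeq x (k * l) (\<lambda>p. g p powi l)"
proof -
  assume "ordeq x k g"
  then obtain c where c: "hol_germ A x c" "c x \<noteq> 0" "\<forall>\<^sub>F p in at x. g p = coord x p powi k * c p"
    unfolding ordeq_def by blast
  have "\<forall>\<^sub>F p in at x. g p powi l = coord x p powi (k * l) * (c p powi l)"
    using c(3) by eventually_elim (simp add: power_int_mult_distrib power_int_mult)
  then show ?thesis unfolding ordeq_def
    by (intro exI[of _ "\<lambda>p. c p powi l"]) (use c(1,2) in \<open>auto intro: hol_germ_power_int\<close>)
qed

lemma ordeq_coord: "ordeq x k (\<lambda>p. coord x p powi k)"
  unfolding ordeq_def by (rule exI[of _ "\<lambda>_. 1"]) auto

lemma hol_imp_ordge: "hol_germ A x h \<Longrightarrow> ordge x 0 h"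
  unfolding ordge_def by (rule exI[of _ h]) auto

lemma unit_imp_ordeq: "hol_germ A x h \<Longrightarrow> h x \<noteq> 0 \<Longrightarrow> ordeq x 0 h"
  unfolding ordeq_def by (rule exI[of _ h]) auto

lemma ordge_zero [simp]: "ordge x k (\<lambda>_. 0)"
  unfolding ordge_def by (rule exI[of _ "\<lambda>_. 0"]) auto

lemma ordge_add: "ordge x k g \<Longrightarrow> ordge x k h \<Longrightarrow> ordge x k (\<lambda>p. g p + h p)"
proof -
  assume "ordge x k g" "ordge x k h"
  then obtain c d where c: "hol_germ A x c" "\<forall>\<^sub>F p in at x. g p = coord x p powi k * c p"
    and d: "hol_germ A x d" "\<forall>\<^sub>F p in at x. h p = coord x p powi k * d p" unfolding ordge_def by blast
  have "\<forall>\<^sub>F p in at x. g p + h p = coord x p powi k * (c p + d p)"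
    using c(2) d(2) by eventually_elim (simp add: algebra_simps)
  then show ?thesis unfolding ordge_def using c(1) d(1) by blast
qed

lemma ordge_sum: "(\<And>i. i \<in> I \<Longrightarrow> ordge x k (h i)) \<Longrightarrow> ordge x k (\<lambda>p. \<Sum>i\<in>I. h i p)"
  by (induction I rule: infinite_finite_induct) (auto intro: ordge_add)

lemma ordge_mono: "ordge x k h \<Longrightarrow> l \<le> k \<Longrightarrow> ordge x l h"
proof -
  assume h: "ordge x k h" and l: "l \<le> k"
  from h obtain c where c: "hol_germ A x c" "\<forall>\<^sub>F p in at x. h p = coord x p powi k * c p"
    unfolding ordge_def by blast
  have "\<forall>\<^sub>F p in at x. h p = coord x p powi l * (coord x p ^ nat (k - l) * c p)"
    using c(2) coord_neq
  proof eventually_elim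
    case (elim p)
    have "coord x p powi k = coord x p powi (l + (k - l))" by simp
    also have "\<dots> = coord x p powi l * coord x p ^ nat (k - l)"
      using elim(2) l by (subst power_int_add) (simp_all add: power_int_def[of _ "k - l"])
    finally show ?case using elim(1) by simp
  qed
  then show ?thesis unfolding ordge_def
    by (intro exI[of _ "\<lambda>p. coord x p ^ nat (k - l) * c p"] conjI hol_germ_mult hol_germ_power
        hol_germ_coord c(1))
qed

lemma ordge_mult_ge: "ordge x k g \<Longrightarrow> ordge x l h \<Longrightarrow> m \<le> k + l \<Longrightarrow> ordge x m (\<lambda>p. g p * h p)"
  using ordge_mult ordge_mono by blast

text \<open>If \<open>l\<close> were larger than \<open>k\<close>, cancelling the common power would
  make a germ that is nonzero at \<open>x\<close> a multiple of the coordinate.\<close>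

lemma ordeq_ordge_le: "ordeq x k h \<Longrightarrow> ordge x l h \<Longrightarrow> l \<le> k"
proof (rule ccontr)
  assume h: "ordeq x k h" "ordge x l h" "\<not> l \<le> k"
  from h(2,3) have "ordge x (k + 1) h" using ordge_mono by force
  then obtain d where d: "hol_germ A x d" "\<forall>\<^sub>F p in at x. h p = coord x p powi (k + 1) * d p"
    unfolding ordge_def by blast
  obtain c where c: "hol_germ A x c" "c x \<noteq> 0" "\<forall>\<^sub>F p in at x. h p = coord x p powi k * c p"
    using h(1) unfolding ordeq_def by blast
  have "\<forall>\<^sub>F p in at x. c p = coord x p * d p"
    using c(3) d(2) coord_neq by eventually_elim (auto simp: power_int_add)
  then have "c x = coord x x * d x"
    using c(1) d(1) by (intro hol_germ_eq_at) auto
  then show False using c(2) by simp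
qed

lemma ordeq_unique: "ordeq x k h \<Longrightarrow> ordeq x l h \<Longrightarrow> k = l"
  by (meson ordeq_imp_ordge ordeq_ordge_le order_antisym)

lemma ordge_0E:
  assumes "ordge x 0 h"
  obtains c where "hol_germ A x c" "\<forall>\<^sub>F p in at x. h p = c p"
  using assms unfolding ordge_def by auto

lemma ordeq_chart:
  assumes c: "(U, z) \<in> A" and x: "x \<in> U"
  shows "\<exists>k. hol_germ A x k \<and> k x \<noteq> 0 \<and> (\<forall>\<^sub>F p in nhds x. z p - z x = coord x p * k p)"
proof -
  have "hol_germ A x (\<lambda>p. z p - z x)" using hol_germ_chart[OF c x] by auto
  then obtain k where k: "hol_germ A x k" "\<forall>\<^sub>F p in nhds x. z p - z x = coord x p * k p"
    using hol_germ_zero_factor by fastforce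
  obtain l where l: "hol_germ A x l" "\<forall>\<^sub>F p in nhds x. coord x p = (z p - z x) * l p"
    using hol_germ_zero_chart_factor[OF c x hol_germ_coord] by auto
  \<comment> \<open>Each of the two coordinates is a holomorphic multiple of the other. The
    quotients are inverse to each other off \<open>x\<close>, hence also at \<open>x\<close>, so
    \<open>k\<close> is a unit.\<close>
  have "\<forall>\<^sub>F p in at x. k p * l p = 1"
    using k(2)[THEN eventually_nhds_conv_at[THEN iffD1, THEN conjunct1]]
      l(2)[THEN eventually_nhds_conv_at[THEN iffD1, THEN conjunct1]] coord_neq
    by eventually_elim (metis mult.assoc mult_cancel_left1 mult.commute)
  then have "k x * l x = 1" using k(1) l(1) by (intro hol_germ_eq_at) auto
  then show ?thesis using k by (intro exI[of _ k]) auto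
qed

lemma ordeq_chart_powi:
  assumes c: "(U, z) \<in> A" and x: "x \<in> U"
  shows "ordeq x k (\<lambda>p. (z p - z x) powi k)"
proof -
  have "ordeq x 1 (\<lambda>p. z p - z x)"
    using ordeq_chart[OF assms] unfolding ordeq_def
    by (auto simp: eventually_nhds_conv_at)
  from ordeq_powi[OF this, of k] show ?thesis by simp
qed

text \<open>Any two local coordinates differ by a unit. Hence order conditions may be written in
  whatever chart a definition happens to supply.\<close>

lemma ordge_iff_chart:
  assumes c: "(U, z) \<in> A" and x: "x \<in> U"
  shows "ordge x k h \<longleftrightarrow> (\<exists>c. hol_germ A x c \<and> (\<forall>\<^sub>F p in at x. h p = (z p - z x) powi k * c p))"
proof
  assume h: "ordge x k h"
  obtain c where c': "hol_germ A x c" "\<forall>\<^sub>F p in at x. (z p - z x) powi (-k) * h p = c p"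
    using ordge_0E[OF ordge_mult_ge[OF ordeq_imp_ordge[OF ordeq_chart_powi[OF assms, of "-k"]] h, of 0]]
    by auto
  have "\<forall>\<^sub>F p in at x. h p = (z p - z x) powi k * c p"
    using c'(2) chart_neq[OF assms]
    by eventually_elim (auto simp: power_int_minus field_simps)
  then show "\<exists>c. hol_germ A x c \<and> (\<forall>\<^sub>F p in at x. h p = (z p - z x) powi k * c p)" using c' by blast
next
  assume "\<exists>c. hol_germ A x c \<and> (\<forall>\<^sub>F p in at x. h p = (z p - z x) powi k * c p)"
  then obtain d where d: "hol_germ A x d" "\<forall>\<^sub>F p in at x. h p = (z p - z x) powi k * d p" by blast
  have "ordge x k (\<lambda>p. (z p - z x) powi k * d p)"
    using ordge_mult[OF ordeq_imp_ordge[OF ordeq_chart_powi[OF assms, of k]] hol_imp_ordge[OF d(1)]] by simp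
  then show "ordge x k h" using ordge_cong[OF d(2)] by simp
qed

end

section \<open>Linear algebra of frames and flags\<close>

lemma matrix_inv_works:
  fixes M :: "complex^'n^'n"
  assumes "invertible M"
  shows "M ** matrix_inv M = mat 1" "matrix_inv M ** M = mat 1"
proof -
  have "M ** matrix_inv M = mat 1 \<and> matrix_inv M ** M = mat 1"
    using assms unfolding invertible_def matrix_inv_def by (rule someI_ex)
  then show "M ** matrix_inv M = mat 1" "matrix_inv M ** M = mat 1" by auto
qed

lemma matrix_inv_unique:
  fixes M :: "complex^'n^'n"
  assumes "M ** N = mat 1"
  shows "matrix_inv M = N"
proof -
  have "invertible M" using assms invertible_right_inverse by blast
  then have "matrix_inv M ** (M ** N) = N"
    by (simp add: matrix_mul_assoc matrix_inv_works)
  then show ?thesis using assms by simp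
qed

lemma invertible_matrix_inv:
  fixes M :: "complex^'n^'n"
  shows "invertible M \<Longrightarrow> invertible (matrix_inv M)"
  using matrix_inv_works[of M] unfolding invertible_def by blast

lemma matrix_inv_matrix_inv:
  fixes M :: "complex^'n^'n"
  shows "invertible M \<Longrightarrow> matrix_inv (matrix_inv M) = M"
  by (rule matrix_inv_unique) (rule matrix_inv_works)

lemma matrix_inv_mult:
  fixes M N :: "complex^'n^'n"
  assumes "invertible M" "invertible N"
  shows "matrix_inv (M ** N) = matrix_inv N ** matrix_inv M"
proof (rule matrix_inv_unique)
  have "M ** N ** (matrix_inv N ** matrix_inv M) = M ** (N ** matrix_inv N) ** matrix_inv M"
    by (simp add: matrix_mul_assoc)
  then show "M ** N ** (matrix_inv N ** matrix_inv M) = mat 1"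
    using assms by (simp add: matrix_inv_works)
qed

lemma matrix_inv_transpose:
  fixes M :: "complex^'n^'n"
  assumes "invertible M"
  shows "matrix_inv (transpose M) = transpose (matrix_inv M)"
  by (rule matrix_inv_unique)
    (metis assms matrix_inv_works(2) matrix_transpose_mul transpose_mat)

lemma matrix_inv_cancel:
  fixes M :: "complex^'n^'n"
  assumes "invertible M"
  shows "M *v (matrix_inv M *v v) = v" "matrix_inv M *v (M *v v) = v"
  by (simp_all add: matrix_vector_mul_assoc matrix_inv_works[OF assms])

lemma matrix_vector_mult_axis: "(M *v axis i 1) $ j = M $ j $ i"
  for M :: "complex^'n^'m"
  by (simp add: matrix_vector_mult_def axis_def if_distrib cong: if_cong)

text \<open>Cramer's rule with a basis vector on the right-hand side. It displays the entries of the
  inverse as quotients of determinants, so that holomorphy survives inversion.\<close>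

lemma matrix_inv_entry:
  fixes M :: "complex^'n^'n"
  assumes "invertible M"
  shows "matrix_inv M $ i $ j = det (\<chi> r c. if c = i then axis j 1 $ r else M $ r $ c) / det M"
proof -
  have "det M \<noteq> 0" using assms invertible_det_nz by blast
  moreover have "M *v (matrix_inv M *v axis j 1) = axis j 1" using assms by (rule matrix_inv_cancel)
  ultimately have "matrix_inv M *v axis j 1 =
      (\<chi> k. det (\<chi> r c. if c = k then axis j 1 $ r else M $ r $ c) / det M)"
    using cramer by blast
  then have "(matrix_inv M *v axis j 1) $ i = det (\<chi> r c. if c = i then axis j 1 $ r else M $ r $ c) / det M"
    by simp
  then show ?thesis by (simp add: matrix_vector_mult_axis)
qed

lemma matrix_mult_scale: "A ** map_matrix ((*) c) B = map_matrix ((*) c) (A ** B)"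
  "map_matrix ((*) c) A ** B = map_matrix ((*) c) (A ** B)"
  for A :: "complex^'n^'m" and B :: "complex^'k^'n"
  by (simp_all add: matrix_matrix_mult_def map_matrix_def vec_eq_iff sum_distrib_left algebra_simps)

lemma matrix_vector_scale: "map_matrix ((*) c) M *v v = c *s (M *v v)"
  for M :: "complex^'n^'m"
  by (simp add: matrix_vector_mult_def map_matrix_def vec_eq_iff sum_distrib_left algebra_simps)

lemma map_matrix_scale_comp: "map_matrix ((*) a) (map_matrix ((*) b) M) = map_matrix ((*) (a * b)) M"
  for M :: "complex^'n^'m"
  by (simp add: map_matrix_def vec_eq_iff algebra_simps)

lemma matrix_vector_smult: "M *v (c *s v) = c *s (M *v v)"
  for M :: "complex^'n^'m"
  by (simp add: matrix_vector_mult_def vec_eq_iff sum_distrib_left algebra_simps)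

lemma matrix_vector_sum: "M *v (\<Sum>i\<in>I. v i) = (\<Sum>i\<in>I. M *v v i)"
  for M :: "complex^'n^'m"
  by (induction I rule: infinite_finite_induct) (simp_all add: matrix_vector_right_distrib)

section \<open>Kronecker products and coordinates of tensors\<close>

lemma kronecker_mult:
  "kronecker A C ** kronecker B D = kronecker (A ** B) (C ** D)"
proof -
  have "(kronecker A C ** kronecker B D) $ q $ r = kronecker (A ** B) (C ** D) $ q $ r" for q r
    by (simp add: matrix_matrix_mult_def kronecker_def sum_product sum.cartesian_product
        flip: UNIV_Times_UNIV) (rule sum.cong, auto)
  then show ?thesis by (simp add: vec_eq_iff)
qed

lemma kronecker_mat_1: "kronecker (mat 1) (mat 1) = mat 1"
  by (auto simp: kronecker_def mat_def vec_eq_iff prod_eq_iff)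

lemma matrix_inv_kronecker:
  assumes "invertible A" "invertible B"
  shows "matrix_inv (kronecker A B) = kronecker (matrix_inv A) (matrix_inv B)"
  by (rule matrix_inv_unique) (simp add: kronecker_mult matrix_inv_works assms kronecker_mat_1)

lemma invertible_kronecker:
  assumes "invertible A" "invertible B"
  shows "invertible (kronecker A B)"
  unfolding invertible_right_inverse
  by (rule exI[of _ "kronecker (matrix_inv A) (matrix_inv B)"])
    (simp add: kronecker_mult matrix_inv_works assms kronecker_mat_1)

lemma kronecker_vtensor: "kronecker A B *v (u \<otimes>\<^sub>v v) = (A *v u) \<otimes>\<^sub>v (B *v v)"
proof -
  have "(kronecker A B *v (u \<otimes>\<^sub>v v)) $ q = ((A *v u) \<otimes>\<^sub>v (B *v v)) $ q" for q
    by (simp add: matrix_vector_mult_def kronecker_def vtensor_def sum_product sum.cartesian_product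
        flip: UNIV_Times_UNIV) (rule sum.cong, auto)
  then show ?thesis by (simp add: vec_eq_iff)
qed

lemma vtensor_axis: "axis i 1 \<otimes>\<^sub>v axis j 1 = axis (i :: 'n::finite, j :: 'm::finite) 1"
  by (auto simp: vtensor_def axis_def vec_eq_iff)

lemma vtensor_smult: "(c *s u) \<otimes>\<^sub>v v = c *s (u \<otimes>\<^sub>v v)" "u \<otimes>\<^sub>v (c *s v) = c *s (u \<otimes>\<^sub>v v)"
  by (simp_all add: vtensor_def vec_eq_iff)

text \<open>Expansion in the tensor frame. It writes a germ with known coordinates as a finite sum
  of pure tensors, the form that \<open>par_tensor\<close> demands.\<close>

lemma kronecker_expansion:
  assumes "invertible A" "invertible B"
  shows "T = (\<Sum>q\<in>UNIV. (((kronecker A B *v T) $ q) *s (matrix_inv A *v axis (fst q) 1))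
               \<otimes>\<^sub>v (matrix_inv B *v axis (snd q) 1))"
proof -
  let ?K = "kronecker A B"
  have "T = matrix_inv ?K *v (?K *v T)"
    using invertible_kronecker[OF assms] by (simp add: matrix_inv_cancel)
  also have "?K *v T = (\<Sum>q\<in>UNIV. ((?K *v T) $ q) *s axis q 1)"
    by (rule basis_expansion[symmetric])
  also have "matrix_inv ?K *v \<dots> = (\<Sum>q\<in>UNIV. ((?K *v T) $ q) *s (matrix_inv ?K *v axis q 1))"
    by (simp add: matrix_vector_sum matrix_vector_smult)
  also have "\<dots> = (\<Sum>q\<in>UNIV. (((?K *v T) $ q) *s (matrix_inv A *v axis (fst q) 1))
               \<otimes>\<^sub>v (matrix_inv B *v axis (snd q) 1))"
    by (simp add: matrix_inv_kronecker assms vtensor_smult flip: kronecker_vtensor)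
      (simp add: vtensor_axis)
  finally show ?thesis .
qed

text \<open>The basis is grown from the smallest step of the flag to the largest by extending
  independent sets, so each step is spanned by the basis vectors that it contains. With
  \<open>\<rho> i\<close> the last step containing the \<open>i\<close>-th vector, a step is cut out
  by the vanishing of the coordinates with smaller \<open>\<rho>\<close>.\<close>

lemma flag_basis:
  fixes V :: "nat \<Rightarrow> (complex^'n) set"
  assumes V1: "V 1 = UNIV" and Vl: "V (l + 1) = {0}"
    and sub: "\<And>j. j \<in> {1..l + 1} \<Longrightarrow> vec.subspace (V j)"
    and dec: "\<And>j. j \<in> {1..l} \<Longrightarrow> V (j + 1) \<subseteq> V j"
  obtains C :: "complex^'n^'n" and \<rho> :: "'n \<Rightarrow> nat"
  where "invertible C" "\<And>i. \<rho> i \<in> {1..l}"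
    "\<And>j. j \<in> {1..l + 1} \<Longrightarrow> V j = {v. \<forall>i. \<rho> i < j \<longrightarrow> (C *v v) $ i = 0}"
proof -
  have anti: "V k \<subseteq> V j" if "j \<le> k" "1 \<le> j" "k \<le> l + 1" for j k
    using that
  proof (induction k rule: dec_induct)
    case (step k) then show ?case using dec[of k] by auto
  qed auto
  \<comment> \<open>A basis of the step with index \<open>l + 1 - d\<close> alone would not carry
    the induction on \<open>d\<close>: the last conjunct keeps it adapted to all smaller steps as
    well.\<close>
  have "\<exists>B. vec.independent B \<and> B \<subseteq> V (l + 1 - d) \<and> V (l + 1 - d) \<subseteq> vec.span B \<and>
      (\<forall>j\<in>{l + 1 - d..l + 1}. V j \<subseteq> vec.span (B \<inter> V j))" if "d \<le> l" for d
    using that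
  proof (induction d)
    case 0
    have "vec.independent {}" by (rule vec.independent_empty)
    then show ?case using Vl by (intro exI[of _ "{}"]) auto
  next
    case (Suc d)
    then obtain B where B: "vec.independent B" "B \<subseteq> V (l + 1 - d)" 
      "\<forall>j\<in>{l + 1 - d..l + 1}. V j \<subseteq> vec.span (B \<inter> V j)" by auto
    let ?m = "l + 1 - Suc d"
    have "V (l + 1 - d) \<subseteq> V ?m" by (rule anti) (use Suc.prems in auto)
    then have "B \<subseteq> V ?m" using B(2) by blast
    then obtain B' where B': "B \<subseteq> B'" "B' \<subseteq> V ?m" "vec.independent B'" "V ?m \<subseteq> vec.span B'"
      using vec.maximal_independent_subset_extend B(1) by metis
    have "V j \<subseteq> vec.span (B' \<inter> V j)" if "j \<in> {?m..l + 1}" for j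
    proof (cases "j = ?m")
      case True then show ?thesis using B'(2,4) by (simp add: Int_absorb2)
    next
      case False
      then have "j \<in> {l + 1 - d..l + 1}" using that by auto
      then have "V j \<subseteq> vec.span (B \<inter> V j)" using B(3) by blast
      also have "\<dots> \<subseteq> vec.span (B' \<inter> V j)" by (rule vec.span_mono) (use B'(1) in auto)
      finally show ?thesis .
    qed
    then show ?case using B' by blast
  qed
  from this[of l] obtain B where B: "vec.independent B" "UNIV \<subseteq> vec.span B"
    "\<And>j. j \<in> {1..l + 1} \<Longrightarrow> V j \<subseteq> vec.span (B \<inter> V j)" using V1 by auto
  have "card B = CARD('n)"
    using vec.basis_card_eq_dim[of B UNIV] B(1,2) vec_dim_card by auto
  moreover have "finite B" using B(1) vec.finiteI_independent by blast
  ultimately obtain b where b: "bij_betw b (UNIV :: 'n set) B"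
    by (metis finite finite_same_card_bij)
  define M :: "complex^'n^'n" where "M = (\<chi> r c. b c $ r)"
  have col: "M *v axis i 1 = b i" for i
    by (simp add: vec_eq_iff matrix_vector_mult_axis M_def)
  have "columns M = B" using b unfolding columns_def bij_betw_def
    by (auto simp: column_def M_def vec_eq_iff)
  then have invM: "invertible M"
    using B(2) matrix_right_invertible_span_columns[of M] invertible_right_inverse[of M] by auto
  define \<rho> where "\<rho> i = Max {j \<in> {1..l}. b i \<in> V j}" for i
  \<comment> \<open>With \<open>l = 0\<close> the whole space would be zero, but a basis vector is
    not. Hence 1 belongs to the set whose maximum defines \<open>\<rho>\<close>.\<close>
  have l: "1 \<le> l"
  proof (rule ccontr)
    assume "\<not> 1 \<le> l"
    then have "l = 0" by simp
    then have "(UNIV :: (complex^'n) set) = {0}" using V1 Vl by simp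
    then have "axis undefined 1 = (0 :: complex^'n)" by auto
    then show False by (simp add: axis_eq_0_iff)
  qed
  have \<rho>: "\<rho> i \<in> {1..l}" "b i \<in> V (\<rho> i)" and \<rho>_max: "j \<in> {1..l} \<Longrightarrow> b i \<in> V j \<Longrightarrow> j \<le> \<rho> i" for i j
  proof -
    have "1 \<in> {j \<in> {1..l}. b i \<in> V j}" using V1 l by simp
    then have "\<rho> i \<in> {j \<in> {1..l}. b i \<in> V j}" unfolding \<rho>_def by (intro Max_in) auto
    then show "\<rho> i \<in> {1..l}" "b i \<in> V (\<rho> i)" by auto
    show "j \<in> {1..l} \<Longrightarrow> b i \<in> V j \<Longrightarrow> j \<le> \<rho> i" unfolding \<rho>_def by (intro Max_ge) auto
  qed
  have b0: "b i \<noteq> 0" for i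
  proof
    assume "b i = 0"
    then have "0 \<in> B" using bij_betwE[OF b] by (metis UNIV_I)
    then show False using B(1) vec.dependent_zero[of B] by simp
  qed
  have bV: "b i \<in> V j \<longleftrightarrow> j \<le> \<rho> i" if "j \<in> {1..l + 1}" for i j
  proof
    assume "b i \<in> V j"
    then have "j \<noteq> l + 1" using b0[of i] Vl by auto
    then show "j \<le> \<rho> i" using \<rho>_max[of j i] that \<open>b i \<in> V j\<close> by auto
  next
    assume "j \<le> \<rho> i"
    then show "b i \<in> V j" using anti[of j "\<rho> i"] \<rho>[of i] that by auto
  qed
  show thesis
  proof (rule that[of "matrix_inv M" \<rho>])
    show "invertible (matrix_inv M)" using invM by (rule invertible_matrix_inv)
    show "\<rho> i \<in> {1..l}" for i by (rule \<rho>)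
    have Cb: "matrix_inv M *v b i = axis i 1" for i
      using matrix_inv_cancel(2)[OF invM] col by metis
    fix j assume j: "j \<in> {1..l + 1}"
    let ?P = "{v. \<forall>i. \<rho> i < j \<longrightarrow> (matrix_inv M *v v) $ i = 0}"
    have "vec.subspace ?P"
      unfolding vec.subspace_def
      by (auto simp: matrix_vector_right_distrib matrix_vector_smult)
    moreover have "B \<inter> V j \<subseteq> ?P"
    proof
      fix v assume "v \<in> B \<inter> V j"
      then obtain i where "v = b i" "b i \<in> V j" using b unfolding bij_betw_def by auto
      then show "v \<in> ?P" using bV[OF j] by (auto simp: Cb axis_def)
    qed
    ultimately have "vec.span (B \<inter> V j) \<subseteq> ?P" by (rule vec.span_minimal[rotated])
    moreover have "?P \<subseteq> V j"
    proof
      fix v assume v: "v \<in> ?P"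
      \<comment> \<open>Only basis vectors with \<open>\<rho> i \<ge> j\<close> occur with a nonzero
        coefficient, and these lie in \<open>V j\<close>.\<close>
      have "v = M *v (\<Sum>i\<in>UNIV. (matrix_inv M *v v) $ i *s axis i 1)"
        unfolding basis_expansion using invM by (simp add: matrix_inv_cancel)
      also have "\<dots> = (\<Sum>i\<in>UNIV. (matrix_inv M *v v) $ i *s b i)"
        by (simp add: matrix_vector_sum matrix_vector_smult col)
      also have "\<dots> \<in> V j"
      proof (rule vec.subspace_sum[OF sub[OF j]])
        fix i
        show "(matrix_inv M *v v) $ i *s b i \<in> V j"
        proof (cases "\<rho> i < j")
          case True
          then have "(matrix_inv M *v v) $ i = 0" using v by auto
          then show ?thesis using vec.subspace_0[OF sub[OF j]] by simp
        next
          case False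
          then have "b i \<in> V j" using bV[OF j] by simp
          then show ?thesis by (rule vec.subspace_scale[OF sub[OF j]])
        qed
      qed
      finally show "v \<in> V j" .
    qed
    ultimately show "V j = ?P" using B(3)[OF j] by blast
  qed
qed

text \<open>\<open>J t\<close> is the index behind \<open>flag_at\<close>. The equivalence for
  \<open>k < J t\<close> turns membership in a flag step into a condition on weights: the
  coordinates that must vanish are those of weight below \<open>t\<close>. If \<open>t\<close>
  exceeds all weights, \<open>J t\<close> is the index \<open>len E x + 1\<close> of the zero
  step.\<close>

lemma flag_index:
  assumes "\<And>j. j \<in> {1..len E x} \<Longrightarrow> 0 \<le> weight E x j \<and> weight E x j < 1"
    and mono: "strict_mono_on {1..len E x} (weight E x)"
  defines "J \<equiv> \<lambda>t. LEAST j. 1 \<le> j \<and> (j \<le> len E x \<longrightarrow> t \<le> weight E x j)"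
  shows "J t \<in> {1..len E x + 1}"
    and "k \<in> {1..len E x} \<Longrightarrow> k < J t \<longleftrightarrow> weight E x k < t"
    and "k \<in> {1..len E x} \<Longrightarrow> J (weight E x k) = k"
    and "t \<le> 0 \<Longrightarrow> J t = 1"
proof -
  let ?P = "\<lambda>t j. 1 \<le> j \<and> (j \<le> len E x \<longrightarrow> t \<le> weight E x j)"
  have P: "?P t (J t)" "J t \<le> len E x + 1" for t
    unfolding J_def by (rule LeastI[of _ "len E x + 1"], simp) (rule Least_le, simp)
  then show "J t \<in> {1..len E x + 1}" by auto
  have le: "k \<in> {1..len E x} \<Longrightarrow> k < J t \<longleftrightarrow> weight E x k < t" for k t
  proof
    assume k: "k \<in> {1..len E x}"
    show "weight E x k < t" if "k < J t"
      using not_less_Least[of k "?P t"] that k unfolding J_def by auto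
    show "k < J t" if "weight E x k < t"
    proof (rule ccontr)
      assume "\<not> k < J t"
      then have "J t \<in> {1..len E x}" "J t \<le> k" using P(1)[of t] k by auto
      then have "weight E x (J t) \<le> weight E x k"
        using mono k by (simp add: strict_mono_on_leD)
      then show False using that P(1)[of t] \<open>J t \<in> {1..len E x}\<close> by auto
    qed
  qed
  then show "k \<in> {1..len E x} \<Longrightarrow> k < J t \<longleftrightarrow> weight E x k < t" .
  show "J (weight E x k) = k" if k: "k \<in> {1..len E x}"
  proof (rule order_antisym)
    show "J (weight E x k) \<le> k" unfolding J_def by (rule Least_le) (use k in auto)
    show "k \<le> J (weight E x k)"
    proof (rule ccontr)
      assume "\<not> k \<le> J (weight E x k)"
      then have "J (weight E x k) \<in> {1..len E x}" "J (weight E x k) < k" using P(1) k by auto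
      then have "weight E x (J (weight E x k)) < weight E x k"
        using mono k by (auto simp: strict_mono_on_def)
      then show False using P(1)[of "weight E x k"] \<open>J (weight E x k) \<in> _\<close> by auto
    qed
  qed
  show "J t = 1" if "t \<le> 0"
    unfolding J_def by (rule Least_equality) (use assms(1)[of 1] that in auto)
qed

section \<open>Filtrations by germs and adapted frames\<close>

context surface
begin

section \<open>Pointwise holomorphy of matrices, sections and bundles\<close>

definition hol_mat :: "'x \<Rightarrow> ('x \<Rightarrow> complex^'n^'m) \<Rightarrow> bool" where
  "hol_mat x M \<longleftrightarrow> (\<forall>i j. hol_germ A x (\<lambda>p. M p $ i $ j))"

definition hol_vec :: "'x \<Rightarrow> ('x \<Rightarrow> complex^'n) \<Rightarrow> bool" where
  "hol_vec x s \<longleftrightarrow> (\<forall>i. hol_germ A x (\<lambda>p. s p $ i))"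

lemma hol_mat_cong: "\<forall>\<^sub>F p in nhds x. M p = N p \<Longrightarrow> hol_mat x M \<longleftrightarrow> hol_mat x N"
  unfolding hol_mat_def by (intro all_cong1 hol_germ_cong) (auto elim: eventually_mono)

lemma hol_vec_cong: "\<forall>\<^sub>F p in nhds x. s p = t p \<Longrightarrow> hol_vec x s \<longleftrightarrow> hol_vec x t"
  unfolding hol_vec_def by (intro all_cong1 hol_germ_cong) (auto elim: eventually_mono)

lemma hol_mat_const: "hol_mat x (\<lambda>_. M)"
  unfolding hol_mat_def by simp

lemma hol_vec_const: "hol_vec x (\<lambda>_. v)"
  unfolding hol_vec_def by simp

lemma hol_mat_mult: "hol_mat x M \<Longrightarrow> hol_mat x N \<Longrightarrow> hol_mat x (\<lambda>p. M p ** N p)"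
  unfolding hol_mat_def matrix_matrix_mult_def by (simp add: hol_germ_sum hol_germ_mult)

lemma hol_mat_vec: "hol_mat x M \<Longrightarrow> hol_vec x s \<Longrightarrow> hol_vec x (\<lambda>p. M p *v s p)"
  unfolding hol_mat_def hol_vec_def matrix_vector_mult_def by (simp add: hol_germ_sum hol_germ_mult)

lemma hol_mat_transpose: "hol_mat x M \<Longrightarrow> hol_mat x (\<lambda>p. transpose (M p))"
  unfolding hol_mat_def transpose_def by simp

lemma hol_mat_kronecker: "hol_mat x M \<Longrightarrow> hol_mat x N \<Longrightarrow> hol_mat x (\<lambda>p. kronecker (M p) (N p))"
  unfolding hol_mat_def kronecker_def by (simp add: hol_germ_mult)

lemma hol_mat_scale: "hol_germ A x c \<Longrightarrow> hol_mat x M \<Longrightarrow> hol_mat x (\<lambda>p. map_matrix ((*) (c p)) (M p))"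
  unfolding hol_mat_def map_matrix_def by (simp add: hol_germ_mult)

lemma hol_germ_det: "hol_mat x M \<Longrightarrow> hol_germ A x (\<lambda>p. det (M p))"
  unfolding hol_mat_def det_def
  by (intro hol_germ_sum hol_germ_mult hol_germ_const hol_germ_prod) simp

lemma hol_mat_nhds: "hol_mat x M \<Longrightarrow> \<forall>\<^sub>F p in nhds x. hol_mat p M"
  unfolding hol_mat_def by (intro eventually_all_finite) (auto intro: hol_germ_nhds)

lemma hol_vec_nhds: "hol_vec x s \<Longrightarrow> \<forall>\<^sub>F p in nhds x. hol_vec p s"
  unfolding hol_vec_def by (intro eventually_all_finite) (auto intro: hol_germ_nhds)

lemma hol_mat_invertible_nhds:
  fixes M :: "'x \<Rightarrow> complex^'n^'n"
  assumes "hol_mat x M" "invertible (M x)"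
  shows "\<forall>\<^sub>F p in nhds x. invertible (M p)"
  using hol_germ_nonzero[OF hol_germ_det[OF assms(1)]] assms(2)
  by (simp add: invertible_det_nz)

lemma hol_mat_inverse:
  fixes M :: "'x \<Rightarrow> complex^'n^'n"
  assumes M: "hol_mat x M" and inv: "invertible (M x)"
  shows "hol_mat x (\<lambda>p. matrix_inv (M p))"
  unfolding hol_mat_def
proof (intro allI)
  fix i j
  let ?N = "\<lambda>p. (\<chi> r c. if c = i then axis j 1 $ r else M p $ r $ c)"
  have "hol_germ A x (\<lambda>p. ?N p $ r $ c)" for r c
    using M unfolding hol_mat_def by (cases "c = i") simp_all
  then have "hol_mat x ?N" unfolding hol_mat_def by blast
  then have "hol_germ A x (\<lambda>p. det (?N p) / det (M p))"
    using hol_germ_det[OF M] inv 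
    by (intro hol_germ_divide hol_germ_det[of x ?N]) (simp_all add: invertible_det_nz)
  moreover have "\<forall>\<^sub>F p in nhds x. matrix_inv (M p) $ i $ j = det (?N p) / det (M p)"
    using hol_mat_invertible_nhds[OF assms] by eventually_elim (rule matrix_inv_entry)
  ultimately show "hol_germ A x (\<lambda>p. matrix_inv (M p) $ i $ j)"
    by (simp add: hol_germ_cong)
qed

lemma hol_matrix_iff: "open W \<Longrightarrow> hol_matrix A W M \<longleftrightarrow> (\<forall>p\<in>W. hol_mat p M)"
  unfolding hol_matrix_def hol_mat_def by (auto simp: hol_fun_iff)

lemma bundleD:
  assumes "holomorphic_bundle A G" "(U, g) \<in> G"
  shows "open U" "\<And>x. x \<in> U \<Longrightarrow> invertible (g x)"
    "\<And>V h x. (V, h) \<in> G \<Longrightarrow> x \<in> U \<Longrightarrow> x \<in> V \<Longrightarrow> hol_mat x (\<lambda>p. h p ** matrix_inv (g p))"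
proof -
  show "open U" "\<And>x. x \<in> U \<Longrightarrow> invertible (g x)"
    using assms unfolding holomorphic_bundle_def by fast+
  fix V h x assume V: "(V, h) \<in> G" "x \<in> U" "x \<in> V"
  have "open V" using assms(1) V unfolding holomorphic_bundle_def by fast
  moreover have "hol_matrix A (U \<inter> V) (\<lambda>x. h x ** matrix_inv (g x))"
    using assms V unfolding holomorphic_bundle_def by fast
  ultimately show "hol_mat x (\<lambda>p. h p ** matrix_inv (g p))"
    using V \<open>open U\<close> by (simp add: hol_matrix_iff open_Int)
qed

lemma triv_ex:
  assumes "holomorphic_bundle A G"
  shows "\<exists>U g. (U, g) \<in> G \<and> x \<in> U"
proof -
  have "(\<Union>(U, g)\<in>G. U) = UNIV" using assms unfolding holomorphic_bundle_def by (rule conjunct1)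
  then have "x \<in> (\<Union>(U, g)\<in>G. U)" by simp
  then show ?thesis by auto
qed

lemma triv_nhds:
  assumes "holomorphic_bundle A G" "(U, g) \<in> G" "x \<in> U"
  shows "\<forall>\<^sub>F p in nhds x. p \<in> U \<and> invertible (g p)"
  using eventually_nhds_in_open[OF bundleD(1)[OF assms(1,2)] assms(3)]
  by eventually_elim (use bundleD(2)[OF assms(1,2)] in auto)

text \<open>Transition matrices are holomorphic, so a single trivialisation around a point decides
  whether a section is holomorphic there.\<close>

lemma hol_vec_triv:
  assumes G: "holomorphic_bundle A G" and t: "(U, g) \<in> G" "x \<in> U" "(V, h) \<in> G" "x \<in> V"
    and s: "hol_vec x (\<lambda>p. g p *v s p)"
  shows "hol_vec x (\<lambda>p. h p *v s p)"
proof -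
  have "\<forall>\<^sub>F p in nhds x. (h p ** matrix_inv (g p)) *v (g p *v s p) = h p *v s p"
    using triv_nhds[OF G t(1,2)]
    by eventually_elim (simp add: matrix_inv_cancel flip: matrix_vector_mul_assoc)
  from hol_vec_cong[OF this] show ?thesis
    using hol_mat_vec[OF bundleD(3)[OF G t(1,3,2,4)] s] by simp
qed

lemma hol_section_iff:
  assumes "holomorphic_bundle A G" "open W"
  shows "hol_section A G W s \<longleftrightarrow> (\<forall>p\<in>W. \<forall>(U, g)\<in>G. p \<in> U \<longrightarrow> hol_vec p (\<lambda>q. g q *v s q))"
proof -
  have "hol_section A G W s \<longleftrightarrow>
      (\<forall>(U, g)\<in>G. \<forall>i. \<forall>p\<in>U \<inter> W. hol_germ A p (\<lambda>p. (g p *v s p) $ i))"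
    unfolding hol_section_def
    by (intro ball_cong refl) (use bundleD(1)[OF assms(1)] assms(2) in \<open>auto simp: hol_fun_iff open_Int\<close>)
  then show ?thesis unfolding hol_vec_def by fast
qed

lemma hol_sectionI:
  assumes "holomorphic_bundle A G" "open W" "(U, g) \<in> G" "W \<subseteq> U"
    "\<And>p. p \<in> W \<Longrightarrow> hol_vec p (\<lambda>q. g q *v s q)"
  shows "hol_section A G W s"
  unfolding hol_section_iff[OF assms(1,2)] using hol_vec_triv[OF assms(1,3)] assms(4,5) by blast

text \<open>\<open>Q p\<close> sends a vector to its coordinates, so the frame itself consists of
  the columns of \<open>matrix_inv (Q p)\<close>. Only invertibility off \<open>x\<close> is
  demanded: relative to the trivialisations of the bundle the frame may have zeros and poles at
  \<open>x\<close>, as pulled-back frames do.\<close>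

definition adapted ::
  "'x \<Rightarrow> (real \<Rightarrow> ('x \<Rightarrow> complex^'n) set) \<Rightarrow> ('x \<Rightarrow> complex^'n^'n) \<Rightarrow> ('n \<Rightarrow> real) \<Rightarrow> bool" where
  "adapted x S Q \<gamma> \<longleftrightarrow> (\<forall>\<^sub>F p in at x. invertible (Q p)) \<and>
     (\<forall>t. S t = {s. \<forall>i. ordge x \<lceil>t - \<gamma> i\<rceil> (\<lambda>p. (Q p *v s p) $ i)})"

lemma adaptedD:
  assumes "adapted x S Q \<gamma>"
  shows "\<forall>\<^sub>F p in at x. invertible (Q p)"
    "s \<in> S t \<longleftrightarrow> (\<forall>i. ordge x \<lceil>t - \<gamma> i\<rceil> (\<lambda>p. (Q p *v s p) $ i))"
  using assms unfolding adapted_def by auto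

lemma adapted_cong:
  assumes "adapted x S Q \<gamma>" "\<forall>\<^sub>F p in at x. s p = s' p"
  shows "s \<in> S t \<longleftrightarrow> s' \<in> S t"
  unfolding adaptedD(2)[OF assms(1)]
  by (intro all_cong1 ordge_cong) (use assms(2) in eventually_elim, simp)

lemma adapted_scale:
  assumes "adapted x S Q \<gamma>" "s \<in> S t" "ordge x k c" "t' \<le> t + real_of_int k"
  shows "(\<lambda>p. c p *s s p) \<in> S t'"
  unfolding adaptedD(2)[OF assms(1)]
proof
  fix i
  have "\<lceil>t' - \<gamma> i\<rceil> \<le> k + \<lceil>t - \<gamma> i\<rceil>" using assms(4) by linarith
  moreover have "ordge x \<lceil>t - \<gamma> i\<rceil> (\<lambda>p. (Q p *v s p) $ i)"
    using assms(2) adaptedD(2)[OF assms(1)] by blast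
  ultimately show "ordge x \<lceil>t' - \<gamma> i\<rceil> (\<lambda>p. (Q p *v (c p *s s p)) $ i)"
    using ordge_mult_ge[OF assms(3)] by (simp add: matrix_vector_smult)
qed

text \<open>The coordinates of a frame vector are the constants 0 and 1, and the 1 stands where the
  exponent is 0. These germs are the test elements for maps and functionals.\<close>

lemma adapted_frame:
  assumes "adapted x S Q \<gamma>"
  shows "(\<lambda>p. matrix_inv (Q p) *v axis i 1) \<in> S (\<gamma> i)"
  unfolding adaptedD(2)[OF assms]
proof
  fix j
  have "\<forall>\<^sub>F p in at x. (Q p *v (matrix_inv (Q p) *v axis i 1)) $ j = axis i 1 $ j"
    using adaptedD(1)[OF assms] by eventually_elim (simp add: matrix_inv_cancel)
  moreover have "ordge x \<lceil>\<gamma> i - \<gamma> j\<rceil> (\<lambda>p. axis i 1 $ j)"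
    by (cases "i = j") (use hol_imp_ordge in \<open>auto simp: axis_def\<close>)
  ultimately show "ordge x \<lceil>\<gamma> i - \<gamma> j\<rceil> (\<lambda>p. (Q p *v (matrix_inv (Q p) *v axis i 1)) $ j)"
    by (simp add: ordge_cong)
qed

text \<open>The frame vectors test the left-hand side. Conversely, an entry of order
  \<lceil>\<gamma> i - \<delta> j\<rceil> times a coordinate of order \<lceil>t - \<gamma> i\<rceil>
  has order at least \<lceil>t - \<delta> j\<rceil> by subadditivity of the ceiling.\<close>

lemma adapted_map_iff:
  assumes S: "adapted x S Q \<gamma>" and T: "adapted x T R \<delta>"
  shows "(\<forall>t. \<forall>s\<in>S t. (\<lambda>p. h p *v s p) \<in> T t) \<longleftrightarrow>
    (\<forall>i j. ordge x \<lceil>\<gamma> i - \<delta> j\<rceil> (\<lambda>p. (R p ** h p ** matrix_inv (Q p)) $ j $ i))"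
proof
  assume *: "\<forall>t. \<forall>s\<in>S t. (\<lambda>p. h p *v s p) \<in> T t"
  show "\<forall>i j. ordge x \<lceil>\<gamma> i - \<delta> j\<rceil> (\<lambda>p. (R p ** h p ** matrix_inv (Q p)) $ j $ i)"
  proof (intro allI)
    fix i j
    have "(\<lambda>p. h p *v (matrix_inv (Q p) *v axis i 1)) \<in> T (\<gamma> i)"
      using *[rule_format, OF adapted_frame[OF S]] .
    then have "ordge x \<lceil>\<gamma> i - \<delta> j\<rceil> (\<lambda>p. (R p *v (h p *v (matrix_inv (Q p) *v axis i 1))) $ j)"
      unfolding adaptedD(2)[OF T] by blast
    then show "ordge x \<lceil>\<gamma> i - \<delta> j\<rceil> (\<lambda>p. (R p ** h p ** matrix_inv (Q p)) $ j $ i)"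
      by (simp add: matrix_vector_mul_assoc matrix_vector_mult_axis matrix_mul_assoc)
  qed
next
  assume *: "\<forall>i j. ordge x \<lceil>\<gamma> i - \<delta> j\<rceil> (\<lambda>p. (R p ** h p ** matrix_inv (Q p)) $ j $ i)"
  show "\<forall>t. \<forall>s\<in>S t. (\<lambda>p. h p *v s p) \<in> T t"
  proof (intro allI ballI)
    fix t s assume s: "s \<in> S t"
    show "(\<lambda>p. h p *v s p) \<in> T t" unfolding adaptedD(2)[OF T]
    proof
      fix j
      let ?F = "\<lambda>p. \<Sum>i\<in>UNIV. (R p ** h p ** matrix_inv (Q p)) $ j $ i * (Q p *v s p) $ i"
      have "ordge x \<lceil>t - \<delta> j\<rceil> ?F"
      proof (rule ordge_sum)
        fix i
        have "\<lceil>t - \<delta> j\<rceil> \<le> \<lceil>\<gamma> i - \<delta> j\<rceil> + \<lceil>t - \<gamma> i\<rceil>" by linarith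
        then show "ordge x \<lceil>t - \<delta> j\<rceil>
            (\<lambda>p. (R p ** h p ** matrix_inv (Q p)) $ j $ i * (Q p *v s p) $ i)"
          using * s unfolding adaptedD(2)[OF S] by (intro ordge_mult_ge) blast+
      qed
      moreover have "\<forall>\<^sub>F p in at x. ?F p = (R p *v (h p *v s p)) $ j"
        using adaptedD(1)[OF S]
      proof eventually_elim
        case (elim p)
        have "?F p = ((R p ** h p ** matrix_inv (Q p)) *v (Q p *v s p)) $ j"
          by (simp add: matrix_vector_mult_def)
        also have "\<dots> = (R p *v (h p *v s p)) $ j"
          using elim by (simp add: matrix_inv_cancel flip: matrix_vector_mul_assoc)
        finally show ?case .
      qed
      ultimately show "ordge x \<lceil>t - \<delta> j\<rceil> (\<lambda>p. (R p *v (h p *v s p)) $ j)"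
        by (simp only: ordge_cong)
    qed
  qed
qed

lemma adapted_tensor:
  fixes V :: "('x, 'a::finite) filtered_bundle" and W :: "('x, 'b::finite) filtered_bundle"
  assumes V: "adapted x (fgerms V x) Q \<gamma>" and W: "adapted x (fgerms W x) R \<delta>"
  shows "adapted x (fgerms (par_tensor V W) x) (\<lambda>p. kronecker (Q p) (R p)) (\<lambda>q. \<gamma> (fst q) + \<delta> (snd q))"
  unfolding adapted_def
proof (intro conjI allI)
  show "\<forall>\<^sub>F p in at x. invertible (kronecker (Q p) (R p))"
    using adaptedD(1)[OF V] adaptedD(1)[OF W] by eventually_elim (rule invertible_kronecker)
  fix t
  show "fgerms (par_tensor V W) x t =
    {T. \<forall>q. ordge x \<lceil>t - (\<gamma> (fst q) + \<delta> (snd q))\<rceil> (\<lambda>p. (kronecker (Q p) (R p) *v T p) $ q)}"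
    (is "_ = ?S")
  proof (intro equalityI subsetI)
    fix T assume "T \<in> fgerms (par_tensor V W) x t"
    then obtain N :: nat and a b u v where uv: "\<And>i. i < N \<Longrightarrow> a i + b i = t \<and> u i \<in> fgerms V x (a i) \<and> v i \<in> fgerms W x (b i)"
      and T: "\<forall>\<^sub>F p in at x. T p = (\<Sum>i<N. u i p \<otimes>\<^sub>v v i p)"
      unfolding par_tensor_def by simp blast
    have "ordge x \<lceil>t - (\<gamma> (fst q) + \<delta> (snd q))\<rceil> (\<lambda>p. (kronecker (Q p) (R p) *v T p) $ q)" for q
    proof -
      have "ordge x \<lceil>t - (\<gamma> (fst q) + \<delta> (snd q))\<rceil>
          (\<lambda>p. \<Sum>i<N. (Q p *v u i p) $ fst q * (R p *v v i p) $ snd q)"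
      proof (rule ordge_sum)
        fix i assume "i \<in> {..<N}"
        then have i: "a i + b i = t" "ordge x \<lceil>a i - \<gamma> (fst q)\<rceil> (\<lambda>p. (Q p *v u i p) $ fst q)"
          "ordge x \<lceil>b i - \<delta> (snd q)\<rceil> (\<lambda>p. (R p *v v i p) $ snd q)"
          using uv adaptedD(2)[OF V] adaptedD(2)[OF W] by auto
        have "\<lceil>t - (\<gamma> (fst q) + \<delta> (snd q))\<rceil> \<le> \<lceil>a i - \<gamma> (fst q)\<rceil> + \<lceil>b i - \<delta> (snd q)\<rceil>"
          using i(1) by linarith
        then show "ordge x \<lceil>t - (\<gamma> (fst q) + \<delta> (snd q))\<rceil>
            (\<lambda>p. (Q p *v u i p) $ fst q * (R p *v v i p) $ snd q)"
          using i(2,3) by (rule ordge_mult_ge[rotated 2])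
      qed
      moreover have "\<forall>\<^sub>F p in at x. (\<Sum>i<N. (Q p *v u i p) $ fst q * (R p *v v i p) $ snd q) =
          (kronecker (Q p) (R p) *v T p) $ q"
        using T
        by eventually_elim (simp add: matrix_vector_sum kronecker_vtensor, simp add: vtensor_def)
      ultimately show ?thesis by (simp only: ordge_cong)
    qed
    then show "T \<in> ?S" by blast
  next
    fix T assume T: "T \<in> ?S"
    let ?N = "CARD('a \<times> 'b)"
    obtain e where e: "bij_betw e {..<?N} (UNIV :: ('a \<times> 'b) set)"
      using ex_bij_betw_nat_finite[of "UNIV :: ('a \<times> 'b) set"] by (auto simp: atLeast0LessThan)
    \<comment> \<open>The coefficient is absorbed into the first factor. The second factor is then a
      frame vector at its own level \<delta>, which leaves the level t - \<delta> for the first; the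
      order of the coefficient provides it.\<close>
    define u where "u k p = ((kronecker (Q p) (R p) *v T p) $ e k) *s (matrix_inv (Q p) *v axis (fst (e k)) 1)" for k p
    define v where "v k p = matrix_inv (R p) *v axis (snd (e k)) 1" for k p
    have "v k \<in> fgerms W x (\<delta> (snd (e k)))" for k
      unfolding v_def by (rule adapted_frame[OF W])
    moreover have "u k \<in> fgerms V x (t - \<delta> (snd (e k)))" for k
      unfolding u_def
    proof (rule adapted_scale[OF V adapted_frame[OF V]])
      show "ordge x \<lceil>t - (\<gamma> (fst (e k)) + \<delta> (snd (e k)))\<rceil> (\<lambda>p. (kronecker (Q p) (R p) *v T p) $ e k)"
        using T by blast
    qed linarith
    moreover have "\<forall>\<^sub>F p in at x. T p = (\<Sum>k<?N. u k p \<otimes>\<^sub>v v k p)"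
      using adaptedD(1)[OF V] adaptedD(1)[OF W]
    proof eventually_elim
      case (elim p)
      have "(\<Sum>k<?N. u k p \<otimes>\<^sub>v v k p) = (\<Sum>q\<in>UNIV. (((kronecker (Q p) (R p) *v T p) $ q)
          *s (matrix_inv (Q p) *v axis (fst q) 1)) \<otimes>\<^sub>v (matrix_inv (R p) *v axis (snd q) 1))"
        unfolding u_def v_def by (rule sum.reindex_bij_betw[OF e])
      then show ?case using kronecker_expansion[OF elim, of "T p"] by simp
    qed
    ultimately show "T \<in> fgerms (par_tensor V W) x t"
      unfolding par_tensor_def filtered_bundle.select_convs mem_Collect_eq
      by (intro exI[of _ ?N] exI[of _ "\<lambda>k. t - \<delta> (snd (e k))"] exI[of _ "\<lambda>k. \<delta> (snd (e k))"]
          exI[of _ u] exI[of _ v]) simp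
  qed
qed

end

lemma invertible_transpose_matrix:
  fixes M :: "complex^'n^'n"
  assumes "invertible M"
  shows "invertible (transpose M)"
proof -
  have "transpose M ** transpose (matrix_inv M) = mat 1"
    using assms by (simp add: matrix_inv_works transpose_mat flip: matrix_transpose_mul)
  then show ?thesis using invertible_right_inverse by blast
qed

context surface
begin

section \<open>Adapted frames of parabolic bundles and of their duals\<close>

lemma parabolic_bundleD:
  assumes "parabolic_bundle A D E"
  shows "finite D" "holomorphic_bundle A (trivs E)"
    "x \<in> D \<Longrightarrow> flag E x 1 = UNIV" "x \<in> D \<Longrightarrow> flag E x (len E x + 1) = {0}"
    "x \<in> D \<Longrightarrow> j \<in> {1..len E x + 1} \<Longrightarrow> vec.subspace (flag E x j)"
    "x \<in> D \<Longrightarrow> j \<in> {1..len E x} \<Longrightarrow> flag E x (j + 1) \<subset> flag E x j"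
    "x \<in> D \<Longrightarrow> j \<in> {1..len E x} \<Longrightarrow> 0 \<le> weight E x j \<and> weight E x j < 1"
    "x \<in> D \<Longrightarrow> strict_mono_on {1..len E x} (weight E x)"
  using assms unfolding parabolic_bundle_def by simp_all

text \<open>\<open>M\<close> will be the value of a trivialisation at \<open>x\<close>. The
  flag-adapted coordinates of the fibre are rewritten as \<open>C ** M\<close> with a constant
  \<open>C\<close>, so that \<open>C\<close> times the trivialisation is still holomorphic and is
  adapted at \<open>x\<close>.\<close>

lemma parabolic_frame:
  fixes E :: "('x, 'n::finite) pbundle"
  assumes E: "parabolic_bundle A D E" and x: "x \<in> D" and M: "invertible M"
  obtains C :: "complex^'n^'n" and \<alpha> :: "'n \<Rightarrow> real" and \<rho> :: "'n \<Rightarrow> nat"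
  where "invertible C" "\<And>i. 0 \<le> \<alpha> i \<and> \<alpha> i < 1"
    "\<And>i. \<rho> i \<in> {1..len E x}" "\<And>i. \<alpha> i = weight E x (\<rho> i)"
    "\<And>t. flag_at E x t = {v. \<forall>i. \<alpha> i < t \<longrightarrow> ((C ** M) *v v) $ i = 0}"
proof -
  note D = parabolic_bundleD[OF E]
  obtain C0 and \<rho> :: "'n \<Rightarrow> nat" where C0: "invertible C0" and \<rho>: "\<And>i. \<rho> i \<in> {1..len E x}" and
    fl: "\<And>j. j \<in> {1..len E x + 1} \<Longrightarrow> flag E x j = {v. \<forall>i. \<rho> i < j \<longrightarrow> (C0 *v v) $ i = 0}"
  proof (rule flag_basis[of "flag E x" "len E x"])
    show "flag E x 1 = UNIV" "flag E x (len E x + 1) = {0}" using D(3,4) x by auto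
    show "\<And>j. j \<in> {1..len E x + 1} \<Longrightarrow> vec.subspace (flag E x j)" using D(5) x by blast
    show "\<And>j. j \<in> {1..len E x} \<Longrightarrow> flag E x (j + 1) \<subseteq> flag E x j" using D(6) x by blast
  qed (rule that)
  show thesis
  proof (rule that[of "C0 ** matrix_inv M" "\<lambda>i. weight E x (\<rho> i)" \<rho>])
    show "invertible (C0 ** matrix_inv M)"
      using C0 M by (simp add: invertible_mult invertible_matrix_inv)
    show "0 \<le> weight E x (\<rho> i) \<and> weight E x (\<rho> i) < 1" for i using D(7)[OF x \<rho>] .
    show "\<rho> i \<in> {1..len E x}" for i by (rule \<rho>)
    have "C0 ** matrix_inv M ** M = C0"
      using M by (simp add: matrix_inv_works flip: matrix_mul_assoc)
    then show "flag_at E x t = {v. \<forall>i. weight E x (\<rho> i) < t \<longrightarrow> ((C0 ** matrix_inv M ** M) *v v) $ i = 0}" for t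
      using flag_index(2)[of E x, OF D(7)[OF x] D(8)[OF x] \<rho>, where t = t]
        fl[OF flag_index(1)[of E x, OF D(7)[OF x] D(8)[OF x], where t = t]]
      unfolding flag_at_def by simp
  qed simp
qed

lemma flag_at_zero:
  assumes E: "parabolic_bundle A D E" and x: "x \<in> D"
  shows "flag_at E x 0 = UNIV"
  unfolding flag_at_def
  using flag_index(4)[of E x 0, OF parabolic_bundleD(7)[OF E x] parabolic_bundleD(8)[OF E x]]
    parabolic_bundleD(3)[OF E x] by simp

lemma flag_at_weight:
  assumes E: "parabolic_bundle A D E" and x: "x \<in> D" and "j \<in> {1..len E x}"
  shows "flag_at E x (weight E x j) = flag E x j"
  unfolding flag_at_def
  using flag_index(3)[of E x j, OF parabolic_bundleD(7)[OF E x] parabolic_bundleD(8)[OF E x] assms(3)]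
  by simp

text \<open>For numbers in [0, 1) the ceiling splits: \<lfloor>t\<rfloor> comes from the power of
  the coordinate in \<open>par_germs\<close>, and the additional 1 is the vanishing at
  \<open>x\<close> that the flag requires of a coordinate with \<alpha> i below the fractional part
  of t.\<close>

lemma par_germs_adapted:
  assumes G: "holomorphic_bundle A (trivs E)" and g: "(U, g) \<in> trivs E" "x \<in> U"
    and C: "invertible C" and \<alpha>: "\<And>i. 0 \<le> \<alpha> i \<and> \<alpha> i < 1"
    and fl: "\<And>t. 0 \<le> t \<Longrightarrow> t < 1 \<Longrightarrow> flag_at E x t = {v. \<forall>i. \<alpha> i < t \<longrightarrow> ((C ** g x) *v v) $ i = 0}"
  shows "adapted x (par_germs A E x) (\<lambda>p. C ** g p) \<alpha>"
  unfolding adapted_def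
proof (intro conjI allI)
  have Cg: "\<forall>\<^sub>F p in nhds x. p \<in> U \<and> invertible (C ** g p)"
    using triv_nhds[OF G g] by eventually_elim (simp add: invertible_mult C)
  then show inv: "\<forall>\<^sub>F p in at x. invertible (C ** g p)"
    by (simp add: eventually_nhds_conv_at eventually_conj_iff)
  fix t
  have fl: "flag_at E x (frac t) = {v. \<forall>i. \<alpha> i < frac t \<longrightarrow> ((C ** g x) *v v) $ i = 0}"
    by (rule fl) (auto simp: frac_ge_0 frac_lt_1)
  have ce: "\<lceil>t - \<alpha> i\<rceil> = \<lfloor>t\<rfloor> + (if \<alpha> i < frac t then 1 else 0)" for i
    using \<alpha>[of i] by (auto simp: frac_def) linarith+
  show "par_germs A E x t = {s. \<forall>i. ordge x \<lceil>t - \<alpha> i\<rceil> (\<lambda>p. ((C ** g p) *v s p) $ i)}" (is "_ = ?S")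
  proof (intro equalityI subsetI)
    fix s assume "s \<in> par_germs A E x t"
    then obtain V z W s' where c: "(V, z) \<in> A" "x \<in> V" and W: "open W" "x \<in> W"
      and s': "hol_section A (trivs E) W s'" "s' x \<in> flag_at E x (frac t)"
      and s: "\<forall>\<^sub>F p in at x. s p = ((z p - z x) powi \<lfloor>t\<rfloor>) *s s' p"
      unfolding par_germs_def by blast
    have "hol_vec x (\<lambda>q. g q *v s' q)"
      using s'(1) unfolding hol_section_iff[OF G W(1)] using W(2) g by blast
    then have hv: "hol_vec x (\<lambda>q. (C ** g q) *v s' q)"
      using hol_mat_vec[OF hol_mat_const] by (simp flip: matrix_vector_mul_assoc)
    have "ordge x \<lceil>t - \<alpha> i\<rceil> (\<lambda>p. ((C ** g p) *v s p) $ i)" for i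
    proof -
      have h: "hol_germ A x (\<lambda>q. ((C ** g q) *v s' q) $ i)" using hv unfolding hol_vec_def by blast
      have "ordge x (if \<alpha> i < frac t then 1 else 0) (\<lambda>q. ((C ** g q) *v s' q) $ i)"
      proof (cases "\<alpha> i < frac t")
        case True
        then have "((C ** g x) *v s' x) $ i = 0" using s'(2) fl by blast
        from hol_germ_zero_factor[OF h this] True show ?thesis
          unfolding ordge_def by (auto simp: eventually_nhds_conv_at)
      qed (use hol_imp_ordge[OF h] in auto)
      from ordge_mult[OF ordeq_imp_ordge[OF ordeq_chart_powi[OF c, of "\<lfloor>t\<rfloor>"]] this]
      have "ordge x \<lceil>t - \<alpha> i\<rceil> (\<lambda>p. (z p - z x) powi \<lfloor>t\<rfloor> * ((C ** g p) *v s' p) $ i)"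
        by (simp add: ce)
      moreover have "\<forall>\<^sub>F p in at x. ((C ** g p) *v s p) $ i = (z p - z x) powi \<lfloor>t\<rfloor> * ((C ** g p) *v s' p) $ i"
        using s by eventually_elim (simp add: matrix_vector_smult)
      ultimately show ?thesis by (simp only: ordge_cong)
    qed
    then show "s \<in> ?S" by blast
  next
    fix s assume s: "s \<in> ?S"
    \<comment> \<open>After the common power with exponent \<lfloor>t\<rfloor> is split off,
      \<open>e i\<close> is the order of the zero that the flag still requires of the
      \<open>i\<close>-th coordinate.\<close>
    define e where "e i = (if \<alpha> i < frac t then 1 else 0 :: nat)" for i
    have "\<forall>i. \<exists>c. hol_germ A x c \<and>
        (\<forall>\<^sub>F p in at x. ((C ** g p) *v s p) $ i = coord x p powi \<lceil>t - \<alpha> i\<rceil> * c p)"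
    proof
      fix i
      from s have "ordge x \<lceil>t - \<alpha> i\<rceil> (\<lambda>p. ((C ** g p) *v s p) $ i)" by simp
      then show "\<exists>c. hol_germ A x c \<and>
          (\<forall>\<^sub>F p in at x. ((C ** g p) *v s p) $ i = coord x p powi \<lceil>t - \<alpha> i\<rceil> * c p)"
        unfolding ordge_def .
    qed
    from choice[OF this] obtain c where c: "\<And>i. hol_germ A x (c i)"
      "\<And>i. \<forall>\<^sub>F p in at x. ((C ** g p) *v s p) $ i = coord x p powi \<lceil>t - \<alpha> i\<rceil> * c i p" by blast
    define d where "d p = (\<chi> i. coord x p ^ e i * c i p)" for p
    define s' where "s' p = matrix_inv (C ** g p) *v d p" for p
    have hd: "hol_vec x d" unfolding hol_vec_def d_def
      by (simp add: hol_germ_mult hol_germ_power c)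
    have gs: "\<forall>\<^sub>F p in nhds x. g p *v s' p = matrix_inv C *v d p"
      using triv_nhds[OF G g]
    proof eventually_elim
      case (elim p)
      then have "matrix_inv (C ** g p) = matrix_inv (g p) ** matrix_inv C"
        by (simp add: matrix_inv_mult C)
      then show ?case using elim unfolding s'_def
        by (simp add: matrix_inv_cancel flip: matrix_vector_mul_assoc)
    qed
    have "hol_vec x (\<lambda>p. g p *v s' p)"
      using hol_vec_cong[OF gs] hol_mat_vec[OF hol_mat_const hd] by simp
    from hol_vec_nhds[OF this] Cg have "\<forall>\<^sub>F p in nhds x. p \<in> U \<and> hol_vec p (\<lambda>p. g p *v s' p)"
      by eventually_elim simp
    then obtain W where W: "open W" "x \<in> W" "\<And>p. p \<in> W \<Longrightarrow> p \<in> U \<and> hol_vec p (\<lambda>p. g p *v s' p)"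
      unfolding eventually_nhds by blast
    have "hol_section A (trivs E) W s'"
      by (rule hol_sectionI[OF G W(1) g(1)]) (use W(3) in auto)
    moreover have "s' x \<in> flag_at E x (frac t)"
    proof -
      have "(C ** g x) *v s' x = d x"
        unfolding s'_def using eventually_nhds_x_imp_x[OF Cg] by (simp add: matrix_inv_cancel)
      then show ?thesis unfolding fl by (simp add: d_def e_def)
    qed
    moreover have "\<forall>\<^sub>F p in at x. s p = ((snd (chart_at x) p - snd (chart_at x) x) powi \<lfloor>t\<rfloor>) *s s' p"
    proof -
      have "\<forall>\<^sub>F p in at x. \<forall>i. ((C ** g p) *v s p) $ i = coord x p powi \<lceil>t - \<alpha> i\<rceil> * c i p"
        by (rule eventually_all_finite) (rule c)
      then show ?thesis using inv coord_neq
      proof eventually_elim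
        case (elim p)
        have "((C ** g p) *v s p) $ i = (coord x p powi \<lfloor>t\<rfloor> *s d p) $ i" for i
          using elim(1,3) by (simp add: d_def e_def ce power_int_add)
        then have "(C ** g p) *v s p = coord x p powi \<lfloor>t\<rfloor> *s d p" by (simp add: vec_eq_iff)
        then have "s p = matrix_inv (C ** g p) *v (coord x p powi \<lfloor>t\<rfloor> *s d p)"
          using elim(2) matrix_inv_cancel(2) by metis
        then show ?case by (simp add: matrix_vector_smult s'_def coord_def)
      qed
    qed
    ultimately show "s \<in> par_germs A E x t"
      unfolding par_germs_def using W(1,2) chart_at[of x]
      by (cases "chart_at x") fastforce
  qed
qed

lemma parabolic_adapted:
  fixes E :: "('x, 'n::finite) pbundle"
  assumes E: "parabolic_bundle A D E" and x: "x \<in> D" and g: "(U, g) \<in> trivs E" "x \<in> U"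
  obtains C :: "complex^'n^'n" and \<alpha> :: "'n \<Rightarrow> real"
  where "invertible C" "adapted x (par_germs A E x) (\<lambda>p. C ** g p) \<alpha>"
    "\<And>i. \<exists>j\<in>{1..len E x}. \<alpha> i = weight E x j"
proof -
  note G = parabolic_bundleD(2)[OF E]
  have "invertible (g x)" using bundleD(2)[OF G g(1)] g(2) by blast
  from parabolic_frame[OF E x this] obtain C :: "complex^'n^'n" and \<alpha> \<rho>
    where C: "invertible C" "\<And>i. 0 \<le> \<alpha> i \<and> \<alpha> i < 1"
    "\<And>i. \<rho> i \<in> {1..len E x}" "\<And>i. \<alpha> i = weight E x (\<rho> i)"
    "\<And>t. flag_at E x t = {v. \<forall>i. \<alpha> i < t \<longrightarrow> ((C ** g x) *v v) $ i = 0}" by blast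
  show thesis
    by (rule that[OF C(1) par_germs_adapted[OF G g C(1,2,5)]]) (use C(3,4) in blast)
qed

lemma matrix_vector_transpose_inv: "(transpose (matrix_inv M) *v \<psi>) $ i = (\<Sum>j\<in>UNIV. \<psi> $ j * (matrix_inv M *v axis i 1) $ j)"
  for M :: "complex^'n^'n"
  by (simp add: matrix_vector_mult_axis vector_matrix_mult_def mult.commute)

lemma dot_transpose_inv:
  fixes M :: "complex^'n^'n"
  assumes "invertible M"
  shows "(\<Sum>j\<in>UNIV. \<psi> $ j * s $ j) = (\<Sum>i\<in>UNIV. (transpose (matrix_inv M) *v \<psi>) $ i * (M *v s) $ i)"
proof -
  have "s $ j = (\<Sum>i\<in>UNIV. matrix_inv M $ j $ i * (M *v s) $ i)" for j
    using matrix_inv_cancel(2)[OF assms, of s]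
    by (metis (no_types, lifting) matrix_vector_mult_def vec_lambda_beta sum.cong)
  then have "(\<Sum>j\<in>UNIV. \<psi> $ j * s $ j) = (\<Sum>j\<in>UNIV. \<Sum>i\<in>UNIV. \<psi> $ j * (matrix_inv M $ j $ i * (M *v s) $ i))"
    by (metis (no_types, lifting) sum.cong sum_distrib_left)
  also have "\<dots> = (\<Sum>i\<in>UNIV. \<Sum>j\<in>UNIV. \<psi> $ j * (matrix_inv M $ j $ i * (M *v s) $ i))"
    by (rule sum.swap)
  also have "\<dots> = (\<Sum>i\<in>UNIV. (transpose (matrix_inv M) *v \<psi>) $ i * (M *v s) $ i)"
    unfolding matrix_vector_transpose_inv matrix_vector_mult_axis
    by (simp add: sum_distrib_right mult.assoc)
  finally show ?thesis .
qed

lemma dual_bundle: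
  assumes G: "holomorphic_bundle A G"
  shows "holomorphic_bundle A (dual_trivs G)"
  unfolding holomorphic_bundle_def
proof (intro conjI)
  have "(\<Union>(U, g)\<in>G. U) = UNIV" using G unfolding holomorphic_bundle_def by (rule conjunct1)
  moreover have "(\<Union>(U, g)\<in>dual_trivs G. U) = (\<Union>(U, g)\<in>G. U)"
    unfolding dual_trivs_def by force
  ultimately show "(\<Union>(U, g)\<in>dual_trivs G. U) = UNIV" by simp
  show "\<forall>(U, g)\<in>dual_trivs G. open U \<and> (\<forall>x\<in>U. invertible (g x))"
    unfolding dual_trivs_def using bundleD(1,2)[OF G]
    by (auto intro!: invertible_transpose_matrix invertible_matrix_inv)
  have "hol_matrix A (U \<inter> V) (\<lambda>x. transpose (matrix_inv (h x)) ** matrix_inv (transpose (matrix_inv (g x))))"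
    if t: "(U, g) \<in> G" "(V, h) \<in> G" for U g V h
  proof -
    have "hol_mat p (\<lambda>x. transpose (matrix_inv (h x)) ** matrix_inv (transpose (matrix_inv (g x))))"
      if p: "p \<in> U \<inter> V" for p
    proof -
      have "hol_mat p (\<lambda>q. transpose (g q ** matrix_inv (h q)))"
        using bundleD(3)[OF G t(2,1)] p by (intro hol_mat_transpose) auto
      moreover have "\<forall>\<^sub>F q in nhds p. transpose (matrix_inv (h q)) ** matrix_inv (transpose (matrix_inv (g q)))
          = transpose (g q ** matrix_inv (h q))"
        using triv_nhds[OF G t(1), of p] p
        by (auto elim!: eventually_mono
            simp: matrix_inv_transpose invertible_matrix_inv matrix_inv_matrix_inv matrix_transpose_mul)
      ultimately show ?thesis by (simp only: hol_mat_cong)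
    qed
    then show ?thesis using bundleD(1)[OF G t(1)] bundleD(1)[OF G t(2)]
      by (simp add: hol_matrix_iff open_Int)
  qed
  then show "\<forall>(U, g)\<in>dual_trivs G. \<forall>(V, h)\<in>dual_trivs G. hol_matrix A (U \<inter> V) (\<lambda>x. h x ** matrix_inv (g x))"
    unfolding dual_trivs_def by auto
qed

text \<open>A supply of local sections with a prescribed value at one point; they serve as test
  elements below.\<close>

lemma constant_section:
  assumes G: "holomorphic_bundle A G" and g: "(U, g) \<in> G"
  shows "hol_section A G U (\<lambda>p. matrix_inv (g p) *v a)"
proof (rule hol_sectionI[OF G bundleD(1)[OF G g] g order_refl])
  fix p assume p: "p \<in> U"
  have "\<forall>\<^sub>F q in nhds p. g q *v (matrix_inv (g q) *v a) = a"
    using triv_nhds[OF G g p] by eventually_elim (simp add: matrix_inv_cancel)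
  from hol_vec_cong[OF this] show "hol_vec p (\<lambda>q. g q *v (matrix_inv (g q) *v a))"
    by (simp add: hol_vec_const)
qed

lemma hol_section_vec:
  assumes "holomorphic_bundle A G" "open W" "hol_section A G W s" "p \<in> W" "(U, g) \<in> G" "p \<in> U"
  shows "hol_vec p (\<lambda>q. g q *v s q)"
  using assms hol_section_iff[OF assms(1,2)] by blast

lemma par_germsI:
  assumes "open W" "x \<in> W" "hol_section A (trivs E) W s" "s x \<in> flag_at E x t" "0 \<le> t" "t < 1"
  shows "s \<in> par_germs A E x t"
proof -
  obtain U z where "(U, z) \<in> A" "x \<in> U" using chart_ex by blast
  moreover have "\<lfloor>t\<rfloor> = 0" using assms(5,6) by linarith
  moreover have "frac t = t" using assms(5,6) by (simp add: frac_eq)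
  ultimately show ?thesis unfolding par_germs_def
    using assms(1-4) by (auto intro!: bexI[of _ "(U, z)"] exI[of _ W] exI[of _ s])
qed

text \<open>Evaluating a functional on the frame vectors gives its dual coordinates, hence their
  orders; conversely, the pairing is the sum of products of coordinates. The remaining work is to
  show that the order conditions make a functional a meromorphic germ of the dual bundle.\<close>

lemma adapted_dual:
  assumes E: "parabolic_bundle A D E" and x: "x \<in> D"
    and Q: "adapted x (par_germs A E x) Q \<gamma>"
  shows "adapted x (fgerms (par_dual A E) x) (\<lambda>p. transpose (matrix_inv (Q p))) (\<lambda>i. - \<gamma> i)"
  unfolding adapted_def
proof (intro conjI allI)
  note G = parabolic_bundleD(2)[OF E]
  show "\<forall>\<^sub>F p in at x. invertible (transpose (matrix_inv (Q p)))"
    using adaptedD(1)[OF Q]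
    by eventually_elim (simp add: invertible_transpose_matrix invertible_matrix_inv)
  fix t
  \<comment> \<open>The chart may vary with the functional and with the section, but the order that
    it expresses does not depend on it.\<close>
  have ch: "(\<exists>(U, z)\<in>A. \<exists>h. x \<in> U \<and> hol_germ A x h \<and> (\<forall>\<^sub>F p in at x. F p = (z p - z x) powi k * h p))
      \<longleftrightarrow> ordge x k F" for k F
    using ordge_iff_chart[of _ _ x k F] chart_ex[of x] by fast
  show "fgerms (par_dual A E) x t =
    {\<psi>. \<forall>i. ordge x \<lceil>t - - \<gamma> i\<rceil> (\<lambda>p. (transpose (matrix_inv (Q p)) *v \<psi> p) $ i)}" (is "_ = ?S")
  proof (intro equalityI subsetI)
    fix \<psi> assume "\<psi> \<in> fgerms (par_dual A E) x t"
    then have \<psi>: "ordge x \<lceil>a + t\<rceil> (\<lambda>p. \<Sum>i\<in>UNIV. \<psi> p $ i * s p $ i)"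
      if "s \<in> par_germs A E x a" for s a 
      using that unfolding par_dual_def filtered_bundle.select_convs mem_Collect_eq ch by blast
    show "\<psi> \<in> ?S"
      using \<psi>[OF adapted_frame[OF Q]]
      by (simp add: matrix_vector_transpose_inv add.commute del: transpose_matrix_vector)
  next
    fix \<psi> assume \<psi>: "\<psi> \<in> ?S"
    have *: "ordge x \<lceil>a + t\<rceil> (\<lambda>p. \<Sum>i\<in>UNIV. \<psi> p $ i * s p $ i)" if s: "s \<in> par_germs A E x a" for s a
    proof -
      have "ordge x \<lceil>a + t\<rceil> (\<lambda>p. \<Sum>i\<in>UNIV. (transpose (matrix_inv (Q p)) *v \<psi> p) $ i * (Q p *v s p) $ i)"
      proof (rule ordge_sum)
        fix i
        have "\<lceil>a + t\<rceil> \<le> \<lceil>t - - \<gamma> i\<rceil> + \<lceil>a - \<gamma> i\<rceil>" by linarith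
        then show "ordge x \<lceil>a + t\<rceil> (\<lambda>p. (transpose (matrix_inv (Q p)) *v \<psi> p) $ i * (Q p *v s p) $ i)"
          using \<psi> s unfolding adaptedD(2)[OF Q] by (intro ordge_mult_ge) blast+
      qed
      moreover have "\<forall>\<^sub>F p in at x. (\<Sum>i\<in>UNIV. \<psi> p $ i * s p $ i) =
          (\<Sum>i\<in>UNIV. (transpose (matrix_inv (Q p)) *v \<psi> p) $ i * (Q p *v s p) $ i)"
        using adaptedD(1)[OF Q] by eventually_elim (rule dot_transpose_inv)
      ultimately show ?thesis by (simp only: ordge_cong)
    qed
    obtain U g where g: "(U, g) \<in> trivs E" "x \<in> U" using triv_ex[OF G] by blast
    have gi: "\<forall>\<^sub>F p in nhds x. p \<in> U \<and> invertible (g p)" by (rule triv_nhds[OF G g])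
    obtain V z where c: "(V, z) \<in> A" "x \<in> V" using chart_ex by blast
    \<comment> \<open>The flag at level 0 is the whole fibre, so constant sections of a
      trivialisation lie in the module at 0. Testing on them bounds the poles of the coefficients of
      \<psi>.\<close>
    have e0: "(\<lambda>p. matrix_inv (g p) *v axis j 1) \<in> par_germs A E x 0" for j
      by (rule par_germsI[OF bundleD(1)[OF G g(1)] g(2) constant_section[OF G g(1)]])
        (simp_all add: flag_at_zero[OF E x])
    have "ordge x \<lceil>t\<rceil> (\<lambda>p. (transpose (matrix_inv (g p)) *v \<psi> p) $ j)" for j
      using *[OF e0[of j]] by (simp add: matrix_vector_transpose_inv del: transpose_matrix_vector)
    then have "\<forall>j. \<exists>h. hol_germ A x h \<and>
        (\<forall>\<^sub>F p in at x. (transpose (matrix_inv (g p)) *v \<psi> p) $ j = (z p - z x) powi \<lceil>t\<rceil> * h p)"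
      unfolding ordge_iff_chart[OF c] by blast
    from choice[OF this] obtain h where h: "\<And>j. hol_germ A x (h j)"
      "\<And>j. \<forall>\<^sub>F p in at x. (transpose (matrix_inv (g p)) *v \<psi> p) $ j = (z p - z x) powi \<lceil>t\<rceil> * h j p"
      by blast
    define \<psi>' where "\<psi>' p = transpose (g p) *v (\<chi> j. h j p)" for p
    have inv_tr: "transpose (matrix_inv M) *v (transpose M *v v) = v"
      "transpose M *v (transpose (matrix_inv M) *v v) = v" if "invertible M" for M :: "complex^'b^'b" and v
      using that by (simp_all add: matrix_vector_mul_assoc matrix_inv_works transpose_mat
          flip: matrix_transpose_mul del: transpose_matrix_vector)
    have ev: "\<forall>\<^sub>F p in nhds x. transpose (matrix_inv (g p)) *v \<psi>' p = (\<chi> j. h j p)"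
      using gi by eventually_elim (simp add: \<psi>'_def inv_tr del: transpose_matrix_vector)
    have "hol_vec x (\<lambda>p. \<chi> j. h j p)" unfolding hol_vec_def using h(1) by simp
    then have "hol_vec x (\<lambda>p. transpose (matrix_inv (g p)) *v \<psi>' p)"
      using hol_vec_cong[OF ev] by simp
    from hol_vec_nhds[OF this] gi
    have "\<forall>\<^sub>F p in nhds x. p \<in> U \<and> hol_vec p (\<lambda>p. transpose (matrix_inv (g p)) *v \<psi>' p)"
      by eventually_elim simp
    then obtain W where W: "open W" "x \<in> W"
      "\<And>p. p \<in> W \<Longrightarrow> p \<in> U \<and> hol_vec p (\<lambda>p. transpose (matrix_inv (g p)) *v \<psi>' p)"
      unfolding eventually_nhds by blast
    have "(U, \<lambda>p. transpose (matrix_inv (g p))) \<in> dual_trivs (trivs E)"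
      unfolding dual_trivs_def using g(1) by blast
    then have "hol_section A (dual_trivs (trivs E)) W \<psi>'"
      by (rule hol_sectionI[OF dual_bundle[OF G] W(1)]) (use W(3) in auto)
    moreover have "\<forall>\<^sub>F p in at x. \<psi> p = ((z p - z x) powi \<lceil>t\<rceil>) *s \<psi>' p"
    proof -
      have "\<forall>\<^sub>F p in at x. \<forall>j. (transpose (matrix_inv (g p)) *v \<psi> p) $ j = (z p - z x) powi \<lceil>t\<rceil> * h j p"
        by (rule eventually_all_finite) (rule h)
      moreover have "\<forall>\<^sub>F p in at x. invertible (g p)"
        using gi by (simp add: eventually_nhds_conv_at eventually_conj_iff)
      ultimately show ?thesis
      proof eventually_elim
        case (elim p)
        then have "transpose (matrix_inv (g p)) *v \<psi> p = (z p - z x) powi \<lceil>t\<rceil> *s (\<chi> j. h j p)"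
          by (simp add: vec_eq_iff)
        then have "transpose (g p) *v (transpose (matrix_inv (g p)) *v \<psi> p) =
          (z p - z x) powi \<lceil>t\<rceil> *s \<psi>' p" by (simp only: \<psi>'_def matrix_vector_smult)
        then show ?case by (simp only: inv_tr(2)[OF elim(2)])
      qed
    qed
    ultimately have "\<psi> \<in> mero_germs A (dual_trivs (trivs E)) x"
      unfolding mero_germs_def using c W(1,2) by blast
    then show "\<psi> \<in> fgerms (par_dual A E) x t"
      unfolding par_dual_def filtered_bundle.select_convs mem_Collect_eq ch using * by blast
  qed
qed

end

section \<open>Holomorphic maps\<close>

context surface
begin

text \<open>The identity theorem on a disc in a chart.\<close>

lemma hol_germ_zero_isolated:
  assumes h: "hol_germ A x h"
  shows "(\<forall>\<^sub>F p in nhds x. h p = 0) \<or> (\<forall>\<^sub>F p in at x. h p \<noteq> 0)"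
proof -
  obtain U z where c: "(U, z) \<in> A" "x \<in> U" using chart_ex by blast
  have "(\<lambda>\<zeta>. h (inv_into U z \<zeta>)) analytic_on {z x}" using h hol_germ_iff[OF c] by blast
  then obtain r where r: "r > 0" "(\<lambda>\<zeta>. h (inv_into U z \<zeta>)) holomorphic_on ball (z x) r"
    unfolding analytic_on_def by auto
  show ?thesis
  proof (cases "\<exists>\<beta>\<in>ball (z x) r. h (inv_into U z \<beta>) \<noteq> 0")
    case True
    then obtain \<beta> where "\<beta> \<in> ball (z x) r" "h (inv_into U z \<beta>) \<noteq> 0" by blast
    from non_zero_neighbour_alt[OF r(2) open_ball connected_ball _ this] r(1)
    have "\<forall>\<^sub>F \<zeta> in at (z x). h (inv_into U z \<zeta>) \<noteq> 0 \<and> \<zeta> \<in> ball (z x) r" by simp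
    then have "\<forall>\<^sub>F \<zeta> in at (z x). h (inv_into U z \<zeta>) \<noteq> 0" by (rule eventually_mono) simp
    then show ?thesis using eventually_at_chart[OF c, of "\<lambda>p. h p \<noteq> 0"] by simp
  next
    case False
    have "\<forall>\<^sub>F \<zeta> in nhds (z x). \<zeta> \<in> ball (z x) r"
      using r(1) by (intro eventually_nhds_in_open) auto
    then have "\<forall>\<^sub>F \<zeta> in nhds (z x). h (inv_into U z \<zeta>) = 0"
      by eventually_elim (use False in blast)
    then show ?thesis using eventually_nhds_chart[OF c, of "\<lambda>p. h p = 0"] by simp
  qed
qed

end

locale surface_map = X: surface AX + Y: surface AY
  for AX :: "'x::t2_space chart set" and AY :: "'y::t2_space chart set" +
  fixes f :: "'y \<Rightarrow> 'x"
  assumes hol: "holomorphic_map AY AX f" and nonconst: "\<not> f constant_on UNIV"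
    and connected_Y: "connected (UNIV :: 'y set)"
begin

abbreviation mult :: "'y \<Rightarrow> int" where "mult \<equiv> map_mult AY AX f"

lemma continuous: "continuous_on UNIV f"
  using hol unfolding holomorphic_map_def by blast

lemma open_vimage_f: "open S \<Longrightarrow> open (f -` S)"
  using continuous by (simp add: continuous_on_open_vimage)

lemma eventually_nhds_map: "\<forall>\<^sub>F q in nhds (f y). P q \<Longrightarrow> \<forall>\<^sub>F p in nhds y. P (f p)"
proof -
  assume "\<forall>\<^sub>F q in nhds (f y). P q"
  then obtain S where "open S" "f y \<in> S" "\<And>q. q \<in> S \<Longrightarrow> P q" by (auto simp: eventually_nhds)
  then show ?thesis unfolding eventually_nhds
    by (intro exI[of _ "f -` S"]) (auto intro: open_vimage_f)
qed

lemma hol_map_charts: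
  assumes "(V, w) \<in> AY" "(U, z) \<in> AX"
  shows "(\<lambda>\<zeta>. z (f (inv_into V w \<zeta>))) holomorphic_on w ` (V \<inter> f -` U)"
    "open (w ` (V \<inter> f -` U))"
proof -
  have "(z \<circ> f \<circ> inv_into V w) holomorphic_on w ` (V \<inter> f -` U)"
    using hol assms unfolding holomorphic_map_def by fast
  then show "(\<lambda>\<zeta>. z (f (inv_into V w \<zeta>))) holomorphic_on w ` (V \<inter> f -` U)"
    by (simp add: o_def)
  show "open (w ` (V \<inter> f -` U))"
    using Y.open_chart_image[OF assms(1)] open_vimage_f X.chartD(1)[OF assms(2)] by blast
qed

lemma hol_germ_map:
  assumes "hol_germ AX (f y) h"
  shows "hol_germ AY y (\<lambda>p. h (f p))"
proof -
  obtain U z where c: "(U, z) \<in> AX" "f y \<in> U" using X.chart_ex by blast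
  obtain V w where d: "(V, w) \<in> AY" "y \<in> V" using Y.chart_ex by blast
  have wy: "w y \<in> w ` (V \<inter> f -` U)" using c(2) d(2) by blast
  have inv: "inv_into V w (w y) = y" by (rule Y.chartD(5)[OF d])
  have "(\<lambda>\<zeta>. z (f (inv_into V w \<zeta>))) analytic_on {w y}"
    using hol_map_charts[OF d(1) c(1)] wy unfolding analytic_at by blast
  moreover have "(\<lambda>\<zeta>. h (inv_into U z \<zeta>)) analytic_on (\<lambda>\<zeta>. z (f (inv_into V w \<zeta>))) ` {w y}"
    using assms X.hol_germ_iff[OF c] inv by simp
  ultimately have "((\<lambda>\<zeta>. h (inv_into U z \<zeta>)) \<circ> (\<lambda>\<zeta>. z (f (inv_into V w \<zeta>)))) analytic_on {w y}"
    by (rule analytic_on_compose)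
  moreover have "\<forall>\<^sub>F \<zeta> in nhds (w y). ((\<lambda>\<zeta>. h (inv_into U z \<zeta>)) \<circ> (\<lambda>\<zeta>. z (f (inv_into V w \<zeta>)))) \<zeta>
      = h (f (inv_into V w \<zeta>))"
    using eventually_nhds_in_open[OF hol_map_charts(2)[OF d(1) c(1)] wy]
    by eventually_elim (use X.chartD(5)[OF c(1)] Y.chartD(5)[OF d(1)] in auto)
  ultimately show ?thesis
    unfolding Y.hol_germ_iff[OF d] using analytic_at_cong[OF _ refl] by metis
qed

section \<open>Isolation of fibres and multiplicities\<close>

lemma map_isolated_or_constant:
  "(\<forall>\<^sub>F p in nhds y. f p = f y) \<or> (\<forall>\<^sub>F p in at y. f p \<noteq> f y)"
proof -
  obtain U z where c: "(U, z) \<in> AX" "f y \<in> U" using X.chart_ex by blast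
  have "hol_germ AX (f y) (\<lambda>q. z q - z (f y))" using X.hol_germ_chart[OF c] by auto
  from Y.hol_germ_zero_isolated[OF hol_germ_map[OF this]]
  have dich: "(\<forall>\<^sub>F p in nhds y. z (f p) = z (f y)) \<or> (\<forall>\<^sub>F p in at y. z (f p) \<noteq> z (f y))" by simp
  have "\<forall>\<^sub>F p in nhds y. f p \<in> U"
    using X.chartD(1)[OF c(1)] c(2) by (intro eventually_nhds_map eventually_nhds_in_open)
  then have ev: "\<forall>\<^sub>F p in nhds y. z (f p) = z (f y) \<longleftrightarrow> f p = f y"
    by eventually_elim (use X.chartD(8)[OF c(1)] c(2) in \<open>auto simp: inj_on_def\<close>)
  from dich show ?thesis
  proof
    assume "\<forall>\<^sub>F p in nhds y. z (f p) = z (f y)"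
    then have "\<forall>\<^sub>F p in nhds y. f p = f y" using ev by eventually_elim simp
    then show ?thesis ..
  next
    assume "\<forall>\<^sub>F p in at y. z (f p) \<noteq> z (f y)"
    then have "\<forall>\<^sub>F p in at y. f p \<noteq> f y" by (rule eventually_mono) auto
    then show ?thesis ..
  qed
qed

text \<open>The points near which \<open>f\<close> is constantly equal to \<open>f y\<close> form an
  open set. Its complement is open too, by the dichotomy at points with value \<open>f y\<close> and
  by continuity at all others. Connectedness would make \<open>f\<close> constant.\<close>

lemma map_isolated: "\<forall>\<^sub>F p in at y. f p \<noteq> f y"
proof (rule ccontr)
  assume "\<not> ?thesis"
  then have y: "\<forall>\<^sub>F p in nhds y. f p = f y" using map_isolated_or_constant by blast
  define S where "S = {q. \<forall>\<^sub>F p in nhds q. f p = f y}"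
  have "open S"
    unfolding open_subopen[of S]
  proof
    fix q assume "q \<in> S"
    then have "\<forall>\<^sub>F p in nhds q. p \<in> S"
      unfolding S_def by (simp add: eventually_eventually)
    then show "\<exists>T. open T \<and> q \<in> T \<and> T \<subseteq> S" unfolding eventually_nhds by blast
  qed
  moreover have "open (- S)"
    unfolding open_subopen[of "- S"]
  proof
    fix q assume q: "q \<in> - S"
    have "\<forall>\<^sub>F p in nhds q. p \<notin> S"
    proof (cases "f q = f y")
      case True
      then have "\<forall>\<^sub>F p in at q. f p \<noteq> f y"
        using q map_isolated_or_constant[of q] by (auto simp: S_def)
      then have "\<forall>\<^sub>F p in at q. p \<notin> S"
        by (rule eventually_mono) (auto simp: S_def dest: eventually_nhds_x_imp_x)
      then show ?thesis using q by (simp add: eventually_nhds_conv_at)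
    next
      case False
      then have "\<forall>\<^sub>F p in nhds q. f p \<noteq> f y"
        by (intro eventually_nhds_map[of "\<lambda>r. r \<noteq> f y"] t1_space_nhds)
      then show ?thesis by (rule eventually_mono) (auto simp: S_def dest: eventually_nhds_x_imp_x)
    qed
    then show "\<exists>T. open T \<and> q \<in> T \<and> T \<subseteq> - S" unfolding eventually_nhds by blast
  qed
  moreover have "y \<in> S" using y by (simp add: S_def)
  ultimately have "S = UNIV"
    using connected_Y unfolding connected_clopen by (auto simp: closed_def)
  then have "f p = f y" for p using eventually_nhds_x_imp_x[of "\<lambda>p. f p = f y" p] by (auto simp: S_def)
  then show False using nonconst unfolding constant_on_def by blast
qed

text \<open>Isolation of fibres makes \<open>f\<close> send punctured neighbourhoods into punctured
  ones. This is what allows germs known only off \<open>f y\<close> to be composed with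
  \<open>f\<close>.\<close>

lemma eventually_at_map: "\<forall>\<^sub>F q in at (f y). P q \<Longrightarrow> \<forall>\<^sub>F p in at y. P (f p)"
proof -
  assume "\<forall>\<^sub>F q in at (f y). P q"
  then have "\<forall>\<^sub>F q in nhds (f y). q \<noteq> f y \<longrightarrow> P q" by (simp add: eventually_at_filter)
  from eventually_nhds_map[OF this] have "\<forall>\<^sub>F p in at y. f p \<noteq> f y \<longrightarrow> P (f p)"
    by (simp add: eventually_nhds_conv_at)
  then show ?thesis using map_isolated by eventually_elim simp
qed

text \<open>The zero order found in the given charts is the order of \<open>coord\<close> along
  \<open>f\<close>, an expression free of these charts. Uniqueness of orders then makes the
  multiplicity independent of the charts.\<close>

lemma zorder_map:
  assumes d: "(V, w) \<in> AY" "y \<in> V" and c: "(U, z) \<in> AX" "f y \<in> U"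
  defines "k \<equiv> zorder (\<lambda>\<zeta>. z (f (inv_into V w \<zeta>)) - z (f y)) (w y)"
  shows "k > 0" "Y.ordeq y k (\<lambda>p. X.coord (f y) (f p))"
proof -
  let ?F = "\<lambda>\<zeta>. z (f (inv_into V w \<zeta>)) - z (f y)"
  have inv: "inv_into V w (w y) = y" by (rule Y.chartD(5)[OF d])
  have wy: "w y \<in> w ` (V \<inter> f -` U)" using c(2) d(2) by blast
  then obtain r where r: "r > 0" "ball (w y) r \<subseteq> w ` (V \<inter> f -` U)"
    using hol_map_charts(2)[OF d(1) c(1)] open_contains_ball by blast
  have F: "?F holomorphic_on ball (w y) r"
    using holomorphic_on_subset[OF hol_map_charts(1)[OF d(1) c(1)] r(2)] by (intro holomorphic_intros)
  have "\<forall>\<^sub>F p in at y. z (f p) - z (f y) \<noteq> 0"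
    using eventually_at_map[OF X.chart_neq[OF c]] by simp
  then have "\<forall>\<^sub>F \<zeta> in at (w y). ?F \<zeta> \<noteq> 0"
    using Y.eventually_at_chart[OF d, of "\<lambda>p. z (f p) - z (f y) \<noteq> 0"] by simp
  moreover have "\<forall>\<^sub>F \<zeta> in at (w y). \<zeta> \<in> ball (w y) r"
    using r(1) by (intro eventually_at_in_open') auto
  ultimately have "\<exists>\<zeta>. ?F \<zeta> \<noteq> 0 \<and> \<zeta> \<in> ball (w y) r"
    by (intro eventually_happens'[of "at (w y)"] eventually_conj) auto
  then have ex: "\<exists>\<zeta>\<in>ball (w y) r. ?F \<zeta> \<noteq> 0" by blast
  have "w y \<in> ball (w y) r" using r(1) by simp
  from zorder_exist_zero[OF F open_ball connected_ball this ex]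
  obtain g r' where k: "k > 0" and r': "r' > 0" "g holomorphic_on cball (w y) r'"
    "\<And>\<zeta>. \<zeta> \<in> cball (w y) r' \<Longrightarrow> ?F \<zeta> = g \<zeta> * (\<zeta> - w y) ^ nat k \<and> g \<zeta> \<noteq> 0"
    unfolding k_def using inv by auto
  show "k > 0" by (rule k)
  have "g analytic_on {w y}"
    unfolding analytic_at using holomorphic_on_subset[OF r'(2)] r'(1)
    by (intro exI[of _ "ball (w y) r'"]) auto
  then have gh: "hol_germ AY y (\<lambda>p. g (w p))" by (rule Y.hol_germ_comp_chart[OF d])
  have "\<forall>\<^sub>F \<zeta> in nhds (w y). ?F \<zeta> = g \<zeta> * (\<zeta> - w y) ^ nat k"
    using eventually_nhds_in_open[of "ball (w y) r'" "w y"] r' by (auto elim: eventually_mono)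
  moreover have "\<forall>\<^sub>F \<zeta> in nhds (w y). \<zeta> \<in> w ` V"
    using Y.chartD(2)[OF d(1)] d(2) by (intro eventually_nhds_in_open) auto
  ultimately have "\<forall>\<^sub>F \<zeta> in nhds (w y). ?F \<zeta> = g (w (inv_into V w \<zeta>)) * (w (inv_into V w \<zeta>) - w y) ^ nat k"
    by eventually_elim (simp add: Y.chartD(6)[OF d(1)])
  then have ev: "\<forall>\<^sub>F p in nhds y. z (f p) - z (f y) = g (w p) * (w p - w y) ^ nat k"
    using Y.eventually_nhds_chart[OF d, of "\<lambda>p. z (f p) - z (f y) = g (w p) * (w p - w y) ^ nat k"] by simp
  have "Y.ordeq y (k + 0) (\<lambda>p. (w p - w y) powi k * g (w p))"
    using r' gh by (intro Y.ordeq_mult Y.ordeq_chart_powi[OF d] Y.unit_imp_ordeq) auto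
  moreover have "\<forall>\<^sub>F p in at y. z (f p) - z (f y) = (w p - w y) powi k * g (w p)"
    using ev k by (simp add: eventually_nhds_conv_at power_int_def mult.commute)
  ultimately have 1: "Y.ordeq y k (\<lambda>p. z (f p) - z (f y))" by (simp add: Y.ordeq_cong)
  \<comment> \<open>The coordinate of the given chart and \<open>coord\<close> differ by a unit
    \<open>e\<close>; its pullback is a unit at \<open>y\<close> and leaves the order
    unchanged.\<close>
  obtain e where e: "hol_germ AX (f y) e" "e (f y) \<noteq> 0"
    "\<forall>\<^sub>F q in nhds (f y). z q - z (f y) = X.coord (f y) q * e q"
    using X.ordeq_chart[OF c] by blast
  have "hol_germ AX (f y) (\<lambda>q. inverse (e q))" using e by (intro X.hol_germ_inverse)
  from hol_germ_map[OF this] have "Y.ordeq y (k + 0) (\<lambda>p. (z (f p) - z (f y)) * inverse (e (f p)))"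
    using e(2) 1 by (intro Y.ordeq_mult Y.unit_imp_ordeq) auto
  moreover have "\<forall>\<^sub>F q in nhds (f y). (z q - z (f y)) * inverse (e q) = X.coord (f y) q"
    using e(3) X.hol_germ_nonzero[OF e(1,2)] by eventually_elim simp
  from eventually_nhds_map[OF this]
  have "\<forall>\<^sub>F p in at y. (z (f p) - z (f y)) * inverse (e (f p)) = X.coord (f y) (f p)"
    by (simp add: eventually_nhds_conv_at)
  ultimately show "Y.ordeq y k (\<lambda>p. X.coord (f y) (f p))" by (simp add: Y.ordeq_cong)
qed

lemma mult_ordeq: "Y.ordeq y (mult y) (\<lambda>p. X.coord (f y) (f p))"
  and mult_pos: "mult y > 0"
proof -
  obtain U z where c: "(U, z) \<in> AX" "f y \<in> U" using X.chart_ex by blast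
  obtain V w where d: "(V, w) \<in> AY" "y \<in> V" using Y.chart_ex by blast
  have "\<exists>m. \<exists>(V, w)\<in>AY. \<exists>(U, z)\<in>AX. y \<in> V \<and> f y \<in> U \<and>
        m = zorder (\<lambda>\<zeta>. z (f (inv_into V w \<zeta>)) - z (f y)) (w y)"
    using c d by blast
  from someI_ex[OF this] obtain V w U z where "(V, w) \<in> AY" "(U, z) \<in> AX" "y \<in> V" "f y \<in> U"
    "mult y = zorder (\<lambda>\<zeta>. z (f (inv_into V w \<zeta>)) - z (f y)) (w y)"
    unfolding map_mult_def by blast
  then show "Y.ordeq y (mult y) (\<lambda>p. X.coord (f y) (f p))" "mult y > 0"
    using zorder_map by auto
qed

lemma mult_eq_zorder:
  assumes "(V, w) \<in> AY" "y \<in> V" "(U, z) \<in> AX" "f y \<in> U"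
  shows "mult y = zorder (\<lambda>\<zeta>. z (f (inv_into V w \<zeta>)) - z (f y)) (w y)"
  using Y.ordeq_unique[OF mult_ordeq zorder_map(2)[OF assms]] .

lemma ordeq_map: "X.ordeq (f y) k h \<Longrightarrow> Y.ordeq y (mult y * k) (\<lambda>p. h (f p))"
proof -
  assume "X.ordeq (f y) k h"
  then obtain c where c: "hol_germ AX (f y) c" "c (f y) \<noteq> 0"
    "\<forall>\<^sub>F q in at (f y). h q = X.coord (f y) q powi k * c q" unfolding X.ordeq_def by blast
  have "Y.ordeq y (mult y * k + 0) (\<lambda>p. X.coord (f y) (f p) powi k * c (f p))"
    using hol_germ_map[OF c(1)] c(2) by (intro Y.ordeq_mult Y.ordeq_powi mult_ordeq Y.unit_imp_ordeq)
  moreover have "\<forall>\<^sub>F p in at y. h (f p) = X.coord (f y) (f p) powi k * c (f p)"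
    by (rule eventually_at_map[OF c(3)])
  ultimately show ?thesis by (simp add: Y.ordeq_cong)
qed

lemma ordge_map: "X.ordge (f y) k h \<Longrightarrow> Y.ordge y (mult y * k) (\<lambda>p. h (f p))"
proof -
  assume "X.ordge (f y) k h"
  then obtain c where c: "hol_germ AX (f y) c"
    "\<forall>\<^sub>F q in at (f y). h q = X.coord (f y) q powi k * c q" unfolding X.ordge_def by blast
  have "Y.ordge y (mult y * k + 0) (\<lambda>p. X.coord (f y) (f p) powi k * c (f p))"
    by (intro Y.ordge_mult Y.ordeq_imp_ordge[OF Y.ordeq_powi[OF mult_ordeq]]
        Y.hol_imp_ordge[OF hol_germ_map[OF c(1)]])
  moreover have "\<forall>\<^sub>F p in at y. h (f p) = X.coord (f y) (f p) powi k * c (f p)"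
    by (rule eventually_at_map[OF c(2)])
  ultimately show ?thesis by (simp add: Y.ordge_cong)
qed

lemma mult_ceiling_ge: "\<lceil>real_of_int (mult y) * t\<rceil> \<le> mult y * \<lceil>t\<rceil>"
proof -
  have "real_of_int (mult y) * t \<le> real_of_int (mult y) * real_of_int \<lceil>t\<rceil>"
    using mult_pos[of y] by (intro mult_left_mono) (auto simp: le_of_int_ceiling)
  then show ?thesis by (simp add: ceiling_le_iff)
qed

text \<open>Every admissible summand has the required orders, because \<lceil>s - m *
  \<gamma>\<rceil> is at most k + m * \<lceil>t - \<gamma>\<rceil> whenever m * t + k is at least s.
  For the reverse inclusion one summand per frame vector suffices.\<close>

lemma pullback_germs_adapted:
  fixes E :: "('x, 'n::finite) pbundle"
  assumes Q: "X.adapted (f y) (par_germs AX E (f y)) Q \<gamma>"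
  shows "Y.adapted y (pullback_germs AY AX f E y) (\<lambda>p. Q (f p)) (\<lambda>i. real_of_int (mult y) * \<gamma> i)"
  unfolding Y.adapted_def
proof (intro conjI allI)
  show inv: "\<forall>\<^sub>F p in at y. invertible (Q (f p))"
    by (rule eventually_at_map[OF X.adaptedD(1)[OF Q]])
  fix s :: real
  let ?m = "real_of_int (mult y)"
  show "pullback_germs AY AX f E y s =
    {v. \<forall>i. Y.ordge y \<lceil>s - ?m * \<gamma> i\<rceil> (\<lambda>p. (Q (f p) *v v p) $ i)}" (is "_ = ?S")
  proof (intro equalityI subsetI)
    fix v assume "v \<in> pullback_germs AY AX f E y s"
    then obtain V w and N :: nat and c k t u where d: "(V, w) \<in> AY" "y \<in> V" and
      u: "\<And>i. i < N \<Longrightarrow> hol_germ AY y (c i) \<and> u i \<in> par_germs AX E (f y) (t i) \<and> ?m * t i + of_int (k i) \<ge> s"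
      and v: "\<forall>\<^sub>F p in at y. v p = (\<Sum>i<N. (c i p * (w p - w y) powi k i) *s u i (f p))"
      unfolding pullback_germs_def mem_Collect_eq by blast
    have "Y.ordge y \<lceil>s - ?m * \<gamma> j\<rceil> (\<lambda>p. (Q (f p) *v v p) $ j)" for j
    proof -
      have "Y.ordge y \<lceil>s - ?m * \<gamma> j\<rceil> (\<lambda>p. \<Sum>i<N. c i p * ((w p - w y) powi k i * (Q (f p) *v u i (f p)) $ j))"
      proof (rule Y.ordge_sum)
        fix i assume "i \<in> {..<N}"
        then have i: "hol_germ AY y (c i)" "u i \<in> par_germs AX E (f y) (t i)" "?m * t i + of_int (k i) \<ge> s"
          using u by auto
        have "X.ordge (f y) \<lceil>t i - \<gamma> j\<rceil> (\<lambda>q. (Q q *v u i q) $ j)"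
          using i(2) X.adaptedD(2)[OF Q] by blast
        then have "Y.ordge y (0 + (k i + mult y * \<lceil>t i - \<gamma> j\<rceil>))
            (\<lambda>p. c i p * ((w p - w y) powi k i * (Q (f p) *v u i (f p)) $ j))"
          by (intro Y.ordge_mult Y.hol_imp_ordge i(1) Y.ordeq_imp_ordge[OF Y.ordeq_chart_powi[OF d]] ordge_map)
        moreover have "\<lceil>s - ?m * \<gamma> j\<rceil> \<le> 0 + (k i + mult y * \<lceil>t i - \<gamma> j\<rceil>)"
        proof -
          have "\<lceil>s - ?m * \<gamma> j\<rceil> \<le> k i + \<lceil>?m * (t i - \<gamma> j)\<rceil>"
            using i(3) by (simp add: right_diff_distrib) linarith
          then show ?thesis using mult_ceiling_ge[of y "t i - \<gamma> j"] by linarith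
        qed
        ultimately show "Y.ordge y \<lceil>s - ?m * \<gamma> j\<rceil> (\<lambda>p. c i p * ((w p - w y) powi k i * (Q (f p) *v u i (f p)) $ j))"
          by (rule Y.ordge_mono)
      qed
      moreover have "\<forall>\<^sub>F p in at y. (\<Sum>i<N. c i p * ((w p - w y) powi k i * (Q (f p) *v u i (f p)) $ j)) =
          (Q (f p) *v v p) $ j"
        using v by eventually_elim (simp add: matrix_vector_sum matrix_vector_smult mult.assoc)
      ultimately show ?thesis by (simp only: Y.ordge_cong)
    qed
    then show "v \<in> ?S" by blast
  next
    fix v assume v: "v \<in> ?S"
    obtain V w where d: "(V, w) \<in> AY" "y \<in> V" using Y.chart_ex by blast
    let ?N = "CARD('n)"
    obtain e where e: "bij_betw e {..<?N} (UNIV :: 'n set)"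
      using ex_bij_betw_nat_finite[of "UNIV :: 'n set"] by (auto simp: atLeast0LessThan)
    \<comment> \<open>The least integer that, added to m * \<gamma>, reaches \<open>s\<close>; with
      it the frame vector at its own level \<gamma> is an admissible generator.\<close>
    define k where "k i = \<lceil>s - ?m * \<gamma> (e i)\<rceil>" for i
    have "\<forall>i. \<exists>c. hol_germ AY y c \<and>
        (\<forall>\<^sub>F p in at y. (Q (f p) *v v p) $ e i = (w p - w y) powi k i * c p)"
    proof
      fix i
      have "Y.ordge y (k i) (\<lambda>p. (Q (f p) *v v p) $ e i)" using v unfolding k_def by blast
      then show "\<exists>c. hol_germ AY y c \<and>
          (\<forall>\<^sub>F p in at y. (Q (f p) *v v p) $ e i = (w p - w y) powi k i * c p)"
        unfolding Y.ordge_iff_chart[OF d] .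
    qed
    from choice[OF this] obtain c where c: "\<And>i. hol_germ AY y (c i)"
      "\<And>i. \<forall>\<^sub>F p in at y. (Q (f p) *v v p) $ e i = (w p - w y) powi k i * c i p" by blast
    define u where "u i q = matrix_inv (Q q) *v axis (e i) 1" for i q
    have u: "u i \<in> par_germs AX E (f y) (\<gamma> (e i))" for i
      unfolding u_def by (rule X.adapted_frame[OF Q])
    have k: "?m * \<gamma> (e i) + of_int (k i) \<ge> s" for i unfolding k_def by linarith
    have "\<forall>\<^sub>F p in at y. \<forall>i\<in>{..<?N}. (Q (f p) *v v p) $ e i = (w p - w y) powi k i * c i p"
      by (rule eventually_ball_finite) (auto intro: c)
    then have ev: "\<forall>\<^sub>F p in at y. v p = (\<Sum>i<?N. (c i p * (w p - w y) powi k i) *s u i (f p))"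
      using inv
    proof eventually_elim
      case (elim p)
      have "v p = matrix_inv (Q (f p)) *v (\<Sum>i\<in>UNIV. (Q (f p) *v v p) $ i *s axis i 1)"
        unfolding basis_expansion by (simp add: matrix_inv_cancel elim(2))
      also have "\<dots> = (\<Sum>i\<in>UNIV. (Q (f p) *v v p) $ i *s (matrix_inv (Q (f p)) *v axis i 1))"
        by (simp add: matrix_vector_sum matrix_vector_smult)
      also have "\<dots> = (\<Sum>i<?N. (Q (f p) *v v p) $ e i *s u i (f p))"
        unfolding u_def by (rule sum.reindex_bij_betw[OF e, symmetric])
      also have "\<dots> = (\<Sum>i<?N. (c i p * (w p - w y) powi k i) *s u i (f p))"
        using elim(1) by (intro sum.cong) (auto simp: mult.commute)
      finally show ?case .
    qed
    show "v \<in> pullback_germs AY AX f E y s"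
      unfolding pullback_germs_def mem_Collect_eq
      by (rule bexI[OF _ d(1)], unfold prod.case,
          intro exI[of _ ?N] exI[of _ c] exI[of _ k] exI[of _ "\<lambda>i. \<gamma> (e i)"] exI[of _ u])
        (use d(2) c(1) u k ev in auto)
  qed
qed

lemma map_germs_pullback:
  assumes S: "X.adapted (f y) S Q \<gamma>" and T: "X.adapted (f y) T R \<delta>"
    and S': "Y.adapted y S' (\<lambda>p. Q (f p)) (\<lambda>i. real_of_int (mult y) * \<gamma> i)"
    and T': "Y.adapted y T' (\<lambda>p. R (f p)) (\<lambda>i. real_of_int (mult y) * \<delta> i)"
    and h: "\<forall>t. \<forall>s\<in>S t. (\<lambda>p. h p *v s p) \<in> T t"
  shows "\<forall>t. \<forall>s\<in>S' t. (\<lambda>p. h (f p) *v s p) \<in> T' t"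
  unfolding Y.adapted_map_iff[OF S' T']
proof (intro allI)
  fix i j
  have "X.ordge (f y) \<lceil>\<gamma> i - \<delta> j\<rceil> (\<lambda>p. (R p ** h p ** matrix_inv (Q p)) $ j $ i)"
    using h unfolding X.adapted_map_iff[OF S T] by blast
  from ordge_map[OF this] show "Y.ordge y \<lceil>real_of_int (mult y) * \<gamma> i - real_of_int (mult y) * \<delta> j\<rceil>
      (\<lambda>p. (R (f p) ** h (f p) ** matrix_inv (Q (f p))) $ j $ i)"
    by (rule Y.ordge_mono) (use mult_ceiling_ge[of y "\<gamma> i - \<delta> j"] in \<open>simp add: right_diff_distrib\<close>)
qed

end

section \<open>The degree of a map\<close>

text \<open>Rouche's theorem on a circle around \<open>a\<close>: if \<omega> is closer to
  \<open>G a\<close> than the minimum \<open>e\<close> of the modulus of \<open>G - G a\<close> on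
  the circle, then \<open>G - \<omega>\<close> and \<open>G - G a\<close> have equally many zeros
  inside. The latter vanishes only at \<open>a\<close>.\<close>

lemma local_zero_count:
  assumes R: "R > 0" and G: "G holomorphic_on ball a R"
    and iso: "\<And>\<zeta>. \<zeta> \<in> ball a R \<Longrightarrow> \<zeta> \<noteq> a \<Longrightarrow> G \<zeta> \<noteq> G a"
  obtains r e where "0 < r" "r < R" "e > 0"
    "\<And>\<omega>. dist (G a) \<omega> < e \<Longrightarrow>
      (\<Sum>p\<in>{\<zeta> \<in> ball a r. G \<zeta> = \<omega>}. zorder (\<lambda>\<zeta>. G \<zeta> - \<omega>) p) = zorder (\<lambda>\<zeta>. G \<zeta> - G a) a"
proof -
  define r where "r = R / 2"
  have r: "0 < r" "r < R" using R by (auto simp: r_def)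
  have sub: "sphere a r \<subseteq> ball a R" using r by auto
  have "continuous_on (sphere a r) (\<lambda>\<zeta>. norm (G \<zeta> - G a))"
    using holomorphic_on_imp_continuous_on[OF G] continuous_on_subset sub by (intro continuous_intros) blast
  moreover have "sphere a r \<noteq> {}" using r by simp
  ultimately obtain \<zeta>0 where \<zeta>0: "\<zeta>0 \<in> sphere a r"
    "\<And>\<zeta>. \<zeta> \<in> sphere a r \<Longrightarrow> norm (G \<zeta>0 - G a) \<le> norm (G \<zeta> - G a)"
    using continuous_attains_inf[of "sphere a r"] compact_sphere by blast
  define e where "e = norm (G \<zeta>0 - G a)"
  have "\<zeta>0 \<noteq> a" using \<zeta>0(1) r by auto
  then have e: "e > 0" using iso[of \<zeta>0] sub \<zeta>0(1) by (auto simp: e_def)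
  show thesis
  proof (rule that[OF r e])
    fix \<omega> assume \<omega>: "dist (G a) \<omega> < e"
    \<comment> \<open>A disc lying strictly between the circle of radius R / 2 and the disc of
      radius \<open>R\<close>. It contains the circle, and its closure is a compact subset of the
      larger disc, so only finitely many zeros occur in it.\<close>
    define S where "S = ball a (3 * R / 4)"
    define F where "F = (\<lambda>\<zeta>. G \<zeta> - G a)"
    have SR: "S \<subseteq> ball a R" "cball a (3 * R / 4) \<subseteq> ball a R" using R unfolding S_def by auto
    have F_path: "norm (F \<zeta>) > norm (G a - \<omega>)" if "\<zeta> \<in> sphere a r" for \<zeta>
      using \<zeta>0(2)[OF that] \<omega> by (simp add: F_def e_def dist_norm)
    have nc: "\<not> (\<lambda>\<zeta>. G \<zeta> - \<omega>) constant_on ball a R"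
    proof
      assume "(\<lambda>\<zeta>. G \<zeta> - \<omega>) constant_on ball a R"
      then obtain b where "\<forall>\<zeta>\<in>ball a R. G \<zeta> - \<omega> = b" unfolding constant_on_def by blast
      then have "G \<zeta>0 - \<omega> = G a - \<omega>" using sub \<zeta>0(1) R by (metis centre_in_ball subset_iff)
      then show False using iso[of \<zeta>0] sub \<zeta>0(1) \<open>\<zeta>0 \<noteq> a\<close> by auto
    qed
    have "finite {\<zeta> \<in> cball a (3 * R / 4). G \<zeta> - \<omega> = 0}"
      by (rule holomorphic_compact_finite_zeros[OF _ open_ball connected_ball compact_cball SR(2) nc])
        (intro holomorphic_intros G)
    then have fin: "finite {\<zeta> \<in> S. F \<zeta> + (G a - \<omega>) = 0}"
      by (rule finite_subset[rotated]) (auto simp: S_def F_def)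
    have zf: "{\<zeta> \<in> S. F \<zeta> = 0} = {a}"
    proof
      show "{\<zeta> \<in> S. F \<zeta> = 0} \<subseteq> {a}" using iso SR(1) by (fastforce simp: F_def)
      show "{a} \<subseteq> {\<zeta> \<in> S. F \<zeta> = 0}" using R by (simp add: F_def S_def)
    qed
    have w1: "winding_number (circlepath a r) \<zeta> = 1" if "\<zeta> \<in> ball a r" for \<zeta>
      using that by (intro winding_number_circlepath) (auto simp: dist_norm norm_minus_commute)
    have w0: "winding_number (circlepath a r) \<zeta> = 0" if "\<zeta> \<notin> cball a r" for \<zeta>
      by (rule winding_number_zero_outside[of _ "cball a r"]) (use that r in auto)
    have "(\<Sum>p\<in>{\<zeta> \<in> S. F \<zeta> + (G a - \<omega>) = 0}. winding_number (circlepath a r) p * zorder (\<lambda>\<zeta>. F \<zeta> + (G a - \<omega>)) p)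
        = (\<Sum>p\<in>{\<zeta> \<in> S. F \<zeta> = 0}. winding_number (circlepath a r) p * zorder F p)"
    proof (rule Rouche_theorem)
      show "open S" "connected S" unfolding S_def by auto
      show "F holomorphic_on S" unfolding F_def
        by (intro holomorphic_intros holomorphic_on_subset[OF G SR(1)])
      show "path_image (circlepath a r) \<subseteq> S" using r R unfolding S_def r_def by auto
      show "\<forall>\<zeta>\<in>path_image (circlepath a r). cmod (G a - \<omega>) < cmod (F \<zeta>)"
        using F_path r by auto
      show "\<forall>\<zeta>. \<zeta> \<notin> S \<longrightarrow> winding_number (circlepath a r) \<zeta> = 0"
        using w0 R by (auto simp: S_def r_def)
    qed (use fin zf in auto)
    also have "\<dots> = of_int (zorder F a)" unfolding zf using w1[of a] r by simp
    \<comment> \<open>The winding number is 1 inside the circle and 0 outside, and no zero lies on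
      the circle by \<open>F_path\<close>. So only the zeros in the inner disc contribute.\<close>
    also have "(\<Sum>p\<in>{\<zeta> \<in> S. F \<zeta> + (G a - \<omega>) = 0}. winding_number (circlepath a r) p * zorder (\<lambda>\<zeta>. F \<zeta> + (G a - \<omega>)) p)
       = (\<Sum>p\<in>{\<zeta> \<in> ball a r. G \<zeta> = \<omega>}. of_int (zorder (\<lambda>\<zeta>. G \<zeta> - \<omega>) p))"
    proof (rule sum.mono_neutral_cong_right[OF fin])
      show "{\<zeta> \<in> ball a r. G \<zeta> = \<omega>} \<subseteq> {\<zeta> \<in> S. F \<zeta> + (G a - \<omega>) = 0}"
        using R by (auto simp: S_def F_def r_def)
      show "\<forall>p\<in>{\<zeta> \<in> S. F \<zeta> + (G a - \<omega>) = 0} - {\<zeta> \<in> ball a r. G \<zeta> = \<omega>}.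
          winding_number (circlepath a r) p * of_int (zorder (\<lambda>\<zeta>. F \<zeta> + (G a - \<omega>)) p) = 0"
      proof
        fix p assume p: "p \<in> {\<zeta> \<in> S. F \<zeta> + (G a - \<omega>) = 0} - {\<zeta> \<in> ball a r. G \<zeta> = \<omega>}"
        then have "F p = - (G a - \<omega>)" by (simp add: F_def)
        then have "norm (F p) = norm (G a - \<omega>)" by (simp only: norm_minus_cancel)
        then have "p \<notin> sphere a r" using F_path[of p] by auto
        moreover have "p \<notin> ball a r" using p by (auto simp: F_def)
        ultimately have "p \<notin> cball a r" by auto
        then show "winding_number (circlepath a r) p * of_int (zorder (\<lambda>\<zeta>. F \<zeta> + (G a - \<omega>)) p) = 0"
          using w0 by simp
      qed
      fix p assume "p \<in> {\<zeta> \<in> ball a r. G \<zeta> = \<omega>}"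
      then show "winding_number (circlepath a r) p * of_int (zorder (\<lambda>\<zeta>. F \<zeta> + (G a - \<omega>)) p)
          = of_int (zorder (\<lambda>\<zeta>. G \<zeta> - \<omega>) p)"
        using w1 by (simp add: F_def)
    qed
    finally have "of_int (\<Sum>p\<in>{\<zeta> \<in> ball a r. G \<zeta> = \<omega>}. zorder (\<lambda>\<zeta>. G \<zeta> - \<omega>) p)
        = (of_int (zorder F a) :: complex)" by simp
    then show "(\<Sum>p\<in>{\<zeta> \<in> ball a r. G \<zeta> = \<omega>}. zorder (\<lambda>\<zeta>. G \<zeta> - \<omega>) p) = zorder (\<lambda>\<zeta>. G \<zeta> - G a) a"
      unfolding F_def of_int_eq_iff .
  qed
qed

lemma finite_separation:
  fixes F :: "'a::t2_space set"
  assumes "finite F"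
  obtains V where "\<And>y. y \<in> F \<Longrightarrow> open (V y) \<and> y \<in> V y" "disjoint_family_on V F"
proof -
  define sep where "sep = (\<lambda>(y::'a, y'). SOME UV. open (fst UV) \<and> open (snd UV) \<and> y \<in> fst UV \<and> y' \<in> snd UV \<and>
      fst UV \<inter> snd UV = {})"
  have sep: "open (fst (sep (y, y')))" "open (snd (sep (y, y')))" "y \<in> fst (sep (y, y'))" "y' \<in> snd (sep (y, y'))"
      "fst (sep (y, y')) \<inter> snd (sep (y, y')) = {}" if neq: "y \<noteq> y'" for y y'
  proof -
    obtain U U' where "open U" "open U'" "y \<in> U" "y' \<in> U'" "U \<inter> U' = {}"
      using hausdorff[OF neq] by blast
    then have "\<exists>UV. open (fst UV) \<and> open (snd UV) \<and> y \<in> fst UV \<and> y' \<in> snd UV \<and> fst UV \<inter> snd UV = {}"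
      by (intro exI[of _ "(U, U')"]) simp
    from someI_ex[OF this] show "open (fst (sep (y, y')))" "open (snd (sep (y, y')))" "y \<in> fst (sep (y, y'))"
      "y' \<in> snd (sep (y, y'))" "fst (sep (y, y')) \<inter> snd (sep (y, y')) = {}" unfolding sep_def by auto
  qed
  \<comment> \<open>\<open>sep\<close> is chosen for ordered pairs and need not be symmetric. Each
    point takes its side from both orders, so that two of the sets are disjoint already because of
    one pair.\<close>
  let ?V = "\<lambda>y. \<Inter>y'\<in>F - {y}. fst (sep (y, y')) \<inter> snd (sep (y', y))"
  show thesis
  proof (rule that[of ?V])
    fix y assume "y \<in> F"
    show "open (?V y) \<and> y \<in> ?V y"
    proof
      show "open (?V y)" using assms sep(1,2) by (intro open_INT ballI open_Int) auto
      show "y \<in> ?V y"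
      proof
        fix y' assume "y' \<in> F - {y}"
        then have "y \<noteq> y'" "y' \<noteq> y" by auto
        then show "y \<in> fst (sep (y, y')) \<inter> snd (sep (y', y))" using sep(3,4) by blast
      qed
    qed
  next
    show "disjoint_family_on ?V F"
      unfolding disjoint_family_on_def
    proof (intro ballI impI)
      fix y y' assume "y \<in> F" "y' \<in> F" "y \<noteq> y'"
      then show "?V y \<inter> ?V y' = {}" using sep(5)[of y y'] by fastforce
    qed
  qed
qed

text \<open>Every point has a neighbourhood in which at most the point itself satisfies
  \<open>P\<close>. The centres of a finite subcover therefore include all such points.\<close>

lemma finite_of_isolated:
  assumes "compact (UNIV :: 'a::topological_space set)" "\<And>x::'a. \<forall>\<^sub>F p in at x. \<not> P p"
  shows "finite {x. P x}"
proof -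
  have "\<forall>x. \<exists>S. open S \<and> x \<in> S \<and> (\<forall>p\<in>S. p \<noteq> x \<longrightarrow> \<not> P p)"
    using assms(2) unfolding eventually_at_topological by simp
  from choice[OF this] obtain S where S: "\<forall>x. open (S x) \<and> x \<in> S x \<and> (\<forall>p\<in>S x. p \<noteq> x \<longrightarrow> \<not> P p)" ..
  obtain C where C: "finite C" "UNIV \<subseteq> (\<Union>x\<in>C. S x)"
    by (rule compactE_image[OF assms(1), of UNIV S]) (use S in auto)
  have "{x. P x} \<subseteq> C"
  proof
    fix p assume p: "p \<in> {x. P x}"
    obtain x where "x \<in> C" "p \<in> S x" using C(2) by blast
    then show "p \<in> C" using S p by auto
  qed
  then show ?thesis using C(1) finite_subset by blast
qed

section \<open>Constancy of the number of preimages counted with multiplicity\<close>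

locale compact_surface_map = surface_map +
  assumes compact_Y: "compact (UNIV :: 'b set)" and connected_X: "connected (UNIV :: 'a set)"
begin

lemma finite_fibre: "finite (f -` {x})"
proof -
  have "\<forall>\<^sub>F p in at y. f p \<noteq> x" for y
  proof (cases "f y = x")
    case True then show ?thesis using map_isolated[of y] by simp
  next
    case False
    then have "\<forall>\<^sub>F p in nhds y. f p \<noteq> x"
      by (intro eventually_nhds_map[of "\<lambda>r. r \<noteq> x"] t1_space_nhds)
    then show ?thesis by (simp add: eventually_nhds_conv_at)
  qed
  then have "finite {y. f y = x}" by (rule finite_of_isolated[OF compact_Y])
  then show ?thesis by (simp add: vimage_def)
qed

text \<open>In charts the nearby fibres are the zeros of \<open>G - \<omega>\<close> in a small disc
  and the multiplicities are their orders, so the local zero count applies.\<close>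

lemma local_degree:
  assumes V0: "open V0" "y \<in> V0"
  obtains V T where "open V" "y \<in> V" "V \<subseteq> V0" "open T" "f y \<in> T"
    "\<And>x'. x' \<in> T \<Longrightarrow> (\<Sum>p\<in>V \<inter> f -` {x'}. mult p) = mult y"
proof -
  obtain U z where c: "(U, z) \<in> AX" "f y \<in> U" using X.chart_ex by blast
  obtain V w where d: "(V, w) \<in> AY" "y \<in> V" using Y.chart_ex by blast
  obtain V1 where V1: "open V1" "y \<in> V1" "\<And>p. p \<in> V1 \<Longrightarrow> p \<noteq> y \<Longrightarrow> f p \<noteq> f y"
    using map_isolated[of y] by (auto simp: eventually_at_topological)
  \<comment> \<open>On this set \<open>y\<close> is the only point with value \<open>f y\<close>,
    all values lie in one chart, and the neighbourhood to be found stays inside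
    \<open>V0\<close>.\<close>
  let ?S = "V0 \<inter> V1 \<inter> f -` U"
  have "open (w ` (V \<inter> ?S))"
    by (intro Y.open_chart_image[OF d(1)] open_Int V0 V1 open_vimage_f X.chartD(1)[OF c(1)])
  moreover have "w y \<in> w ` (V \<inter> ?S)" using d V0 V1 c by blast
  ultimately obtain R where R: "R > 0" "ball (w y) R \<subseteq> w ` (V \<inter> ?S)"
    using open_contains_ball by blast
  define G where "G = (\<lambda>\<zeta>. z (f (inv_into V w \<zeta>)))"
  have winv: "inv_into V w (w p) = p" if "p \<in> V" for p by (rule Y.chartD(5)[OF d(1) that])
  have Ga: "G (w y) = z (f y)" using winv[OF d(2)] by (simp add: G_def)
  have ball_in: "p \<in> ?S" if "p \<in> V" "w p \<in> ball (w y) R" for p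
  proof -
    have "w p \<in> w ` (V \<inter> ?S)" using that(2) R(2) by blast
    then obtain p' where "p' \<in> V" "p' \<in> ?S" "w p = w p'" by blast
    then show ?thesis using winv that(1) by metis
  qed
  have G: "G holomorphic_on ball (w y) R"
    unfolding G_def by (rule holomorphic_on_subset[OF hol_map_charts(1)[OF d(1) c(1)]]) (use R(2) in blast)
  have iso: "G \<zeta> \<noteq> G (w y)" if \<zeta>: "\<zeta> \<in> ball (w y) R" "\<zeta> \<noteq> w y" for \<zeta>
  proof -
    obtain p where p: "p \<in> V" "p \<in> ?S" "\<zeta> = w p" using \<zeta>(1) R(2) by blast
    then have "f p \<noteq> f y" using V1(3)[of p] \<zeta>(2) by auto
    then have "z (f p) \<noteq> z (f y)" using X.chartD(8)[OF c(1)] p c(2) by (auto simp: inj_on_def)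
    then show ?thesis using p winv Ga by (simp add: G_def)
  qed
  obtain r e where r: "0 < r" "r < R" "e > 0" and count: "\<And>\<omega>. dist (G (w y)) \<omega> < e \<Longrightarrow>
      (\<Sum>p\<in>{\<zeta> \<in> ball (w y) r. G \<zeta> = \<omega>}. zorder (\<lambda>\<zeta>. G \<zeta> - \<omega>) p) = zorder (\<lambda>\<zeta>. G \<zeta> - G (w y)) (w y)"
    by (rule local_zero_count[OF R(1) G], (rule iso; assumption), rule that)
  let ?V = "V \<inter> w -` ball (w y) r" and ?T = "U \<inter> z -` ball (z (f y)) e"
  have VR: "p \<in> ?S" if "p \<in> ?V" for p using ball_in[of p] that r by auto
  show thesis
  proof (rule that[of ?V ?T])
    show "open ?V" "open ?T"
      using Y.open_chart_vimage[OF d(1)] X.open_chart_vimage[OF c(1)] by auto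
    show "y \<in> ?V" "f y \<in> ?T" using d(2) c(2) r by auto
    show "?V \<subseteq> V0" using VR by blast
    fix x' assume x': "x' \<in> ?T"
    have zx: "z x'' = z x' \<longleftrightarrow> x'' = x'" if "x'' \<in> U" for x''
      using X.chartD(8)[OF c(1)] x' that by (auto simp: inj_on_def)
    have "(\<Sum>p\<in>?V \<inter> f -` {x'}. mult p) = (\<Sum>\<zeta>\<in>{\<zeta> \<in> ball (w y) r. G \<zeta> = z x'}. zorder (\<lambda>\<zeta>. G \<zeta> - z x') \<zeta>)"
    proof (rule sum.reindex_bij_witness[of _ "inv_into V w" w])
      fix p assume p: "p \<in> ?V \<inter> f -` {x'}"
      then have "p \<in> V" "f p = x'" "f p \<in> U" using VR by auto
      then show "inv_into V w (w p) = p" "w p \<in> {\<zeta> \<in> ball (w y) r. G \<zeta> = z x'}"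
        using winv p by (auto simp: G_def)
      show "zorder (\<lambda>\<zeta>. G \<zeta> - z x') (w p) = mult p"
        using mult_eq_zorder[OF d(1) \<open>p \<in> V\<close> c(1) \<open>f p \<in> U\<close>] \<open>f p = x'\<close> by (simp add: G_def)
    next
      fix \<zeta> assume \<zeta>: "\<zeta> \<in> {\<zeta> \<in> ball (w y) r. G \<zeta> = z x'}"
      then have "\<zeta> \<in> ball (w y) R" using r by auto
      then obtain p where p: "p \<in> V" "p \<in> ?S" "\<zeta> = w p" using R(2) by blast
      then have "f p = x'" using \<zeta> winv zx[of "f p"] by (auto simp: G_def)
      then show "w (inv_into V w \<zeta>) = \<zeta>" "inv_into V w \<zeta> \<in> ?V \<inter> f -` {x'}"
        using p winv \<zeta> by auto
    qed
    also have "\<dots> = zorder (\<lambda>\<zeta>. G \<zeta> - G (w y)) (w y)"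
      using x' by (intro count) (simp add: Ga)
    also have "\<dots> = mult y"
      using mult_eq_zorder[OF d c] unfolding Ga by (simp add: G_def)
    finally show "(\<Sum>p\<in>?V \<inter> f -` {x'}. mult p) = mult y" .
  qed
qed

text \<open>Around each point of the fibre, a neighbourhood contributes the multiplicity of that
  point to every nearby fibre. Compactness of the source excludes preimages elsewhere.\<close>

lemma degree_locally_constant:
  "\<exists>T. open T \<and> x \<in> T \<and> (\<forall>x'\<in>T. (\<Sum>y\<in>f -` {x'}. mult y) = (\<Sum>y\<in>f -` {x}. mult y))"
proof -
  let ?F = "f -` {x}"
  obtain V0 where V0: "\<And>y. y \<in> ?F \<Longrightarrow> open (V0 y) \<and> y \<in> V0 y" "disjoint_family_on V0 ?F"
    by (rule finite_separation[OF finite_fibre]) (rule that)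
  have "\<forall>y\<in>?F. \<exists>V T. open V \<and> y \<in> V \<and> V \<subseteq> V0 y \<and> open T \<and> f y \<in> T \<and>
      (\<forall>x'\<in>T. (\<Sum>p\<in>V \<inter> f -` {x'}. mult p) = mult y)"
  proof
    fix y assume "y \<in> ?F"
    then have "open (V0 y)" "y \<in> V0 y" using V0(1) by auto
    then show "\<exists>V T. open V \<and> y \<in> V \<and> V \<subseteq> V0 y \<and> open T \<and> f y \<in> T \<and>
      (\<forall>x'\<in>T. (\<Sum>p\<in>V \<inter> f -` {x'}. mult p) = mult y)" by (rule local_degree) blast
  qed
  then obtain V T where V: "\<And>y. y \<in> ?F \<Longrightarrow> open (V y) \<and> y \<in> V y \<and> V y \<subseteq> V0 y \<and> open (T y) \<and> f y \<in> T y \<and>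
      (\<forall>x'\<in>T y. (\<Sum>p\<in>V y \<inter> f -` {x'}. mult p) = mult y)" by metis
  \<comment> \<open>The image of \<open>K\<close> is compact, hence closed, and it misses
    \<open>x\<close>. Over its complement all fibres lie inside the union of the sets
    \<open>V y\<close>.\<close>
  define K where "K = UNIV - (\<Union>y\<in>?F. V y)"
  have "closed K" unfolding K_def using V by (intro closed_Diff) auto
  then have "compact K" using compact_Y compact_Int_closed[of UNIV K] by simp
  then have "compact (f ` K)" using continuous continuous_on_subset by (intro compact_continuous_image) auto
  then have cK: "closed (f ` K)" by (rule compact_imp_closed)
  have xK: "x \<notin> f ` K" unfolding K_def using V by auto
  let ?T = "(\<Inter>y\<in>?F. T y) \<inter> - (f ` K)"
  have "open ?T" using V finite_fibre cK by (intro open_Int open_INT) auto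
  moreover have "x \<in> ?T" using V xK by auto
  moreover have "(\<Sum>y\<in>f -` {x'}. mult y) = (\<Sum>y\<in>?F. mult y)" if x': "x' \<in> ?T" for x'
  proof -
    have "f -` {x'} = (\<Union>y\<in>?F. V y \<inter> f -` {x'})" using x' by (auto simp: K_def)
    also have "sum mult \<dots> = (\<Sum>y\<in>?F. \<Sum>p\<in>V y \<inter> f -` {x'}. mult p)"
    proof (rule sum.UNION_disjoint)
      show "\<forall>y\<in>?F. \<forall>y'\<in>?F. y \<noteq> y' \<longrightarrow> V y \<inter> f -` {x'} \<inter> (V y' \<inter> f -` {x'}) = {}"
        using V V0(2) unfolding disjoint_family_on_def by blast
    qed (use finite_fibre in auto)
    also have "\<dots> = (\<Sum>y\<in>?F. mult y)" using V x' by (intro sum.cong) auto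
    finally show ?thesis .
  qed
  ultimately show ?thesis by (intro exI[of _ ?T] conjI ballI)
qed

lemma degree_constant: "(\<Sum>y\<in>f -` {x}. mult y) = (\<Sum>y\<in>f -` {x'}. mult y)"
proof (rule connected_local_const[OF connected_X])
  show "\<forall>a\<in>UNIV. \<forall>\<^sub>F b in at a. (\<Sum>y\<in>f -` {a}. mult y) = (\<Sum>y\<in>f -` {b}. mult y)"
  proof
    fix a :: 'a
    obtain T where "open T" "a \<in> T" "\<forall>x'\<in>T. (\<Sum>y\<in>f -` {x'}. mult y) = (\<Sum>y\<in>f -` {a}. mult y)"
      using degree_locally_constant by blast
    then show "\<forall>\<^sub>F b in at a. (\<Sum>y\<in>f -` {a}. mult y) = (\<Sum>y\<in>f -` {b}. mult y)"
      unfolding eventually_at_topological by metis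
  qed
qed auto

end

section \<open>Pullback of parabolic homomorphisms\<close>

context surface
begin

lemma hol_bundle_map_iff:
  assumes "holomorphic_bundle A G" "holomorphic_bundle A H" "open W"
  shows "hol_bundle_map A G H W h \<longleftrightarrow>
    (\<forall>p\<in>W. \<forall>(U, g)\<in>G. \<forall>(V, k)\<in>H. p \<in> U \<longrightarrow> p \<in> V \<longrightarrow>
       hol_mat p (\<lambda>q. k q ** h q ** matrix_inv (g q)))"
proof -
  have "open U" if "(U, g) \<in> G" for U g using bundleD(1)[OF assms(1) that] .
  moreover have "open V" if "(V, k) \<in> H" for V k using bundleD(1)[OF assms(2) that] .
  ultimately have "hol_bundle_map A G H W h \<longleftrightarrow> (\<forall>(U, g)\<in>G. \<forall>(V, k)\<in>H. \<forall>p\<in>U \<inter> V \<inter> W.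
       hol_mat p (\<lambda>q. k q ** h q ** matrix_inv (g q)))"
    unfolding hol_bundle_map_def
    by (intro ball_cong refl) (use assms(3) in \<open>auto simp: hol_matrix_iff open_Int intro!: ball_cong\<close>)
  then show ?thesis by fast
qed

lemma tensor_bundle:
  assumes G: "holomorphic_bundle A G" and H: "holomorphic_bundle A H"
  shows "holomorphic_bundle A (tensor_trivs G H)"
  unfolding holomorphic_bundle_def
proof (intro conjI)
  show "(\<Union>(U, g)\<in>tensor_trivs G H. U) = UNIV"
  proof (intro set_eqI iffI UNIV_I)
    fix x
    obtain U g V h where "(U, g) \<in> G" "x \<in> U" "(V, h) \<in> H" "x \<in> V"
      using triv_ex[OF G, of x] triv_ex[OF H, of x] by blast
    then have "(U \<inter> V, \<lambda>x. kronecker (g x) (h x)) \<in> tensor_trivs G H" "x \<in> U \<inter> V"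
      unfolding tensor_trivs_def by blast+
    then show "x \<in> (\<Union>(U, g)\<in>tensor_trivs G H. U)" by blast
  qed
  show "\<forall>(U, g)\<in>tensor_trivs G H. open U \<and> (\<forall>x\<in>U. invertible (g x))"
    unfolding tensor_trivs_def using bundleD(1,2)[OF G] bundleD(1,2)[OF H]
    by (auto intro!: invertible_kronecker open_Int)
  have "hol_matrix A (U \<inter> U' \<inter> (V \<inter> V'))
      (\<lambda>x. kronecker (h x) (h' x) ** matrix_inv (kronecker (g x) (g' x)))"
    if t: "(U, g) \<in> G" "(V, h) \<in> G" "(U', g') \<in> H" "(V', h') \<in> H" for U g V h U' g' V' h'
  proof -
    have op: "open (U \<inter> U' \<inter> (V \<inter> V'))"
      using bundleD(1)[OF G] bundleD(1)[OF H] t by blast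
    have "hol_mat p (\<lambda>x. kronecker (h x) (h' x) ** matrix_inv (kronecker (g x) (g' x)))"
      if p: "p \<in> U \<inter> U' \<inter> (V \<inter> V')" for p
    proof -
      have "hol_mat p (\<lambda>q. kronecker (h q ** matrix_inv (g q)) (h' q ** matrix_inv (g' q)))"
        using bundleD(3)[OF G t(1,2)] bundleD(3)[OF H t(3,4)] p by (intro hol_mat_kronecker) auto
      moreover have "\<forall>\<^sub>F q in nhds p. kronecker (h q) (h' q) ** matrix_inv (kronecker (g q) (g' q))
          = kronecker (h q ** matrix_inv (g q)) (h' q ** matrix_inv (g' q))"
        using eventually_nhds_in_open[OF op p]
        by eventually_elim (use bundleD(2)[OF G t(1)] bundleD(2)[OF H t(3)] in
            \<open>auto simp: matrix_inv_kronecker kronecker_mult\<close>)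
      ultimately show ?thesis by (simp only: hol_mat_cong)
    qed
    then show ?thesis using hol_matrix_iff[OF op] by blast
  qed
  then show "\<forall>(U, g)\<in>tensor_trivs G H. \<forall>(V, h)\<in>tensor_trivs G H.
      hol_matrix A (U \<inter> V) (\<lambda>x. h x ** matrix_inv (g x))"
    unfolding tensor_trivs_def by auto
qed

end

section \<open>Pulling back trivialisations, filtrations and homomorphisms\<close>

context surface_map
begin

text \<open>The pointwise form of the condition that \<open>parabolic_pullback\<close> imposes off
  the preimage of \<open>D\<close>. It is stated for arbitrary families of trivialisations so that
  it passes to duals and tensor products.\<close>

definition compatible :: "('x, 'n::finite) triv set \<Rightarrow> ('y, 'n) triv set \<Rightarrow> 'y \<Rightarrow> bool" where
  "compatible G H p \<longleftrightarrow> (\<forall>(U, g)\<in>G. \<forall>(V, h)\<in>H. f p \<in> U \<longrightarrow> p \<in> V \<longrightarrow>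
     Y.hol_mat p (\<lambda>q. h q ** matrix_inv (g (f q))))"

lemma compatibleD:
  "compatible G H p \<Longrightarrow> (U, g) \<in> G \<Longrightarrow> f p \<in> U \<Longrightarrow> (V, h) \<in> H \<Longrightarrow> p \<in> V \<Longrightarrow>
    Y.hol_mat p (\<lambda>q. h q ** matrix_inv (g (f q)))"
  unfolding compatible_def by blast

lemma compatible_inverse:
  assumes G: "holomorphic_bundle AX G" and H: "holomorphic_bundle AY H" and c: "compatible G H p"
    and t: "(U, g) \<in> G" "f p \<in> U" "(V, h) \<in> H" "p \<in> V"
  shows "Y.hol_mat p (\<lambda>q. g (f q) ** matrix_inv (h q))"
proof -
  have i: "invertible (h p ** matrix_inv (g (f p)))"
    using X.bundleD(2)[OF G t(1,2)] Y.bundleD(2)[OF H t(3,4)]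
    by (simp add: invertible_mult invertible_matrix_inv)
  have "\<forall>\<^sub>F q in nhds p. matrix_inv (h q ** matrix_inv (g (f q))) = g (f q) ** matrix_inv (h q)"
    using eventually_nhds_map[OF X.triv_nhds[OF G t(1,2)]] Y.triv_nhds[OF H t(3,4)]
    by eventually_elim (simp add: matrix_inv_mult invertible_matrix_inv matrix_inv_matrix_inv)
  from Y.hol_mat_cong[OF this] show ?thesis
    using Y.hol_mat_inverse[OF compatibleD[OF c t] i] by simp
qed

lemma compatible_dual:
  assumes G: "holomorphic_bundle AX G" and H: "holomorphic_bundle AY H" and c: "compatible G H p"
  shows "compatible (dual_trivs G) (dual_trivs H) p"
proof -
  have "Y.hol_mat p (\<lambda>q. transpose (matrix_inv (h q)) ** matrix_inv (transpose (matrix_inv (g (f q)))))"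
    if t: "(U, g) \<in> G" "f p \<in> U" "(V, h) \<in> H" "p \<in> V" for U g V h
  proof -
    have "\<forall>\<^sub>F q in nhds p. transpose (matrix_inv (h q)) ** matrix_inv (transpose (matrix_inv (g (f q))))
        = transpose (g (f q) ** matrix_inv (h q))"
      using eventually_nhds_map[OF X.triv_nhds[OF G t(1,2)]]
      by eventually_elim
        (simp add: matrix_inv_transpose invertible_matrix_inv matrix_inv_matrix_inv matrix_transpose_mul)
    then show ?thesis
      using Y.hol_mat_transpose[OF compatible_inverse[OF G H c t]] by (simp only: Y.hol_mat_cong)
  qed
  then show ?thesis unfolding compatible_def dual_trivs_def by auto
qed

lemma compatible_tensor:
  assumes G: "holomorphic_bundle AX G" and G': "holomorphic_bundle AX G'"
    and c: "compatible G H p" "compatible G' H' p"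
  shows "compatible (tensor_trivs G G') (tensor_trivs H H') p"
proof -
  have "Y.hol_mat p (\<lambda>q. kronecker (h q) (h' q) ** matrix_inv (kronecker (g (f q)) (g' (f q))))"
    if t: "(U, g) \<in> G" "f p \<in> U" "(V, h) \<in> H" "p \<in> V"
      "(U', g') \<in> G'" "f p \<in> U'" "(V', h') \<in> H'" "p \<in> V'" for U g V h U' g' V' h'
  proof -
    have "\<forall>\<^sub>F q in nhds p. kronecker (h q) (h' q) ** matrix_inv (kronecker (g (f q)) (g' (f q)))
        = kronecker (h q ** matrix_inv (g (f q))) (h' q ** matrix_inv (g' (f q)))"
      using eventually_nhds_map[OF X.triv_nhds[OF G t(1,2)]] eventually_nhds_map[OF X.triv_nhds[OF G' t(5,6)]]
      by eventually_elim (simp add: matrix_inv_kronecker kronecker_mult)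
    then show ?thesis
      using Y.hol_mat_kronecker[OF compatibleD[OF c(1) t(1-4)] compatibleD[OF c(2) t(5-8)]]
      by (simp only: Y.hol_mat_cong)
  qed
  then show ?thesis unfolding compatible_def tensor_trivs_def by auto
qed

lemma hol_mat_map: "X.hol_mat (f p) M \<Longrightarrow> Y.hol_mat p (\<lambda>q. M (f q))"
  unfolding X.hol_mat_def Y.hol_mat_def by (auto intro: hol_germ_map[of p "\<lambda>q. M q $ i $ j" for i j])

text \<open>The matrix in the new trivialisations is the old one between two holomorphic transition
  matrices. The map \<open>h\<close> lives on the source and need not be of the form k \<circ> f,
  which is what the Higgs field with its derivative factor requires.\<close>

lemma hol_mat_pullback:
  assumes G: "holomorphic_bundle AX G" and H: "holomorphic_bundle AX H"
    and G': "holomorphic_bundle AY G'" and H': "holomorphic_bundle AY H'"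
    and c: "compatible G G' p" "compatible H H' p"
    and t: "(U, g) \<in> G" "f p \<in> U" "(V, k) \<in> H" "f p \<in> V"
      "(U', g') \<in> G'" "p \<in> U'" "(V', k') \<in> H'" "p \<in> V'"
    and h: "Y.hol_mat p (\<lambda>q. k (f q) ** h q ** matrix_inv (g (f q)))"
  shows "Y.hol_mat p (\<lambda>q. k' q ** h q ** matrix_inv (g' q))"
proof -
  have "Y.hol_mat p (\<lambda>q. (k' q ** matrix_inv (k (f q))) ** (k (f q) ** h q ** matrix_inv (g (f q)))
      ** (g (f q) ** matrix_inv (g' q)))"
    by (intro Y.hol_mat_mult h compatibleD[OF c(2) t(3,4,7,8)] compatible_inverse[OF G G' c(1) t(1,2,5,6)])
  moreover have "\<forall>\<^sub>F q in nhds p. k' q ** h q ** matrix_inv (g' q) =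
      (k' q ** matrix_inv (k (f q))) ** (k (f q) ** h q ** matrix_inv (g (f q))) ** (g (f q) ** matrix_inv (g' q))"
    using eventually_nhds_map[OF X.triv_nhds[OF G t(1,2)]] eventually_nhds_map[OF X.triv_nhds[OF H t(3,4)]]
  proof eventually_elim
    case (elim q)
    have "(k' q ** matrix_inv (k (f q))) ** (k (f q) ** h q ** matrix_inv (g (f q))) ** (g (f q) ** matrix_inv (g' q))
      = k' q ** (matrix_inv (k (f q)) ** k (f q)) ** h q ** (matrix_inv (g (f q)) ** g (f q)) ** matrix_inv (g' q)"
      by (simp only: matrix_mul_assoc)
    then show ?case using elim by (simp add: matrix_inv_works)
  qed
  ultimately show ?thesis by (simp only: Y.hol_mat_cong)
qed

text \<open>A notion of pullback stable under duals and tensor products, whose germs are not given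
  by \<open>pullback_germs\<close>. One adapted frame at each point stands in for the explicit
  description of the modules.\<close>

definition pullback_of ::
  "'x set \<Rightarrow> ('x, 'n::finite) filtered_bundle \<Rightarrow> ('y, 'n) filtered_bundle \<Rightarrow> bool" where
  "pullback_of D V V' \<longleftrightarrow>
     holomorphic_bundle AX (ftrivs V) \<and> holomorphic_bundle AY (ftrivs V') \<and>
     (\<forall>p\<in>- (f -` D). compatible (ftrivs V) (ftrivs V') p) \<and>
     (\<forall>y\<in>f -` D. \<exists>Q \<gamma>. X.adapted (f y) (fgerms V (f y)) Q \<gamma> \<and>
        Y.adapted y (fgerms V' y) (\<lambda>p. Q (f p)) (\<lambda>i. real_of_int (mult y) * \<gamma> i))"

lemma pullback_adapted:
  assumes F: "parabolic_pullback AY AX f D E F" and y: "f y \<in> D"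
    and Q: "X.adapted (f y) (par_germs AX E (f y)) Q \<gamma>"
  shows "Y.adapted y (par_germs AY F y) (\<lambda>p. Q (f p)) (\<lambda>i. real_of_int (mult y) * \<gamma> i)"
proof -
  have "par_germs AY F y s = pullback_germs AY AX f E y s" for s
    using F y unfolding parabolic_pullback_def by blast
  then show ?thesis using pullback_germs_adapted[OF Q] unfolding Y.adapted_def by simp
qed

lemma pullback_compatible:
  assumes E: "parabolic_bundle AX D E" and F: "parabolic_pullback AY AX f D E F" and p: "f p \<notin> D"
  shows "compatible (trivs E) (trivs F) p"
  unfolding compatible_def
proof clarify
  fix U g V h assume t: "(U, g) \<in> trivs E" "(V, h) \<in> trivs F" "f p \<in> U" "p \<in> V"
  have PF: "parabolic_bundle AY (f -` D) F" using F unfolding parabolic_pullback_def by blast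
  have "open (- (f -` D))"
    using Y.parabolic_bundleD(1)[OF PF] by (simp add: finite_imp_closed open_Compl)
  then have op: "open (V \<inter> f -` U - f -` D)"
    using Y.bundleD(1)[OF Y.parabolic_bundleD(2)[OF PF] t(2)]
      X.bundleD(1)[OF X.parabolic_bundleD(2)[OF E] t(1)]
    by (simp add: Diff_eq open_Int open_vimage_f)
  have "hol_matrix AY (V \<inter> f -` U - f -` D) (\<lambda>y. h y ** matrix_inv (g (f y)))"
    using F t unfolding parabolic_pullback_def by fast
  then show "Y.hol_mat p (\<lambda>q. h q ** matrix_inv (g (f q)))"
    using Y.hol_matrix_iff[OF op] t p by blast
qed

lemma pullback_of_filtered:
  fixes E :: "('x, 'n::finite) pbundle"
  assumes E: "parabolic_bundle AX D E" and F: "parabolic_pullback AY AX f D E F"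
  shows "pullback_of D (filtered AX E) (filtered AY F)"
    and "pullback_of D (par_dual AX E) (par_dual AY F)"
proof -
  have PF: "parabolic_bundle AY (f -` D) F" using F unfolding parabolic_pullback_def by blast
  note G = X.parabolic_bundleD(2)[OF E] and H = Y.parabolic_bundleD(2)[OF PF]
  have ex: "\<exists>Q \<gamma>. X.adapted (f y) (par_germs AX E (f y)) Q \<gamma>" if y: "f y \<in> D" for y
  proof -
    obtain U g where g: "(U, g) \<in> trivs E" "f y \<in> U" using X.triv_ex[OF G] by blast
    show ?thesis by (rule X.parabolic_adapted[OF E y g]) blast
  qed
  show "pullback_of D (filtered AX E) (filtered AY F)"
    unfolding pullback_of_def filtered_def filtered_bundle.select_convs
    using G H pullback_compatible[OF E F] ex pullback_adapted[OF F] by fast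
  have "\<exists>Q \<gamma>. X.adapted (f y) (fgerms (par_dual AX E) (f y)) Q \<gamma> \<and>
        Y.adapted y (fgerms (par_dual AY F) y) (\<lambda>p. Q (f p)) (\<lambda>i. real_of_int (mult y) * \<gamma> i)"
    if y: "f y \<in> D" for y
  proof -
    obtain Q \<gamma> where Q: "X.adapted (f y) (par_germs AX E (f y)) Q \<gamma>" using ex[OF y] by blast
    have "X.adapted (f y) (fgerms (par_dual AX E) (f y)) (\<lambda>p. transpose (matrix_inv (Q p))) (\<lambda>i. - \<gamma> i)"
      by (rule X.adapted_dual[OF E y Q])
    moreover have "Y.adapted y (fgerms (par_dual AY F) y) (\<lambda>p. transpose (matrix_inv (Q (f p))))
        (\<lambda>i. real_of_int (mult y) * - \<gamma> i)"
      using Y.adapted_dual[OF PF _ pullback_adapted[OF F y Q]] y by simp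
    ultimately show ?thesis
      by (intro exI[of _ "\<lambda>p. transpose (matrix_inv (Q p))"] exI[of _ "\<lambda>i. - \<gamma> i"] conjI)
  qed
  then show "pullback_of D (par_dual AX E) (par_dual AY F)"
    unfolding pullback_of_def
    using X.dual_bundle[OF G] Y.dual_bundle[OF H] compatible_dual[OF G H pullback_compatible[OF E F]]
    by (auto simp: par_dual_def)
qed

lemma pullback_of_tensor:
  assumes V: "pullback_of D V V'" and W: "pullback_of D W W'"
  shows "pullback_of D (par_tensor V W) (par_tensor V' W')"
  unfolding pullback_of_def
proof (intro conjI ballI)
  have ft: "ftrivs (par_tensor A B) = tensor_trivs (ftrivs A) (ftrivs B)"
    for A :: "('z::t2_space, 'k::finite) filtered_bundle" and B :: "('z, 'l::finite) filtered_bundle"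
    by (simp add: par_tensor_def)
  note v = V[unfolded pullback_of_def] and w = W[unfolded pullback_of_def]
  show "holomorphic_bundle AX (ftrivs (par_tensor V W))"
    unfolding ft using v w by (intro X.tensor_bundle) blast+
  show "holomorphic_bundle AY (ftrivs (par_tensor V' W'))"
    unfolding ft using v w by (intro Y.tensor_bundle) blast+
  show "compatible (ftrivs (par_tensor V W)) (ftrivs (par_tensor V' W')) p" if "p \<in> - (f -` D)" for p
    unfolding ft using v w that by (intro compatible_tensor) blast+
  fix y assume y: "y \<in> f -` D"
  obtain Q \<gamma> where Q: "X.adapted (f y) (fgerms V (f y)) Q \<gamma>"
    "Y.adapted y (fgerms V' y) (\<lambda>p. Q (f p)) (\<lambda>i. real_of_int (mult y) * \<gamma> i)" using v y by blast
  obtain R \<delta> where R: "X.adapted (f y) (fgerms W (f y)) R \<delta>"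
    "Y.adapted y (fgerms W' y) (\<lambda>p. R (f p)) (\<lambda>i. real_of_int (mult y) * \<delta> i)" using w y by blast
  show "\<exists>Q \<gamma>. X.adapted (f y) (fgerms (par_tensor V W) (f y)) Q \<gamma> \<and>
        Y.adapted y (fgerms (par_tensor V' W') y) (\<lambda>p. Q (f p)) (\<lambda>i. real_of_int (mult y) * \<gamma> i)"
    using X.adapted_tensor[OF Q(1) R(1)] Y.adapted_tensor[OF Q(2) R(2)]
    by (intro exI[of _ "\<lambda>p. kronecker (Q p) (R p)"] exI[of _ "\<lambda>q. \<gamma> (fst q) + \<delta> (snd q)"])
      (simp add: distrib_left)
qed

lemma par_hom_pullback:
  assumes V: "pullback_of D V V'" and W: "pullback_of D W W'" and D: "finite D" "finite (f -` D)"
    and h: "par_hom AX D V W h"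
  shows "par_hom AY (f -` D) V' W' (\<lambda>p. h (f p))"
  unfolding par_hom_def
proof (intro conjI)
  note v = V[unfolded pullback_of_def] and w = W[unfolded pullback_of_def]
  have GV: "holomorphic_bundle AX (ftrivs V)" "holomorphic_bundle AY (ftrivs V')" using v by auto
  have GW: "holomorphic_bundle AX (ftrivs W)" "holomorphic_bundle AY (ftrivs W')" using w by auto
  have op: "open (- D)" "open (- (f -` D))" using D by (simp_all add: finite_imp_closed open_Compl)
  have hX: "X.hol_mat q (\<lambda>q. k q ** h q ** matrix_inv (g q))"
    if "q \<notin> D" "(U, g) \<in> ftrivs V" "(U', k) \<in> ftrivs W" "q \<in> U" "q \<in> U'" for q U g U' k
    using h that unfolding par_hom_def X.hol_bundle_map_iff[OF GV(1) GW(1) op(1)] by blast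
  have "Y.hol_mat p (\<lambda>q. k' q ** h (f q) ** matrix_inv (g' q))"
    if p: "f p \<notin> D" and t': "(U', g') \<in> ftrivs V'" "(T', k') \<in> ftrivs W'" "p \<in> U'" "p \<in> T'"
    for p U' g' T' k'
  proof -
    obtain U g T k where t: "(U, g) \<in> ftrivs V" "f p \<in> U" "(T, k) \<in> ftrivs W" "f p \<in> T"
      using X.triv_ex[OF GV(1)] X.triv_ex[OF GW(1)] by metis
    have "compatible (ftrivs V) (ftrivs V') p" "compatible (ftrivs W) (ftrivs W') p"
      using v w p by auto
    from hol_mat_pullback[OF GV(1) GW(1) GV(2) GW(2) this t t'(1,3,2,4) hol_mat_map[OF hX[OF p t(1,3,2,4)]]]
    show ?thesis .
  qed
  then show "hol_bundle_map AY (ftrivs V') (ftrivs W') (- (f -` D)) (\<lambda>p. h (f p))"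
    unfolding Y.hol_bundle_map_iff[OF GV(2) GW(2) op(2)] by fast
  show "\<forall>y\<in>f -` D. \<forall>t. \<forall>s\<in>fgerms V' y t. (\<lambda>p. h (f p) *v s p) \<in> fgerms W' y t"
  proof
    fix y assume y: "y \<in> f -` D"
    obtain Q \<gamma> where Q: "X.adapted (f y) (fgerms V (f y)) Q \<gamma>"
      "Y.adapted y (fgerms V' y) (\<lambda>p. Q (f p)) (\<lambda>i. real_of_int (mult y) * \<gamma> i)" using v y by blast
    obtain R \<delta> where R: "X.adapted (f y) (fgerms W (f y)) R \<delta>"
      "Y.adapted y (fgerms W' y) (\<lambda>p. R (f p)) (\<lambda>i. real_of_int (mult y) * \<delta> i)" using w y by blast
    have "\<forall>t. \<forall>s\<in>fgerms V (f y) t. (\<lambda>p. h p *v s p) \<in> fgerms W (f y) t"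
      using h y unfolding par_hom_def by blast
    from map_germs_pullback[OF Q(1) R(1) Q(2) R(2) this]
    show "\<forall>t. \<forall>s\<in>fgerms V' y t. (\<lambda>p. h (f p) *v s p) \<in> fgerms W' y t" .
  qed
qed

lemma par_iso_pullback:
  assumes V: "pullback_of D V V'" and W: "pullback_of D W W'" and D: "finite D" "finite (f -` D)"
    and h: "par_iso AX D V W h"
  shows "par_iso AY (f -` D) V' W' (\<lambda>p. h (f p))"
proof -
  obtain k where k: "par_hom AX D V W h" "par_hom AX D W V k"
    "\<And>p. p \<in> - D \<Longrightarrow> k p ** h p = mat 1 \<and> h p ** k p = mat 1"
    using h unfolding par_iso_def by blast
  show ?thesis unfolding par_iso_def
    using par_hom_pullback[OF V W D k(1)] par_hom_pullback[OF W V D k(2)] k(3) by auto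
qed

end

section \<open>Existence of the pullback\<close>

text \<open>The distinct values are listed in increasing order and their positions shifted by one.
  Since \<open>\<rho>\<close> hits every index, consecutive steps of the flag built from it will be
  distinct.\<close>

lemma weights_index:
  fixes \<beta> :: "'n::finite \<Rightarrow> real"
  shows "\<exists>l w \<rho>. strict_mono_on {1..l} w \<and> range \<rho> = {1..l::nat} \<and> (\<forall>i. \<beta> i = w (\<rho> i))"
proof -
  define ws where "ws = sorted_list_of_set (range \<beta>)"
  have ws: "set ws = range \<beta>" "sorted_wrt (<) ws" unfolding ws_def by auto
  have "\<forall>i. \<exists>k. k < length ws \<and> ws ! k = \<beta> i"
    using ws(1) by (metis in_set_conv_nth rangeI)
  then obtain \<sigma> where \<sigma>: "\<And>i. \<sigma> i < length ws \<and> ws ! \<sigma> i = \<beta> i" by metis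
  have "strict_mono_on {1..length ws} (\<lambda>j. ws ! (j - 1))"
    unfolding strict_mono_on_def using sorted_wrt_nth_less[OF ws(2)] by auto
  moreover have "range (\<lambda>i. Suc (\<sigma> i)) = {1..length ws}"
  proof (intro equalityI subsetI)
    fix j assume j: "j \<in> {1..length ws}"
    then have "ws ! (j - 1) \<in> range \<beta>" using ws(1) nth_mem[of "j - 1" ws] by auto
    then obtain i where i: "ws ! (j - 1) = \<beta> i" by auto
    have "j - 1 = \<sigma> i"
      using \<sigma>[of i] i j strict_sorted_iff[of ws] ws(2) nth_eq_iff_index_eq[of ws "j - 1" "\<sigma> i"] by auto
    then show "j \<in> range (\<lambda>i. Suc (\<sigma> i))" using j by (auto intro!: image_eqI[of _ _ i])
  qed (use \<sigma> in \<open>auto simp: Suc_le_eq\<close>)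
  ultimately show ?thesis
    using \<sigma> by (intro exI[of _ "length ws"] exI[of _ "\<lambda>j. ws ! (j - 1)"] exI[of _ "\<lambda>i. Suc (\<sigma> i)"]) auto
qed

definition diag :: "('n \<Rightarrow> complex) \<Rightarrow> complex^'n^'n" where
  "diag d = (\<chi> i j. if i = j then d i else 0)"

lemma diag_vec: "(diag d *v v) $ i = d i * v $ i"
  by (simp add: diag_def matrix_vector_mult_def if_distrib[of "\<lambda>c. c * _"] cong: if_cong)

lemma diag_mult: "diag d ** diag e = diag (\<lambda>i. d i * e i)"
  by (simp add: diag_def matrix_matrix_mult_def vec_eq_iff if_distrib[of "\<lambda>c. c * _"] cong: if_cong)

lemma diag_one: "diag (\<lambda>_. 1) = mat 1"
  by (simp add: diag_def mat_def)

lemma invertible_diag: "(\<And>i. d i \<noteq> 0) \<Longrightarrow> invertible (diag d)"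
  unfolding invertible_right_inverse
  by (rule exI[of _ "diag (\<lambda>i. inverse (d i))"]) (simp add: diag_mult diag_one)

lemma (in surface) hol_mat_diag:
  assumes "\<And>i. hol_germ A x (d i)"
  shows "hol_mat x (\<lambda>p. diag (\<lambda>i. d i p))"
proof -
  have "hol_germ A x (\<lambda>p. if i = j then d i p else 0)" for i j
    by (cases "i = j") (simp_all add: assms)
  then show ?thesis unfolding hol_mat_def diag_def by simp
qed

lemma (in surface) ordge_powi_iff: "ordge x k (\<lambda>p. coord x p powi n * F p) \<longleftrightarrow> ordge x (k - n) F"
proof
  assume "ordge x k (\<lambda>p. coord x p powi n * F p)"
  from ordge_mult[OF ordeq_imp_ordge[OF ordeq_coord[of x "-n"]] this]
  have "ordge x (k - n) (\<lambda>p. coord x p powi (-n) * (coord x p powi n * F p))" by simp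
  moreover have "\<forall>\<^sub>F p in at x. coord x p powi (-n) * (coord x p powi n * F p) = F p"
    using coord_neq by eventually_elim (simp add: power_int_minus)
  ultimately show "ordge x (k - n) F" by (simp only: ordge_cong)
next
  assume "ordge x (k - n) F"
  from ordge_mult[OF ordeq_imp_ordge[OF ordeq_coord[of x n]] this]
  show "ordge x k (\<lambda>p. coord x p powi n * F p)" by simp
qed

lemma (in surface) hol_germ_coord_chart:
  assumes "p \<in> fst (chart_at x)"
  shows "hol_germ A p (coord x)"
  unfolding coord_def using chart_at(1)[of x] assms
  by (cases "chart_at x") (simp add: hol_germ_diff hol_germ_chart)

context compact_surface_map
begin

lemma finite_vimage_f: "finite D \<Longrightarrow> finite (f -` D)"
proof -
  assume "finite D"
  moreover have "f -` D = (\<Union>x\<in>D. f -` {x})" by auto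
  ultimately show ?thesis using finite_fibre by simp
qed

text \<open>Off the preimage of \<open>D\<close> the trivialisations of \<open>E\<close> are pulled
  back. At a point \<open>y\<close> of the preimage the adapted frame of the prescribed germs has
  numbers \<gamma> that need not be weights; twisting the \<open>i\<close>-th coordinate by a power
  with exponent \<open>\<lfloor>\<gamma> y i\<rfloor>\<close> replaces them by their fractional
  parts.\<close>

lemma pullback_exists:
  fixes E :: "('a, 'n::finite) pbundle"
  assumes E: "parabolic_bundle AX D E"
  shows "\<exists>F. parabolic_pullback AY AX f D E F"
proof -
  let ?B = "f -` D"
  note G = X.parabolic_bundleD(2)[OF E]
  have fB: "finite ?B" using X.parabolic_bundleD(1)[OF E] by (rule finite_vimage_f)
  have "\<forall>y. \<exists>T. (fst T, snd T) \<in> trivs E \<and> f y \<in> fst T" using X.triv_ex[OF G] by fastforce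
  from choice[OF this] obtain T where T: "\<And>y. (fst (T y), snd (T y)) \<in> trivs E \<and> f y \<in> fst (T y)" by blast
  define U where "U y = fst (T y)" for y
  define g where "g y = snd (T y)" for y
  have Ug: "(U y, g y) \<in> trivs E" "f y \<in> U y" for y using T[of y] unfolding U_def g_def by auto
  have "\<forall>y\<in>?B. \<exists>C\<alpha>. invertible (fst C\<alpha>) \<and> X.adapted (f y) (par_germs AX E (f y)) (\<lambda>p. fst C\<alpha> ** g y p) (snd C\<alpha>)"
  proof
    fix y assume "y \<in> ?B"
    then show "\<exists>C\<alpha>. invertible (fst C\<alpha>) \<and>
        X.adapted (f y) (par_germs AX E (f y)) (\<lambda>p. fst C\<alpha> ** g y p) (snd C\<alpha>)"
      using X.parabolic_adapted[OF E _ Ug] by (metis fst_conv snd_conv vimage_eq)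
  qed
  from bchoice[OF this] obtain C\<alpha> where C\<alpha>: "\<And>y. y \<in> ?B \<Longrightarrow> invertible (fst (C\<alpha> y)) \<and>
      X.adapted (f y) (par_germs AX E (f y)) (\<lambda>p. fst (C\<alpha> y) ** g y p) (snd (C\<alpha> y))" by blast
  define C where "C y = fst (C\<alpha> y)" for y
  define \<gamma> where "\<gamma> y i = real_of_int (mult y) * snd (C\<alpha> y) i" for y i
  define \<beta> where "\<beta> y i = frac (\<gamma> y i)" for y i
  have C: "invertible (C y)" and
    ad: "Y.adapted y (pullback_germs AY AX f E y) (\<lambda>p. C y ** g y (f p)) (\<gamma> y)" if "y \<in> ?B" for y
    using C\<alpha>[OF that] pullback_germs_adapted[of y E "\<lambda>p. C y ** g y p" "snd (C\<alpha> y)"]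
    unfolding C_def \<gamma>_def by auto
  have "\<forall>y. \<exists>L. strict_mono_on {1..fst L} (fst (snd L)) \<and> range (snd (snd L)) = {1..fst L :: nat} \<and>
      (\<forall>i. \<beta> y i = fst (snd L) (snd (snd L) i))"
  proof
    fix y
    obtain l w \<rho> where "strict_mono_on {1..l} w \<and> range \<rho> = {1..l::nat} \<and> (\<forall>i. \<beta> y i = w (\<rho> i))"
      using weights_index[of "\<beta> y"] by blast
    then show "\<exists>L. strict_mono_on {1..fst L} (fst (snd L)) \<and> range (snd (snd L)) = {1..fst L :: nat} \<and>
      (\<forall>i. \<beta> y i = fst (snd L) (snd (snd L) i))" by (intro exI[of _ "(l, w, \<rho>)"]) simp
  qed
  from choice[OF this] obtain L where L: "\<forall>y. strict_mono_on {1..fst (L y)} (fst (snd (L y))) \<and>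
      range (snd (snd (L y))) = {1..fst (L y) :: nat} \<and> (\<forall>i. \<beta> y i = fst (snd (L y)) (snd (snd (L y)) i))" ..
  define l where "l y = fst (L y)" for y
  define \<omega> where "\<omega> y = fst (snd (L y))" for y
  define \<rho> where "\<rho> y = snd (snd (L y))" for y
  have l: "strict_mono_on {1..l y} (\<omega> y)" "range (\<rho> y) = {1..l y}" "\<beta> y i = \<omega> y (\<rho> y i)" for y i
    using L unfolding l_def \<omega>_def \<rho>_def by auto
  \<comment> \<open>On such a neighbourhood of a point \<open>y\<close> of the preimage, the
    coordinate is holomorphic and vanishes only at \<open>y\<close>, so the twist is invertible off
    \<open>y\<close>; the other points of the preimage are kept outside.\<close>
  have "\<forall>y. \<exists>W. open W \<and> y \<in> W \<and> W \<subseteq> f -` U y \<and> W \<inter> ?B \<subseteq> {y} \<and> (\<forall>p\<in>W. p \<noteq> y \<longrightarrow> Y.coord y p \<noteq> 0) \<and>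
      W \<subseteq> fst (Y.chart_at y)"
  proof
    fix y
    obtain W where "open W" "y \<in> W" "\<And>p. p \<in> W \<Longrightarrow> p \<noteq> y \<Longrightarrow> Y.coord y p \<noteq> 0"
      using Y.coord_neq[of y] by (auto simp: eventually_at_topological)
    moreover have "open (f -` U y - (?B - {y}))"
      using fB Ug X.bundleD(1)[OF G] by (intro open_Diff open_vimage_f finite_imp_closed) auto
    moreover have "open (fst (Y.chart_at y))" "y \<in> fst (Y.chart_at y)"
      using Y.chart_at[of y] Y.chartD(1)[of "fst (Y.chart_at y)" "snd (Y.chart_at y)"] by auto
    ultimately show "\<exists>W. open W \<and> y \<in> W \<and> W \<subseteq> f -` U y \<and> W \<inter> ?B \<subseteq> {y} \<and>
        (\<forall>p\<in>W. p \<noteq> y \<longrightarrow> Y.coord y p \<noteq> 0) \<and> W \<subseteq> fst (Y.chart_at y)"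
      using Ug(2)[of y] by (intro exI[of _ "W \<inter> (f -` U y - (?B - {y})) \<inter> fst (Y.chart_at y)"]) auto
  qed
  from choice[OF this] obtain W where W': "\<forall>y. open (W y) \<and> y \<in> W y \<and> W y \<subseteq> f -` U y \<and> W y \<inter> ?B \<subseteq> {y} \<and>
      (\<forall>p\<in>W y. p \<noteq> y \<longrightarrow> Y.coord y p \<noteq> 0) \<and> W y \<subseteq> fst (Y.chart_at y)" ..
  have W: "open (W y)" "y \<in> W y" "W y \<subseteq> f -` U y" "W y \<inter> ?B \<subseteq> {y}"
    "W y \<subseteq> fst (Y.chart_at y)" "p \<in> W y \<Longrightarrow> p \<noteq> y \<Longrightarrow> Y.coord y p \<noteq> 0" for y p
    using spec[OF W', of y] by auto
  \<comment> \<open>The fibre of \<open>F\<close> over \<open>y\<close> is not given in advance, so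
    its identification with the model fibre is free and the identity is taken. No other
    trivialisation of \<open>F\<close> will cover \<open>y\<close>, hence no holomorphic transition
    has to be matched there.\<close>
  define h where "h y p = (if p = y then mat 1
      else diag (\<lambda>i. Y.coord y p powi \<lfloor>\<gamma> y i\<rfloor>) ** (C y ** g y (f p)))" for y p
  \<comment> \<open>Under these identifications the flag at \<open>y\<close> consists of coordinate
    subspaces: the \<open>i\<close>-th axis belongs to the steps up to
    \<open>\<rho> y i\<close>.\<close>
  define F :: "('b, 'n) pbundle" where
    "F = \<lparr>trivs = {(f -` V - ?B, \<lambda>p. k (f p)) | V k. (V, k) \<in> trivs E} \<union> {(W y, h y) | y. y \<in> ?B},
      len = l, flag = (\<lambda>y j. {v. \<forall>i. \<rho> y i < j \<longrightarrow> v $ i = 0}), weight = \<omega>\<rparr>"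
  have hinv: "invertible (h y p)" if "y \<in> ?B" "p \<in> W y" for y p
  proof (cases "p = y")
    case True then show ?thesis unfolding h_def by (simp add: invertible_def)
  next
    case False
    have "f p \<in> U y" using that W(3) by blast
    then show ?thesis unfolding h_def
      using False that C W(6) X.bundleD(2)[OF G Ug(1)]
      by (auto intro!: invertible_mult invertible_diag)
  qed
  have opE: "open (f -` V - ?B)" if "(V, k) \<in> trivs E" for V k
    using fB X.bundleD(1)[OF G that] by (intro open_Diff open_vimage_f finite_imp_closed) auto
  have FopI: "open V \<and> (\<forall>p\<in>V. invertible (k p))" if "(V, k) \<in> trivs F" for V k
    using that opE W(1) hinv X.bundleD(2)[OF G] unfolding F_def by auto
  have comp: "Y.hol_mat p (\<lambda>q. k q ** matrix_inv (e (f q)))"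
    if t: "(V, k) \<in> trivs F" "p \<in> V" "p \<notin> ?B" and e: "(S, e) \<in> trivs E" "f p \<in> S" for V k p S e
  proof -
    consider V' k' where "V = f -` V' - ?B" "k = (\<lambda>p. k' (f p))" "(V', k') \<in> trivs E"
      | y where "V = W y" "k = h y" "y \<in> ?B" using t(1) unfolding F_def by auto
    then show ?thesis
    proof cases
      case 1
      then show ?thesis using X.bundleD(3)[OF G e(1) 1(3) e(2)] t(2)
        by (auto intro!: hol_mat_map[of p "\<lambda>q. k' q ** matrix_inv (e q)"])
    next
      case 2
      then have p: "p \<in> W y" "p \<noteq> y" "f p \<in> U y" using t(2,3) W(3) by auto
      have cn: "Y.coord y p \<noteq> 0" using W(6) p by blast
      have "hol_germ AY p (Y.coord y)" using W(5) p by (intro Y.hol_germ_coord_chart) blast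
      then have "Y.hol_mat p (\<lambda>q. diag (\<lambda>i. Y.coord y q powi \<lfloor>\<gamma> y i\<rfloor>))"
        using cn by (intro Y.hol_mat_diag Y.hol_germ_power_int)
      then have "Y.hol_mat p (\<lambda>q. diag (\<lambda>i. Y.coord y q powi \<lfloor>\<gamma> y i\<rfloor>) ** (C y ** (g y (f q) ** matrix_inv (e (f q)))))"
        by (intro Y.hol_mat_mult Y.hol_mat_const hol_mat_map[of p "\<lambda>q. g y q ** matrix_inv (e q)"]
            X.bundleD(3)[OF G e(1) Ug(1) e(2) p(3)])
      moreover have "\<forall>\<^sub>F q in nhds p. k q ** matrix_inv (e (f q)) =
          diag (\<lambda>i. Y.coord y q powi \<lfloor>\<gamma> y i\<rfloor>) ** (C y ** (g y (f q) ** matrix_inv (e (f q))))"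
        using t1_space_nhds[OF p(2)] by eventually_elim (simp add: 2(2) h_def matrix_mul_assoc)
      ultimately show ?thesis by (simp only: Y.hol_mat_cong)
    qed
  qed
  have onB: "V = W p \<and> k = h p" if "(V, k) \<in> trivs F" "p \<in> V" "p \<in> ?B" for V k p
    using that W(4) unfolding F_def by auto
  have FG: "holomorphic_bundle AY (trivs F)"
    unfolding holomorphic_bundle_def
  proof (intro conjI)
    show "(\<Union>(V, k)\<in>trivs F. V) = UNIV"
    proof (intro set_eqI iffI UNIV_I)
      fix p
      have "(f -` U p - ?B, \<lambda>q. g p (f q)) \<in> trivs F" unfolding F_def using Ug(1) by auto
      moreover have "p \<in> ?B \<Longrightarrow> (W p, h p) \<in> trivs F" unfolding F_def by auto
      ultimately show "p \<in> (\<Union>(V, k)\<in>trivs F. V)" using Ug(2)[of p] W(2)[of p] by blast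
    qed
    show "\<forall>(V, k)\<in>trivs F. open V \<and> (\<forall>x\<in>V. invertible (k x))" using FopI by blast
    have "hol_matrix AY (V \<inter> V') (\<lambda>x. k' x ** matrix_inv (k x))"
      if t: "(V, k) \<in> trivs F" "(V', k') \<in> trivs F" for V k V' k'
    proof -
      have op: "open (V \<inter> V')" using FopI t by blast
      have "Y.hol_mat p (\<lambda>x. k' x ** matrix_inv (k x))" if p: "p \<in> V" "p \<in> V'" for p
      proof (cases "p \<in> ?B")
        case True
        then have "k' = k" using onB t p by metis
        have "\<forall>\<^sub>F q in nhds p. k' q ** matrix_inv (k q) = mat 1"
          using eventually_nhds_in_open[OF op, of p] p
          by (auto elim!: eventually_mono simp: \<open>k' = k\<close> matrix_inv_works FopI[OF t(1)])
        then show ?thesis using Y.hol_mat_const by (simp only: Y.hol_mat_cong)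
      next
        case False
        \<comment> \<open>Off the preimage of \<open>D\<close> two trivialisations of
          \<open>F\<close> are compared through a trivialisation of \<open>E\<close> around
          \<open>f p\<close>.\<close>
        note c = comp[OF t(1) p(1) False Ug] and c' = comp[OF t(2) p(2) False Ug]
        have ge: "\<forall>\<^sub>F q in nhds p. f q \<in> U p \<and> invertible (g p (f q))"
          by (rule eventually_nhds_map[OF X.triv_nhds[OF G Ug]])
        have i: "invertible (k p ** matrix_inv (g p (f p)))"
          using FopI[OF t(1)] p(1) X.bundleD(2)[OF G Ug] by (simp add: invertible_mult invertible_matrix_inv)
        have "\<forall>\<^sub>F q in nhds p. k' q ** matrix_inv (k q) =
          (k' q ** matrix_inv (g p (f q))) ** matrix_inv (k q ** matrix_inv (g p (f q)))"
          using ge eventually_nhds_in_open[OF op, of p, OF IntI[OF p]]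
        proof eventually_elim
          case (elim q)
          then have "invertible (k q)" "invertible (g p (f q))" using FopI[OF t(1)] by auto
          then have "(k' q ** matrix_inv (g p (f q))) ** matrix_inv (k q ** matrix_inv (g p (f q)))
            = k' q ** (matrix_inv (g p (f q)) ** g p (f q)) ** matrix_inv (k q)"
            by (simp add: matrix_inv_mult invertible_matrix_inv matrix_inv_matrix_inv matrix_mul_assoc)
          then show ?case using \<open>invertible (g p (f q))\<close> by (simp add: matrix_inv_works)
        qed
        then show ?thesis
          using Y.hol_mat_mult[OF c' Y.hol_mat_inverse[OF c i]] by (simp only: Y.hol_mat_cong)
      qed
      then show ?thesis using Y.hol_matrix_iff[OF op] by blast
    qed
    then show "\<forall>(V, k)\<in>trivs F. \<forall>(V', k')\<in>trivs F. hol_matrix AY (V \<inter> V') (\<lambda>x. k' x ** matrix_inv (k x))"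
      by blast
  qed
  have \<omega>: "0 \<le> \<omega> y j \<and> \<omega> y j < 1" if "j \<in> {1..l y}" for y j
  proof -
    have "j \<in> range (\<rho> y)" using that l(2) by simp
    then obtain i where "j = \<rho> y i" by blast
    then have "\<omega> y j = frac (\<gamma> y i)" using l(3)[of y i] unfolding \<beta>_def by simp
    then show ?thesis by (simp add: frac_ge_0 frac_lt_1)
  qed
  have PF: "parabolic_bundle AY ?B F"
    unfolding parabolic_bundle_def
  proof (intro conjI ballI fB FG)
    fix y assume y: "y \<in> ?B"
    have \<rho>: "\<rho> y i \<in> {1..l y}" for i using l(2)[of y] by blast
    have \<rho>1: "\<rho> y i \<noteq> 0" "\<rho> y i < Suc (l y)" for i using \<rho>[of i] by auto
    show "flag F y 1 = UNIV" unfolding F_def by (simp add: \<rho>1)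
    show "flag F y (len F y + 1) = {0}" unfolding F_def by (auto simp: vec_eq_iff \<rho>1)
    show "vec.subspace (flag F y j)" for j unfolding F_def vec.subspace_def by auto
    show "strict_mono_on {1..len F y} (weight F y)" using l(1) unfolding F_def by simp
    fix j assume j: "j \<in> {1..len F y}"
    then have "j \<in> range (\<rho> y)" using l(2)[of y] unfolding F_def by simp
    then obtain i where i: "j = \<rho> y i" by blast
    have "axis i 1 \<in> flag F y j" unfolding F_def i by (auto simp: axis_def)
    moreover have "axis i 1 \<notin> flag F y (j + 1)" unfolding F_def i by (auto simp: axis_def)
    moreover have "flag F y (j + 1) \<subseteq> flag F y j" unfolding F_def by auto
    ultimately show "flag F y (j + 1) \<subset> flag F y j" by blast
    show "0 \<le> weight F y j" "weight F y j < 1" using \<omega> j unfolding F_def by auto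
  qed
  have "par_germs AY F y = pullback_germs AY AX f E y" if y: "y \<in> ?B" for y
  proof
    fix t
    have fl: "flag_at F y \<tau> = {v. \<forall>i. \<beta> y i < \<tau> \<longrightarrow> ((mat 1 ** h y y) *v v) $ i = 0}" for \<tau>
    proof -
      have "\<rho> y i \<in> {1..len F y}" for i using l(2)[of y] unfolding F_def by auto
      from flag_index(2)[of F y, OF Y.parabolic_bundleD(7)[OF PF y] Y.parabolic_bundleD(8)[OF PF y] this, where t = \<tau>]
      show ?thesis unfolding flag_at_def by (simp add: F_def h_def l(3))
    qed
    have "(W y, h y) \<in> trivs F" unfolding F_def using y by auto
    moreover have "invertible (mat 1 :: complex^'n^'n)" by (simp add: invertible_def)
    moreover have "0 \<le> \<beta> y i \<and> \<beta> y i < 1" for i unfolding \<beta>_def by (simp add: frac_ge_0 frac_lt_1)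
    ultimately have "Y.adapted y (par_germs AY F y) (\<lambda>p. mat 1 ** h y p) (\<beta> y)"
      using fl by (intro Y.par_germs_adapted[OF FG _ W(2)]) auto
    note ad' = Y.adaptedD(2)[OF this]
    have "s \<in> par_germs AY F y t \<longleftrightarrow> s \<in> pullback_germs AY AX f E y t" for s
    proof -
      have "s \<in> par_germs AY F y t \<longleftrightarrow> (\<forall>i. Y.ordge y \<lceil>t - \<beta> y i\<rceil> (\<lambda>p. (h y p *v s p) $ i))"
        using ad' by simp
      also have "(\<forall>i. Y.ordge y \<lceil>t - \<beta> y i\<rceil> (\<lambda>p. (h y p *v s p) $ i)) \<longleftrightarrow>
          (\<forall>i. Y.ordge y \<lceil>t - \<gamma> y i\<rceil> (\<lambda>p. ((C y ** g y (f p)) *v s p) $ i))"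
      proof (rule all_cong1)
        fix i
        have "\<forall>\<^sub>F p in at y. (h y p *v s p) $ i = Y.coord y p powi \<lfloor>\<gamma> y i\<rfloor> * ((C y ** g y (f p)) *v s p) $ i"
          unfolding eventually_at_filter
          by (rule always_eventually) (simp add: h_def diag_vec flip: matrix_vector_mul_assoc)
        \<comment> \<open>\<beta> and \<gamma> differ by an integer, which is the exponent of the
          twist; thus the twisted coordinates impose the same orders as the original ones.\<close>
        moreover have "\<lceil>t - \<beta> y i\<rceil> - \<lfloor>\<gamma> y i\<rfloor> = \<lceil>t - \<gamma> y i\<rceil>"
          unfolding \<beta>_def frac_def by linarith
        ultimately show "Y.ordge y \<lceil>t - \<beta> y i\<rceil> (\<lambda>p. (h y p *v s p) $ i) \<longleftrightarrow>
          Y.ordge y \<lceil>t - \<gamma> y i\<rceil> (\<lambda>p. ((C y ** g y (f p)) *v s p) $ i)"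
          by (simp only: Y.ordge_cong Y.ordge_powi_iff)
      qed
      also have "\<dots> \<longleftrightarrow> s \<in> pullback_germs AY AX f E y t"
        using Y.adaptedD(2)[OF ad[OF y]] by simp
      finally show ?thesis .
    qed
    then show "par_germs AY F y t = pullback_germs AY AX f E y t" by blast
  qed
  moreover have "hol_matrix AY (V \<inter> f -` S - ?B) (\<lambda>y. k y ** matrix_inv (e (f y)))"
    if t: "(V, k) \<in> trivs F" "(S, e) \<in> trivs E" for V k S e
  proof -
    have op: "open (V \<inter> f -` S - ?B)"
      using FopI[OF t(1)] X.bundleD(1)[OF G t(2)] fB
      by (intro open_Diff open_Int open_vimage_f finite_imp_closed) auto
    show ?thesis unfolding Y.hol_matrix_iff[OF op] using comp[OF t(1) _ _ t(2)] by blast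
  qed
  ultimately have "parabolic_pullback AY AX f D E F"
    unfolding parabolic_pullback_def using PF by auto
  then show ?thesis by blast
qed

end

section \<open>Pullback of Higgs fields\<close>

context surface
begin

lemma hol_germ_deriv_chart:
  assumes "(U, z) \<in> A" "x \<in> U" "hol_germ A x h"
  shows "hol_germ A x (\<lambda>p. deriv (\<lambda>\<zeta>. h (inv_into U z \<zeta>)) (z p))"
  using assms hol_germ_iff[OF assms(1,2)]
  by (intro hol_germ_comp_chart[OF assms(1,2)] analytic_deriv) blast

lemma hol_germ_field_differentiable:
  assumes "(U, z) \<in> A" "x \<in> U" "hol_germ A x h"
  shows "(\<lambda>\<zeta>. h (inv_into U z \<zeta>)) field_differentiable at (z x)"
  using assms(3) hol_germ_iff[OF assms(1,2)] analytic_on_imp_differentiable_at by blast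

lemma hol_bundle_endI:
  assumes G: "holomorphic_bundle A G" and g: "(U, g) \<in> G" and W: "open W" "W \<subseteq> U"
    and h: "\<And>p. p \<in> W \<Longrightarrow> hol_mat p (\<lambda>q. g q ** h q ** matrix_inv (g q))"
  shows "hol_bundle_map A G G W h"
proof -
  have "hol_mat p (\<lambda>q. k q ** h q ** matrix_inv (l q))"
    if p: "p \<in> W" and t: "(V, l) \<in> G" "(V', k) \<in> G" "p \<in> V" "p \<in> V'" for p V l V' k
  proof -
    have pU: "p \<in> U" using p W(2) by blast
    have "hol_mat p (\<lambda>q. (k q ** matrix_inv (g q)) ** (g q ** h q ** matrix_inv (g q)) ** (g q ** matrix_inv (l q)))"
      by (intro hol_mat_mult h p bundleD(3)[OF G g t(2) pU t(4)] bundleD(3)[OF G t(1) g t(3) pU])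
    moreover have "\<forall>\<^sub>F q in nhds p. k q ** h q ** matrix_inv (l q) =
        (k q ** matrix_inv (g q)) ** (g q ** h q ** matrix_inv (g q)) ** (g q ** matrix_inv (l q))"
      using triv_nhds[OF G g pU]
    proof eventually_elim
      case (elim q)
      have "(k q ** matrix_inv (g q)) ** (g q ** h q ** matrix_inv (g q)) ** (g q ** matrix_inv (l q))
        = k q ** (matrix_inv (g q) ** g q) ** h q ** (matrix_inv (g q) ** g q) ** matrix_inv (l q)"
        by (simp only: matrix_mul_assoc)
      then show ?case using elim by (simp add: matrix_inv_works)
    qed
    ultimately show ?thesis by (simp only: hol_mat_cong)
  qed
  then show ?thesis unfolding hol_bundle_map_iff[OF G G W(1)] by blast
qed

lemma parabolic_higgsD:
  assumes "parabolic_higgs A D E \<theta>" and c: "(U, z) \<in> A"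
  shows "(V, w) \<in> A \<Longrightarrow> p \<in> U \<Longrightarrow> p \<in> V \<Longrightarrow> p \<notin> D \<Longrightarrow>
      \<theta> (U, z) p = map_matrix ((*) (deriv (w \<circ> inv_into U z) (z p))) (\<theta> (V, w) p)"
    and "hol_bundle_map A (trivs E) (trivs E) (U - D) (\<theta> (U, z))"
    and "p \<in> U \<Longrightarrow> p \<notin> D \<Longrightarrow> trace (\<theta> (U, z) p) = 0"
    and "x \<in> D \<Longrightarrow> x \<in> U \<Longrightarrow>
        \<exists>W M. open W \<and> x \<in> W \<and> hol_bundle_map A (trivs E) (trivs E) W M \<and>
           (\<forall>\<^sub>F p in at x. M p = map_matrix ((*) (z p - z x)) (\<theta> (U, z) p)) \<and>
           (\<forall>j\<in>{1..len E x}. \<forall>v\<in>flag E x j. M x *v v \<in> flag E x j)"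
proof -
  note * = assms(1)[unfolded parabolic_higgs_def]
  note 1 = conjunct1[OF *] and 2 = conjunct1[OF conjunct2[OF *]]
    and 3 = conjunct1[OF conjunct2[OF conjunct2[OF *]]] and 4 = conjunct2[OF conjunct2[OF conjunct2[OF *]]]
  show "(V, w) \<in> A \<Longrightarrow> p \<in> U \<Longrightarrow> p \<in> V \<Longrightarrow> p \<notin> D \<Longrightarrow>
      \<theta> (U, z) p = map_matrix ((*) (deriv (w \<circ> inv_into U z) (z p))) (\<theta> (V, w) p)"
    using bspec[OF 1 c] by auto
  show "hol_bundle_map A (trivs E) (trivs E) (U - D) (\<theta> (U, z))" using bspec[OF 2 c] by simp
  show "p \<in> U \<Longrightarrow> p \<notin> D \<Longrightarrow> trace (\<theta> (U, z) p) = 0" using bspec[OF 3 c] by simp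
  show "x \<in> D \<Longrightarrow> x \<in> U \<Longrightarrow>
        \<exists>W M. open W \<and> x \<in> W \<and> hol_bundle_map A (trivs E) (trivs E) W M \<and>
           (\<forall>\<^sub>F p in at x. M p = map_matrix ((*) (z p - z x)) (\<theta> (U, z) p)) \<and>
           (\<forall>j\<in>{1..len E x}. \<forall>v\<in>flag E x j. M x *v v \<in> flag E x j)"
    using bspec[OF bspec[OF 4] c] by simp
qed

lemma par_germsE:
  assumes "s \<in> par_germs A E x t" "0 \<le> t" "t < 1"
  obtains W s' where "open W" "x \<in> W" "hol_section A (trivs E) W s'" "s' x \<in> flag_at E x t"
    "\<forall>\<^sub>F p in at x. s p = s' p"
proof -
  have "\<lfloor>t\<rfloor> = 0" "frac t = t" using assms(2,3) by (linarith, simp add: frac_eq)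
  then obtain W s' where "open W" "x \<in> W" "hol_section A (trivs E) W s'" "s' x \<in> flag_at E x t"
    "\<forall>\<^sub>F p in at x. s p = s' p" using assms(1) unfolding par_germs_def by auto
  then show thesis by (rule that)
qed

text \<open>An endomorphism commutes with the scalar power of the coordinate, so only its holomorphy
  and its value at \<open>x\<close> matter, and the flag governs that value. The residue of a Higgs
  field enters the calculus of adapted frames in this way.\<close>

lemma par_germs_map:
  assumes E: "parabolic_bundle A D E" and x: "x \<in> D" and W: "open W" "x \<in> W"
    and M: "hol_bundle_map A (trivs E) (trivs E) W M"
    and fl: "\<And>j v. j \<in> {1..len E x} \<Longrightarrow> v \<in> flag E x j \<Longrightarrow> M x *v v \<in> flag E x j"
    and s: "s \<in> par_germs A E x t"
  shows "(\<lambda>p. M p *v s p) \<in> par_germs A E x t"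
proof -
  note G = parabolic_bundleD(2)[OF E]
  obtain U z W' s' where c: "(U, z) \<in> A" "x \<in> U" and W': "open W'" "x \<in> W'"
    and s': "hol_section A (trivs E) W' s'" "s' x \<in> flag_at E x (frac t)"
    and ev: "\<forall>\<^sub>F p in at x. s p = ((z p - z x) powi \<lfloor>t\<rfloor>) *s s' p"
    using s unfolding par_germs_def by blast
  have "hol_section A (trivs E) (W \<inter> W') (\<lambda>p. M p *v s' p)"
  proof -
    have "hol_vec p (\<lambda>q. g q *v (M q *v s' q))" if p: "p \<in> W \<inter> W'" "(V, g) \<in> trivs E" "p \<in> V" for p V g
    proof -
      have "hol_mat p (\<lambda>q. g q ** M q ** matrix_inv (g q))"
        using M p unfolding hol_bundle_map_iff[OF G G W(1)] by blast
      moreover have "hol_vec p (\<lambda>q. g q *v s' q)"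
        by (rule hol_section_vec[OF G W'(1) s'(1)]) (use p in auto)
      ultimately have "hol_vec p (\<lambda>q. (g q ** M q ** matrix_inv (g q)) *v (g q *v s' q))"
        by (rule hol_mat_vec)
      moreover have "\<forall>\<^sub>F q in nhds p. (g q ** M q ** matrix_inv (g q)) *v (g q *v s' q) = g q *v (M q *v s' q)"
        using triv_nhds[OF G p(2,3)]
        by eventually_elim (simp add: matrix_inv_cancel flip: matrix_vector_mul_assoc)
      ultimately show ?thesis by (simp only: hol_vec_cong)
    qed
    then show ?thesis unfolding hol_section_iff[OF G open_Int[OF W(1) W'(1)]] by blast
  qed
  moreover have "M x *v s' x \<in> flag_at E x (frac t)"
  proof -
    let ?J = "LEAST j. 1 \<le> j \<and> (j \<le> len E x \<longrightarrow> frac t \<le> weight E x j)"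
    have J: "?J \<in> {1..len E x + 1}"
      by (rule flag_index(1)[OF parabolic_bundleD(7)[OF E x] parabolic_bundleD(8)[OF E x]])
    show ?thesis
    \<comment> \<open>The flag condition covers only the indices up to \<open>len E x\<close>; the
      remaining index belongs to the zero step, which every linear map preserves.\<close>
    proof (cases "?J \<in> {1..len E x}")
      case True
      then show ?thesis using fl s'(2) unfolding flag_at_def by blast
    next
      case False
      then have "?J = len E x + 1" using J by auto
      then have "flag_at E x (frac t) = {0}"
        unfolding flag_at_def using parabolic_bundleD(4)[OF E x] by simp
      then show ?thesis using s'(2) by simp
    qed
  qed
  moreover have "\<forall>\<^sub>F p in at x. M p *v s p = ((z p - z x) powi \<lfloor>t\<rfloor>) *s (M p *v s' p)"
    using ev by eventually_elim (simp add: matrix_vector_smult)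
  ultimately show ?thesis
    unfolding par_germs_def mem_Collect_eq using W W' c
    by (intro bexI[OF _ c(1)], unfold prod.case)
      (intro exI[of _ "W \<inter> W'"] exI[of _ "\<lambda>p. M p *v s' p"], auto)
qed

text \<open>A germ of an endomorphism off \<open>x\<close> that preserves all the modules \<open>E\<^bsub>x,t\<^esub>\<close> extends over \<open>x\<close>, since
  it preserves \<open>E\<^bsub>x,0\<^esub>\<close>, and the extension preserves the filtration by continuity.\<close>

lemma par_germs_map_extend:
  assumes E: "parabolic_bundle A D E" and x: "x \<in> D"
    and N: "\<And>t s. s \<in> par_germs A E x t \<Longrightarrow> (\<lambda>p. N p *v s p) \<in> par_germs A E x t"
  shows "\<exists>W M. open W \<and> x \<in> W \<and> hol_bundle_map A (trivs E) (trivs E) W M \<and>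
    (\<forall>\<^sub>F p in at x. M p = N p) \<and> (\<forall>j\<in>{1..len E x}. \<forall>v\<in>flag E x j. M x *v v \<in> flag E x j)"
proof -
  note G = parabolic_bundleD(2)[OF E]
  obtain U g where g: "(U, g) \<in> trivs E" "x \<in> U" using triv_ex[OF G] by blast
  have oU: "open U" by (rule bundleD(1)[OF G g(1)])
  have gi: "\<And>p. p \<in> U \<Longrightarrow> invertible (g p)" using bundleD(2)[OF G g(1)] .
  \<comment> \<open>Constant sections of the trivialisation belong to the module at level 0.
    Applying \<open>N\<close> to them shows that its matrix entries agree off \<open>x\<close> with
    holomorphic germs.\<close>
  have "\<exists>c. hol_germ A x c \<and> (\<forall>\<^sub>F p in at x. (g p *v (N p *v (matrix_inv (g p) *v axis j 1))) $ i = c p)" for i j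
  proof -
    have "(\<lambda>p. matrix_inv (g p) *v axis j 1) \<in> par_germs A E x 0"
      by (rule par_germsI[OF oU g(2) constant_section[OF G g(1)]]) (simp_all add: flag_at_zero[OF E x])
    from N[OF this] obtain W s' where W: "open W" "x \<in> W" "hol_section A (trivs E) W s'"
      "\<forall>\<^sub>F p in at x. N p *v (matrix_inv (g p) *v axis j 1) = s' p"
      by (rule par_germsE) auto
    have "hol_germ A x (\<lambda>p. (g p *v s' p) $ i)"
      using hol_section_vec[OF G W(1,3,2) g] unfolding hol_vec_def by blast
    moreover have "\<forall>\<^sub>F p in at x. (g p *v (N p *v (matrix_inv (g p) *v axis j 1))) $ i = (g p *v s' p) $ i"
      using W(4) by eventually_elim simp
    ultimately show ?thesis by blast
  qed
  then have "\<forall>ij. \<exists>c. hol_germ A x c \<and>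
      (\<forall>\<^sub>F p in at x. (g p *v (N p *v (matrix_inv (g p) *v axis (snd ij) 1))) $ (fst ij) = c p)" by blast
  from choice[OF this] obtain k where k: "\<forall>ij. hol_germ A x (k ij) \<and>
      (\<forall>\<^sub>F p in at x. (g p *v (N p *v (matrix_inv (g p) *v axis (snd ij) 1))) $ (fst ij) = k ij p)" ..
  define K where "K p = (\<chi> i j. k (i, j) p)" for p
  define M where "M p = matrix_inv (g p) ** K p ** g p" for p
  have K: "hol_mat x K" unfolding hol_mat_def K_def using k by simp
  have "\<forall>\<^sub>F p in at x. \<forall>ij. (g p *v (N p *v (matrix_inv (g p) *v axis (snd ij) 1))) $ (fst ij) = k ij p"
    by (rule eventually_all_finite) (use k in blast)
  then have KN: "\<forall>\<^sub>F p in at x. g p ** N p ** matrix_inv (g p) = K p"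
  proof eventually_elim
    case (elim p)
    show ?case unfolding vec_eq_iff
    proof (intro allI)
      fix i j
      show "(g p ** N p ** matrix_inv (g p)) $ i $ j = K p $ i $ j"
        using spec[OF elim, of "(i, j)"]
        by (simp add: K_def matrix_vector_mul_assoc matrix_vector_mult_axis matrix_mul_assoc)
    qed
  qed
  have gi_at: "\<forall>\<^sub>F p in at x. invertible (g p)"
    using triv_nhds[OF G g] by (simp add: eventually_nhds_conv_at eventually_conj_iff)
  have MN: "\<forall>\<^sub>F p in at x. M p = N p"
    using KN gi_at
  proof eventually_elim
    case (elim p)
    have "M p = (matrix_inv (g p) ** g p) ** N p ** (matrix_inv (g p) ** g p)"
      unfolding M_def elim(1)[symmetric] by (simp only: matrix_mul_assoc)
    then show ?case using elim(2) by (simp add: matrix_inv_works)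
  qed
  have "\<forall>\<^sub>F p in nhds x. p \<in> U \<and> hol_mat p K"
    using hol_mat_nhds[OF K] eventually_nhds_in_open[OF oU g(2)] by eventually_elim simp
  then obtain W where W: "open W" "x \<in> W" "\<And>p. p \<in> W \<Longrightarrow> p \<in> U \<and> hol_mat p K"
    unfolding eventually_nhds by blast
  have "hol_bundle_map A (trivs E) (trivs E) W M"
  proof (rule hol_bundle_endI[OF G g(1) W(1)])
    show "W \<subseteq> U" using W(3) by blast
    fix p assume p: "p \<in> W"
    have "\<forall>\<^sub>F q in nhds p. g q ** M q ** matrix_inv (g q) = K q"
      using eventually_nhds_in_open[OF oU, of p, OF conjunct1[OF W(3)[OF p]]]
    proof eventually_elim
      case (elim q)
      have "g q ** M q ** matrix_inv (g q) = (g q ** matrix_inv (g q)) ** K q ** (g q ** matrix_inv (g q))"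
        unfolding M_def by (simp only: matrix_mul_assoc)
      then show ?case using gi[OF elim] by (simp add: matrix_inv_works)
    qed
    from hol_mat_cong[OF this] show "hol_mat p (\<lambda>q. g q ** M q ** matrix_inv (g q))"
      using W(3)[OF p] by simp
  qed
  moreover have "M x *v v \<in> flag E x j" if j: "j \<in> {1..len E x}" and v: "v \<in> flag E x j" for j v
  proof -
    let ?t = "weight E x j"
    have t: "0 \<le> ?t" "?t < 1" using parabolic_bundleD(7)[OF E x j] by auto
    \<comment> \<open>The section through \<open>v\<close> that is constant in the trivialisation.
      As \<open>v\<close> lies in the \<open>j\<close>-th step, it belongs to the module whose level
      is the \<open>j\<close>-th weight.\<close>
    let ?s = "\<lambda>p. matrix_inv (g p) *v (g x *v v)"
    have "?s \<in> par_germs A E x ?t"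
      by (rule par_germsI[OF oU g(2) constant_section[OF G g(1)] _ t])
        (use v gi[OF g(2)] in \<open>simp add: flag_at_weight[OF E x j] matrix_inv_cancel\<close>)
    from N[OF this] obtain W' s' where W': "open W'" "x \<in> W'" "hol_section A (trivs E) W' s'"
      "s' x \<in> flag_at E x ?t" "\<forall>\<^sub>F p in at x. N p *v ?s p = s' p" by (rule par_germsE[OF _ t])
    have 1: "hol_vec x (\<lambda>p. g p *v s' p)" by (rule hol_section_vec[OF G W'(1,3,2) g])
    have 2: "hol_vec x (\<lambda>p. K p *v (g x *v v))" by (intro hol_mat_vec K hol_vec_const)
    have "\<forall>\<^sub>F p in at x. K p *v (g x *v v) = g p *v s' p"
      using KN W'(5)
      by eventually_elim (metis matrix_vector_mul_assoc)
    then have "\<forall>\<^sub>F p in at x. (K p *v (g x *v v)) $ i = (g p *v s' p) $ i" for i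
      by (rule eventually_mono) simp
    from hol_germ_eq_at[OF _ _ this] have "(K x *v (g x *v v)) $ i = (g x *v s' x) $ i" for i
      using 1 2 unfolding hol_vec_def by blast
    then have "K x *v (g x *v v) = g x *v s' x" by (simp add: vec_eq_iff)
    then have "matrix_inv (g x) *v (K x *v (g x *v v)) = s' x"
      using matrix_inv_cancel(2)[OF gi[OF g(2)]] by simp
    then have "M x *v v = s' x" unfolding M_def by (simp add: matrix_vector_mul_assoc matrix_mul_assoc)
    then show ?thesis using W'(4) by (simp add: flag_at_weight[OF E x j])
  qed
  ultimately show ?thesis using W MN by blast
qed

end

section \<open>The pulled-back Higgs field and its residues\<close>

context compact_surface_map
begin

lemma hol_germ_coordinate_map:
  assumes "(U, z) \<in> AX" "f y \<in> U"
  shows "hol_germ AY y (\<lambda>p. z (f p))"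
  using hol_germ_map[OF X.hol_germ_chart[OF assms]] .

text \<open>By the chain rule, replacing the chosen chart around \<open>f y\<close> by another one
  multiplies the derivative by the factor with which the coefficient of \<theta> transforms. That
  transformation rule holds only off \<open>D\<close>.\<close>

lemma pullback_higgs_eq:
  assumes \<theta>: "parabolic_higgs AX D E \<theta>" and d: "(V, w) \<in> AY" "y \<in> V" and c: "(U, z) \<in> AX" "f y \<in> U"
    and y: "f y \<notin> D"
  shows "pullback_higgs AX f \<theta> (V, w) y =
    map_matrix ((*) (deriv (\<lambda>\<zeta>. z (f (inv_into V w \<zeta>))) (w y))) (\<theta> (U, z) (f y))"
proof -
  obtain U0 z0 where c0: "X.chart_at (f y) = (U0, z0)" by fastforce
  then have c0': "(U0, z0) \<in> AX" "f y \<in> U0" using X.chart_at[of "f y"] by auto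
  have inv: "inv_into V w (w y) = y" by (rule Y.chartD(5)[OF d])
  let ?G0 = "\<lambda>\<zeta>. z0 (f (inv_into V w \<zeta>))" and ?t = "\<lambda>\<eta>. z (inv_into U0 z0 \<eta>)"
  have "?G0 field_differentiable at (w y)"
    by (rule Y.hol_germ_field_differentiable[OF d hol_germ_coordinate_map[OF c0']])
  moreover have "?t field_differentiable at (?G0 (w y))"
    using X.hol_germ_field_differentiable[OF c0' X.hol_germ_chart[OF c]] inv by simp
  ultimately have "deriv (?t \<circ> ?G0) (w y) = deriv ?t (?G0 (w y)) * deriv ?G0 (w y)"
    by (rule deriv_chain)
  moreover have "deriv (?t \<circ> ?G0) (w y) = deriv (\<lambda>\<zeta>. z (f (inv_into V w \<zeta>))) (w y)"
  proof (rule deriv_cong_ev[OF _ refl])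
    have "\<forall>\<^sub>F p in nhds y. f p \<in> U0"
      by (intro eventually_nhds_map eventually_nhds_in_open X.chartD(1)[OF c0'(1)] c0'(2))
    then have "\<forall>\<^sub>F \<zeta> in nhds (w y). f (inv_into V w \<zeta>) \<in> U0"
      using Y.eventually_nhds_chart[OF d, of "\<lambda>p. f p \<in> U0"] by simp
    then show "\<forall>\<^sub>F \<zeta> in nhds (w y). (?t \<circ> ?G0) \<zeta> = z (f (inv_into V w \<zeta>))"
      by eventually_elim (simp add: X.chartD(5)[OF c0'(1)])
  qed
  moreover have "\<theta> (U0, z0) (f y) = map_matrix ((*) (deriv (z \<circ> inv_into U0 z0) (z0 (f y)))) (\<theta> (U, z) (f y))"
    by (rule X.parabolic_higgsD(1)[OF \<theta> c0'(1) c(1) c0'(2) c(2) y])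
  moreover have "pullback_higgs AX f \<theta> (V, w) y = map_matrix ((*) (deriv ?G0 (w y))) (\<theta> (U0, z0) (f y))"
    using c0 unfolding pullback_higgs_def X.chart_at_def by (simp add: o_def)
  ultimately show ?thesis
    using inv by (simp add: map_matrix_scale_comp o_def mult.commute)
qed

text \<open>The chain rule on the source. One chart around \<open>f y\<close> is used for both
  sides, so the coefficient of \<theta> stays the same and only the derivatives are
  compared.\<close>

lemma pullback_higgs_transition:
  assumes \<theta>: "parabolic_higgs AX D E \<theta>" and d: "(V, w) \<in> AY" "(V', w') \<in> AY" and y: "y \<in> V \<inter> V' - f -` D"
  shows "pullback_higgs AX f \<theta> (V, w) y =
    map_matrix ((*) (deriv (w' \<circ> inv_into V w) (w y))) (pullback_higgs AX f \<theta> (V', w') y)"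
proof -
  obtain U z where c: "(U, z) \<in> AX" "f y \<in> U" using X.chart_ex by blast
  have y': "y \<in> V" "y \<in> V'" "f y \<notin> D" using y by auto
  have inv: "inv_into V w (w y) = y" by (rule Y.chartD(5)[OF d(1) y'(1)])
  let ?G = "\<lambda>\<zeta>. z (f (inv_into V' w' \<zeta>))" and ?t = "\<lambda>\<zeta>. w' (inv_into V w \<zeta>)"
  have "?t field_differentiable at (w y)"
    by (rule Y.hol_germ_field_differentiable[OF d(1) y'(1) Y.hol_germ_chart[OF d(2) y'(2)]])
  moreover have "?G field_differentiable at (?t (w y))"
    using Y.hol_germ_field_differentiable[OF d(2) y'(2) hol_germ_coordinate_map[OF c]] inv by simp
  ultimately have "deriv (?G \<circ> ?t) (w y) = deriv ?G (?t (w y)) * deriv ?t (w y)" by (rule deriv_chain)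
  moreover have "deriv (?G \<circ> ?t) (w y) = deriv (\<lambda>\<zeta>. z (f (inv_into V w \<zeta>))) (w y)"
  proof (rule deriv_cong_ev[OF _ refl])
    have "\<forall>\<^sub>F p in nhds y. p \<in> V'" by (intro eventually_nhds_in_open Y.chartD(1)[OF d(2)] y')
    then have "\<forall>\<^sub>F \<zeta> in nhds (w y). inv_into V w \<zeta> \<in> V'"
      using Y.eventually_nhds_chart[OF d(1) y'(1), of "\<lambda>p. p \<in> V'"] by simp
    then show "\<forall>\<^sub>F \<zeta> in nhds (w y). (?G \<circ> ?t) \<zeta> = z (f (inv_into V w \<zeta>))"
      by eventually_elim (simp add: Y.chartD(5)[OF d(2)])
  qed
  ultimately show ?thesis
    unfolding pullback_higgs_eq[OF \<theta> d(1) y'(1) c y'(3)] pullback_higgs_eq[OF \<theta> d(2) y'(2) c y'(3)]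
    using inv by (simp add: map_matrix_scale_comp o_def mult.commute)
qed

text \<open>The definition chooses a chart separately at each point, but off the preimage of
  \<open>D\<close> one chart around \<open>f p\<close> computes the pullback at all nearby points.
  The derivative factor is holomorphic in that description.\<close>

lemma pullback_higgs_holomorphic:
  fixes E :: "('a, 'n::finite) pbundle"
  assumes E: "parabolic_bundle AX D E" and F: "parabolic_pullback AY AX f D E F"
    and \<theta>: "parabolic_higgs AX D E \<theta>" and d: "(V, w) \<in> AY"
  shows "hol_bundle_map AY (trivs F) (trivs F) (V - f -` D) (pullback_higgs AX f \<theta> (V, w))"
proof -
  have PF: "parabolic_bundle AY (f -` D) F" using F unfolding parabolic_pullback_def by blast
  note G = X.parabolic_bundleD(2)[OF E] and H = Y.parabolic_bundleD(2)[OF PF]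
  have oD: "open (- D)" "open (- (f -` D))"
    using X.parabolic_bundleD(1)[OF E] Y.parabolic_bundleD(1)[OF PF] by (simp_all add: finite_imp_closed open_Compl)
  have oV: "open (V - f -` D)" using Y.chartD(1)[OF d] oD(2) by (simp add: Diff_eq open_Int)
  have "Y.hol_mat p (\<lambda>q. k' q ** pullback_higgs AX f \<theta> (V, w) q ** matrix_inv (g' q))"
    if p: "p \<in> V - f -` D" and t': "(U', g') \<in> trivs F" "(T', k') \<in> trivs F" "p \<in> U'" "p \<in> T'" for p U' g' T' k'
  proof -
    have p': "p \<in> V" "f p \<notin> D" using p by auto
    obtain U z where c: "(U, z) \<in> AX" "f p \<in> U" using X.chart_ex by blast
    obtain T g where t: "(T, g) \<in> trivs E" "f p \<in> T" using X.triv_ex[OF G] by blast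
    let ?d = "\<lambda>q. deriv (\<lambda>\<zeta>. z (f (inv_into V w \<zeta>))) (w q)"
    have oU: "open (U - D)" using X.chartD(1)[OF c(1)] oD(1) by (simp add: Diff_eq open_Int)
    have "hol_bundle_map AX (trivs E) (trivs E) (U - D) (\<theta> (U, z))"
      by (rule X.parabolic_higgsD(2)[OF \<theta> c(1)])
    then have "X.hol_mat (f p) (\<lambda>q. g q ** \<theta> (U, z) q ** matrix_inv (g q))"
      unfolding X.hol_bundle_map_iff[OF G G oU] using t c p' by blast
    from Y.hol_mat_scale[OF Y.hol_germ_deriv_chart[OF d p'(1) hol_germ_coordinate_map[OF c]] hol_mat_map[OF this]]
    have 1: "Y.hol_mat p (\<lambda>q. map_matrix ((*) (?d q)) (g (f q) ** \<theta> (U, z) (f q) ** matrix_inv (g (f q))))" .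
    have "\<forall>\<^sub>F q in nhds p. f q \<in> U \<inter> - D"
      by (intro eventually_nhds_map eventually_nhds_in_open open_Int X.chartD(1)[OF c(1)] oD) (use c p' in auto)
    moreover have "\<forall>\<^sub>F q in nhds p. q \<in> V"
      by (intro eventually_nhds_in_open Y.chartD(1)[OF d] p')
    ultimately have "\<forall>\<^sub>F q in nhds p. g (f q) ** pullback_higgs AX f \<theta> (V, w) q ** matrix_inv (g (f q)) =
        map_matrix ((*) (?d q)) (g (f q) ** \<theta> (U, z) (f q) ** matrix_inv (g (f q)))"
      by eventually_elim (simp add: pullback_higgs_eq[OF \<theta> d _ c(1)] matrix_mult_scale)
    with 1 have "Y.hol_mat p (\<lambda>q. g (f q) ** pullback_higgs AX f \<theta> (V, w) q ** matrix_inv (g (f q)))"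
      by (simp only: Y.hol_mat_cong)
    moreover have "compatible (trivs E) (trivs F) p" by (rule pullback_compatible[OF E F p'(2)])
    ultimately show ?thesis
      by (intro hol_mat_pullback[OF G G H H _ _ t t t'(1,3,2,4)])
  qed
  then show ?thesis unfolding Y.hol_bundle_map_iff[OF H H oV] by blast
qed

text \<open>If \<open>z \<circ> f\<close> vanishes to order \<open>m\<close> in the coordinate \<open>w\<close>, then its derivative vanishes to order
  at least \<open>m - 1\<close>, so \<open>dz / z\<close> pulls back to a holomorphic multiple of \<open>dw / w\<close>.\<close>

lemma deriv_coordinate_map_order:
  assumes d: "(V, w) \<in> AY" "y \<in> V" and c: "X.chart_at (f y) = (U, z)"
  shows "Y.ordge y (mult y - 1) (\<lambda>p. deriv (\<lambda>\<zeta>. z (f (inv_into V w \<zeta>))) (w p))"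
proof -
  define m where "m = nat (mult y)"
  have m: "mult y = int m" "m > 0" using mult_pos[of y] unfolding m_def by auto
  have c': "(U, z) \<in> AX" "f y \<in> U" using X.chart_at[of "f y"] c by auto
  have coord: "X.coord (f y) q = z q - z (f y)" for q using c by (simp add: X.coord_def)
  from Y.ordeq_imp_ordge[OF mult_ordeq[of y], unfolded Y.ordge_iff_chart[OF d]]
  obtain u where "hol_germ AY y u \<and> (\<forall>\<^sub>F p in at y. X.coord (f y) (f p) = (w p - w y) powi mult y * u p)" ..
  then have u: "hol_germ AY y u" "\<forall>\<^sub>F p in at y. X.coord (f y) (f p) = (w p - w y) powi mult y * u p" by auto
  let ?u = "\<lambda>\<zeta>. u (inv_into V w \<zeta>)" and ?G = "\<lambda>\<zeta>. z (f (inv_into V w \<zeta>))"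
  have inv: "inv_into V w (w y) = y" by (rule Y.chartD(5)[OF d])
  have ua: "?u analytic_on {w y}" using u(1) Y.hol_germ_iff[OF d] by blast
  have "\<forall>\<^sub>F p in at y. z (f p) = z (f y) + (w p - w y) ^ m * u p"
    using u(2) by eventually_elim (simp add: coord m power_int_def algebra_simps)
  then have "\<forall>\<^sub>F p in nhds y. z (f p) = z (f y) + (w p - w y) ^ m * u p"
    using m by (simp add: eventually_nhds_conv_at)
  then have "\<forall>\<^sub>F \<zeta> in nhds (w y). ?G \<zeta> = z (f y) + (w (inv_into V w \<zeta>) - w y) ^ m * ?u \<zeta>"
    using Y.eventually_nhds_chart[OF d, of "\<lambda>p. z (f p) = z (f y) + (w p - w y) ^ m * u p"] by simp
  moreover have "\<forall>\<^sub>F \<zeta> in nhds (w y). \<zeta> \<in> w ` V"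
    using Y.chartD(2)[OF d(1)] d(2) by (intro eventually_nhds_in_open) auto
  ultimately have "\<forall>\<^sub>F \<zeta> in nhds (w y). ?G \<zeta> = z (f y) + (\<zeta> - w y) ^ m * ?u \<zeta>"
    by eventually_elim (simp add: Y.chartD(6)[OF d(1)])
  \<comment> \<open>To be differentiated, the local formula has to hold in a whole neighbourhood of
    each nearby point and not merely at that point.\<close>
  then have evG: "\<forall>\<^sub>F \<zeta> in nhds (w y). \<forall>\<^sub>F \<xi> in nhds \<zeta>. ?G \<xi> = z (f y) + (\<xi> - w y) ^ m * ?u \<xi>"
    by (simp add: eventually_eventually)
  moreover have "\<forall>\<^sub>F \<zeta> in nhds (w y). ?u field_differentiable at \<zeta>"
  proof -
    obtain S where S: "open S" "w y \<in> S" "?u holomorphic_on S" using ua unfolding analytic_at by blast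
    show ?thesis using eventually_nhds_in_open[OF S(1,2)]
      by eventually_elim (use S holomorphic_on_imp_differentiable_at in blast)
  qed
  ultimately have ev: "\<forall>\<^sub>F \<zeta> in nhds (w y). deriv ?G \<zeta> =
      (\<zeta> - w y) ^ (m - 1) * (of_nat m * ?u \<zeta> + (\<zeta> - w y) * deriv ?u \<zeta>)"
  proof eventually_elim
    case (elim \<zeta>)
    have "deriv ?G \<zeta> = deriv (\<lambda>\<xi>. z (f y) + (\<xi> - w y) ^ m * ?u \<xi>) \<zeta>"
      by (rule deriv_cong_ev[OF elim(1) refl])
    also have "((\<lambda>\<xi>. z (f y) + (\<xi> - w y) ^ m * ?u \<xi>) has_field_derivative
        (of_nat m * (\<zeta> - w y) ^ (m - 1) * ?u \<zeta> + (\<zeta> - w y) ^ m * deriv ?u \<zeta>)) (at \<zeta>)"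
      using elim(2) by (auto intro!: derivative_eq_intros simp: field_differentiable_derivI)
    then have "deriv (\<lambda>\<xi>. z (f y) + (\<xi> - w y) ^ m * ?u \<xi>) \<zeta> =
        of_nat m * (\<zeta> - w y) ^ (m - 1) * ?u \<zeta> + (\<zeta> - w y) ^ m * deriv ?u \<zeta>"
      by (rule DERIV_imp_deriv)
    also have "\<dots> = (\<zeta> - w y) ^ (m - 1) * (of_nat m * ?u \<zeta> + (\<zeta> - w y) * deriv ?u \<zeta>)"
      using m(2) by (cases m) (simp_all add: algebra_simps)
    finally show ?case .
  qed
  have "Y.ordge y (int (m - 1) + 0) (\<lambda>p. (w p - w y) powi int (m - 1) * (of_nat m * u p + (w p - w y) * deriv ?u (w p)))"
    by (intro Y.ordge_mult Y.ordeq_imp_ordge[OF Y.ordeq_chart_powi[OF d]] Y.hol_imp_ordge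
        Y.hol_germ_add Y.hol_germ_mult Y.hol_germ_const u(1) Y.hol_germ_diff Y.hol_germ_chart[OF d]
        Y.hol_germ_deriv_chart[OF d])
  moreover have "\<forall>\<^sub>F p in at y. deriv ?G (w p) =
      (w p - w y) powi int (m - 1) * (of_nat m * u p + (w p - w y) * deriv ?u (w p))"
  proof -
    have "\<forall>\<^sub>F p in nhds y. w p \<in> w ` V \<and> inv_into V w (w p) = p"
      using eventually_nhds_in_open[OF Y.chartD(1)[OF d(1)] d(2)]
      by eventually_elim (use Y.chartD(5)[OF d(1)] in auto)
    moreover have "\<forall>\<^sub>F p in nhds y. deriv ?G (w p) =
      (w p - w y) ^ (m - 1) * (of_nat m * ?u (w p) + (w p - w y) * deriv ?u (w p))"
      unfolding Y.eventually_nhds_chart[OF d, of "\<lambda>p. deriv ?G (w p) =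
      (w p - w y) ^ (m - 1) * (of_nat m * ?u (w p) + (w p - w y) * deriv ?u (w p))"]
      using ev \<open>\<forall>\<^sub>F \<zeta> in nhds (w y). \<zeta> \<in> w ` V\<close>
      by eventually_elim (simp add: Y.chartD(6)[OF d(1)])
    ultimately have "\<forall>\<^sub>F p in nhds y. deriv ?G (w p) =
      (w p - w y) powi int (m - 1) * (of_nat m * u p + (w p - w y) * deriv ?u (w p))"
      by eventually_elim simp
    then show ?thesis by (simp add: eventually_nhds_conv_at)
  qed
  ultimately have "Y.ordge y (int (m - 1) + 0) (\<lambda>p. deriv ?G (w p))" by (simp only: Y.ordge_cong)
  then show ?thesis using m by (simp add: of_nat_diff)
qed

text \<open>Off \<open>y\<close> the residue matrix is a scalar \<open>e\<close> times
  \<open>M0\<close> at the image point. \<open>M0\<close> along \<open>f\<close> preserves the germs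
  of \<open>F\<close> because its entries keep the required orders, and \<open>e\<close> has order
  at least 0. The extension over \<open>y\<close> and its action on the flag are then recovered from
  the germs.\<close>

lemma pullback_higgs_residue:
  fixes E :: "('a, 'n::finite) pbundle"
  assumes E: "parabolic_bundle AX D E" and F: "parabolic_pullback AY AX f D E F"
    and \<theta>: "parabolic_higgs AX D E \<theta>" and d: "(V, w) \<in> AY" "y \<in> V" and y: "y \<in> f -` D"
  shows "\<exists>W M. open W \<and> y \<in> W \<and> hol_bundle_map AY (trivs F) (trivs F) W M \<and>
    (\<forall>\<^sub>F p in at y. M p = map_matrix ((*) (w p - w y)) (pullback_higgs AX f \<theta> (V, w) p)) \<and>
    (\<forall>j\<in>{1..len F y}. \<forall>v\<in>flag F y j. M y *v v \<in> flag F y j)"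
proof -
  have PF: "parabolic_bundle AY (f -` D) F" using F unfolding parabolic_pullback_def by blast
  note G = X.parabolic_bundleD(2)[OF E]
  have fy: "f y \<in> D" using y by simp
  obtain U z where c: "X.chart_at (f y) = (U, z)" by fastforce
  then have c': "(U, z) \<in> AX" "f y \<in> U" using X.chart_at[of "f y"] by auto
  have coord: "X.coord (f y) q = z q - z (f y)" for q using c by (simp add: X.coord_def)
  obtain W0 M0 where M0: "open W0" "f y \<in> W0" "hol_bundle_map AX (trivs E) (trivs E) W0 M0"
    "\<forall>\<^sub>F q in at (f y). M0 q = map_matrix ((*) (z q - z (f y))) (\<theta> (U, z) q)"
    "\<forall>j\<in>{1..len E (f y)}. \<forall>v\<in>flag E (f y) j. M0 (f y) *v v \<in> flag E (f y) j"
    using X.parabolic_higgsD(4)[OF \<theta> c'(1) fy c'(2)] by blast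
  obtain T g where g: "(T, g) \<in> trivs E" "f y \<in> T" using X.triv_ex[OF G] by blast
  obtain Q \<gamma> where Q: "X.adapted (f y) (par_germs AX E (f y)) Q \<gamma>"
    by (rule X.parabolic_adapted[OF E fy g]) (rule that)
  have Q': "Y.adapted y (par_germs AY F y) (\<lambda>p. Q (f p)) (\<lambda>i. real_of_int (mult y) * \<gamma> i)"
    by (rule pullback_adapted[OF F fy Q])
  have M0_germs: "\<forall>t. \<forall>s\<in>par_germs AX E (f y) t. (\<lambda>p. M0 p *v s p) \<in> par_germs AX E (f y) t"
    using X.par_germs_map[OF E fy M0(1,2,3)] M0(5) by blast
  let ?d = "\<lambda>p. deriv (\<lambda>\<zeta>. z (f (inv_into V w \<zeta>))) (w p)"
  \<comment> \<open>The pullback of dz / (z - z (f y)) divided by dw / (w - w y). With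
    \<open>m\<close> the multiplicity, its order is at least 1 + (m - 1) - m = 0.\<close>
  define e where "e p = (w p - w y) powi 1 * (?d p * X.coord (f y) (f p) powi (-1))" for p
  have "Y.ordge y (1 + ((mult y - 1) + mult y * (-1))) e"
    unfolding e_def by (intro Y.ordge_mult Y.ordeq_imp_ordge[OF Y.ordeq_chart_powi[OF d]]
        deriv_coordinate_map_order[OF d c] Y.ordeq_imp_ordge[OF Y.ordeq_powi[OF mult_ordeq]])
  then have e: "Y.ordge y 0 e" by simp
  let ?N = "\<lambda>p. map_matrix ((*) (w p - w y)) (pullback_higgs AX f \<theta> (V, w) p)"
  have oB: "finite (f -` D)" using Y.parabolic_bundleD(1)[OF PF] .
  have "\<forall>\<^sub>F p in at y. p \<in> V - (f -` D - {y})"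
  proof -
    have "open (V - (f -` D - {y}))"
      using Y.chartD(1)[OF d(1)] oB by (intro open_Diff finite_imp_closed) auto
    from eventually_nhds_in_open[OF this, of y] show ?thesis
      using d(2) by (simp add: eventually_nhds_conv_at)
  qed
  moreover have "\<forall>\<^sub>F p in at y. p \<noteq> y" by (simp add: eventually_at_filter)
  moreover have "\<forall>\<^sub>F p in at y. f p \<in> U"
    using eventually_nhds_map[OF eventually_nhds_in_open[OF X.chartD(1)[OF c'(1)] c'(2)]]
    by (simp add: eventually_nhds_conv_at)
  ultimately have NM: "\<forall>\<^sub>F p in at y. ?N p = map_matrix ((*) (e p)) (M0 (f p))"
    using eventually_at_map[OF M0(4)] eventually_at_map[OF X.coord_neq]
  proof eventually_elim
    case (elim p)
    then have p: "p \<in> V" "f p \<notin> D" "X.coord (f y) (f p) \<noteq> 0" by auto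
    have "?N p = map_matrix ((*) ((w p - w y) * ?d p)) (\<theta> (U, z) (f p))"
      using pullback_higgs_eq[OF \<theta> d(1) p(1) c'(1) elim(3) p(2)] by (simp add: map_matrix_scale_comp)
    also have "(w p - w y) * ?d p = e p * (z (f p) - z (f y))"
      using p(3) unfolding e_def coord by (simp add: power_int_minus)
    also have "map_matrix ((*) (e p * (z (f p) - z (f y)))) (\<theta> (U, z) (f p)) = map_matrix ((*) (e p)) (M0 (f p))"
      using elim(4) by (simp add: map_matrix_scale_comp)
    finally show ?case .
  qed
  have N: "(\<lambda>p. ?N p *v s p) \<in> par_germs AY F y t" if s: "s \<in> par_germs AY F y t" for s t
  proof -
    have "(\<lambda>p. M0 (f p) *v s p) \<in> par_germs AY F y t"
      using map_germs_pullback[OF Q Q Q' Q' M0_germs] s by blast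
    from Y.adapted_scale[OF Q' this e, of t]
    have mem: "(\<lambda>p. e p *s (M0 (f p) *v s p)) \<in> par_germs AY F y t" by simp
    have "\<forall>\<^sub>F p in at y. e p *s (M0 (f p) *v s p) = ?N p *v s p"
      using NM by eventually_elim (simp add: matrix_vector_scale)
    then show ?thesis by (rule iffD1[OF Y.adapted_cong[OF Q'] mem])
  qed
  show ?thesis by (rule Y.par_germs_map_extend[OF PF y]) (rule N)
qed

lemma trace_scale: "trace (map_matrix ((*) c) M) = c * trace M" for M :: "complex^'n^'n"
  by (simp add: trace_def map_matrix_def sum_distrib_left)

lemma pullback_parabolic_higgs:
  fixes E :: "('a, 'n::finite) pbundle"
  assumes E: "parabolic_bundle AX D E" and F: "parabolic_pullback AY AX f D E F"
    and \<theta>: "parabolic_higgs AX D E \<theta>"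
  shows "parabolic_higgs AY (f -` D) F (pullback_higgs AX f \<theta>)"
proof -
  have tr: "trace (pullback_higgs AX f \<theta> (V, w) p) = 0" if d: "(V, w) \<in> AY" "p \<in> V" "f p \<notin> D" for V w p
  proof -
    obtain U z where c: "(U, z) \<in> AX" "f p \<in> U" using X.chart_ex by blast
    show ?thesis
      unfolding pullback_higgs_eq[OF \<theta> d(1,2) c d(3)] trace_scale X.parabolic_higgsD(3)[OF \<theta> c d(3)] by simp
  qed
  show ?thesis
    unfolding parabolic_higgs_def
  proof (intro conjI)
    show "\<forall>(V, w)\<in>AY. \<forall>(V', w')\<in>AY. \<forall>p\<in>V \<inter> V' - f -` D. pullback_higgs AX f \<theta> (V, w) p =
        map_matrix ((*) (deriv (w' \<circ> inv_into V w) (w p))) (pullback_higgs AX f \<theta> (V', w') p)"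
      using pullback_higgs_transition[OF \<theta>] by blast
    show "\<forall>(V, w)\<in>AY. hol_bundle_map AY (trivs F) (trivs F) (V - f -` D) (pullback_higgs AX f \<theta> (V, w))"
      using pullback_higgs_holomorphic[OF E F \<theta>] by blast
    show "\<forall>(V, w)\<in>AY. \<forall>p\<in>V - f -` D. trace (pullback_higgs AX f \<theta> (V, w) p) = 0"
      using tr by auto
    show "\<forall>y\<in>f -` D. \<forall>(V, w)\<in>AY. y \<in> V \<longrightarrow>
        (\<exists>W M. open W \<and> y \<in> W \<and> hol_bundle_map AY (trivs F) (trivs F) W M \<and>
           (\<forall>\<^sub>F p in at y. M p = map_matrix ((*) (w p - w y)) (pullback_higgs AX f \<theta> (V, w) p)) \<and>
           (\<forall>j\<in>{1..len F y}. \<forall>v\<in>flag F y j. M y *v v \<in> flag F y j))"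
    proof (rule ballI, rule ballI, clarify)
      fix y V w assume "f y \<in> D" "(V, w) \<in> AY" "y \<in> V"
      then show "\<exists>W M. open W \<and> y \<in> W \<and> hol_bundle_map AY (trivs F) (trivs F) W M \<and>
           (\<forall>\<^sub>F p in at y. M p = map_matrix ((*) (w p - w y)) (pullback_higgs AX f \<theta> (V, w) p)) \<and>
           (\<forall>j\<in>{1..len F y}. \<forall>v\<in>flag F y j. M y *v v \<in> flag F y j)"
        by (intro pullback_higgs_residue[OF E F \<theta>]) auto
    qed
  qed
qed

text \<open>The identity involves only values at one point, and any two vectors of a fibre are
  values of local sections. So it holds for all vectors over points off \<open>D\<close>, and
  pulling back merely multiplies it by a scalar derivative.\<close>

lemma pullback_higgs_compatible:
  fixes E :: "('a, 'n::finite) pbundle"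
  assumes E: "parabolic_bundle AX D E" and \<theta>: "parabolic_higgs AX D E \<theta>"
    and c: "higgs_compatible AX D E \<phi> \<theta>"
  shows "higgs_compatible AY (f -` D) F (\<phi> \<circ> f) (pullback_higgs AX f \<theta>)"
proof -
  note G = X.parabolic_bundleD(2)[OF E]
  have pt: "\<phi> x *v ((\<theta> (U, z) x *v a) \<otimes>\<^sub>v b) + \<phi> x *v (a \<otimes>\<^sub>v (\<theta> (U, z) x *v b)) = 0"
    if x: "(U, z) \<in> AX" "x \<in> U" "x \<notin> D" for U z x a b
  proof -
    obtain W g where g: "(W, g) \<in> trivs E" "x \<in> W" using X.triv_ex[OF G] by blast
    have gi: "invertible (g x)" using X.bundleD(2)[OF G g(1)] g(2) by blast
    \<comment> \<open>Constant in the trivialisation, with value \<open>a\<close> at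
      \<open>x\<close>.\<close>
    let ?s = "\<lambda>a p. matrix_inv (g p) *v (g x *v a)"
    have "\<forall>(U, z)\<in>AX. \<forall>p\<in>U \<inter> W - D.
        \<phi> p *v ((\<theta> (U, z) p *v ?s a p) \<otimes>\<^sub>v ?s b p) + \<phi> p *v (?s a p \<otimes>\<^sub>v (\<theta> (U, z) p *v ?s b p)) = 0"
      using c[unfolded higgs_compatible_def, rule_format, of W "?s a" "?s b"]
        X.constant_section[OF G g(1)] X.bundleD(1)[OF G g(1)] by blast
    from bspec[OF this x(1)] have "\<phi> x *v ((\<theta> (U, z) x *v ?s a x) \<otimes>\<^sub>v ?s b x) +
        \<phi> x *v (?s a x \<otimes>\<^sub>v (\<theta> (U, z) x *v ?s b x)) = 0" using x g(2) by auto
    then show ?thesis by (simp add: matrix_inv_cancel(2)[OF gi])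
  qed
  have "(\<phi> \<circ> f) p *v ((pullback_higgs AX f \<theta> (V, w) p *v a) \<otimes>\<^sub>v b) +
      (\<phi> \<circ> f) p *v (a \<otimes>\<^sub>v (pullback_higgs AX f \<theta> (V, w) p *v b)) = 0"
    if d: "(V, w) \<in> AY" "p \<in> V" "f p \<notin> D" for V w p a b
  proof -
    obtain U z where c: "(U, z) \<in> AX" "f p \<in> U" using X.chart_ex by blast
    show ?thesis
      using pt[OF c d(3), of a b]
      by (simp add: pullback_higgs_eq[OF \<theta> d(1,2) c d(3)] matrix_vector_scale vtensor_smult
          matrix_vector_smult flip: vector_add_ldistrib)
  qed
  then show ?thesis unfolding higgs_compatible_def by (auto simp only: split_paired_all prod.case Diff_iff Int_iff vimage_eq)
qed

end

section \<open>Pullback of the parabolic degree\<close>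

context surface
begin

text \<open>The condition of \<open>has_degree\<close> in one chart becomes a statement about
  \<open>ordeq\<close>, for which products, pullback and independence of the chart are available.
  The frequency clause excludes germs that vanish identically.\<close>

lemma meromorphic_ordeq:
  assumes c: "(U, z) \<in> A" "x \<in> U"
  shows "(\<lambda>\<zeta>. H (inv_into U z \<zeta>)) meromorphic_on {z x} \<and> (\<exists>\<^sub>F \<zeta> in at (z x). H (inv_into U z \<zeta>) \<noteq> 0) \<and>
    zorder (\<lambda>\<zeta>. H (inv_into U z \<zeta>)) (z x) = n \<longleftrightarrow> ordeq x n H" (is "?L \<longleftrightarrow> _")
proof
  let ?h = "\<lambda>\<zeta>. H (inv_into U z \<zeta>)"
  assume h: ?L
  then have "isolated_singularity_at ?h (z x)" "not_essential ?h (z x)" by (auto simp: meromorphic_at_iff)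
  from zorder_exist[OF this] h obtain g r where g: "g (z x) \<noteq> 0" "r > 0" "g holomorphic_on cball (z x) r"
    "\<And>\<zeta>. \<zeta> \<in> cball (z x) r - {z x} \<Longrightarrow> ?h \<zeta> = g \<zeta> * (\<zeta> - z x) powi n" by auto
  have "g analytic_on {z x}"
    unfolding analytic_at using holomorphic_on_subset[OF g(3)] g(2)
    by (intro exI[of _ "ball (z x) r"]) auto
  then have "hol_germ A x (\<lambda>p. g (z p))" by (rule hol_germ_comp_chart[OF c])
  then have "ordeq x (n + 0) (\<lambda>p. (z p - z x) powi n * g (z p))"
    using g(1) by (intro ordeq_mult ordeq_chart_powi[OF c] unit_imp_ordeq)
  moreover have "\<forall>\<^sub>F p in at x. H p = (z p - z x) powi n * g (z p)"
  proof -
    have "\<forall>\<^sub>F \<zeta> in at (z x). \<zeta> \<in> ball (z x) r - {z x} \<and> \<zeta> \<in> z ` U"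
      using g(2) chartD(2)[OF c(1)] c(2)
      by (intro eventually_conj eventually_at_in_open eventually_at_in_open') auto
    then have "\<forall>\<^sub>F \<zeta> in at (z x). ?h \<zeta> = (z (inv_into U z \<zeta>) - z x) powi n * g (z (inv_into U z \<zeta>))"
      by eventually_elim (simp add: g(4) chartD(6)[OF c(1)])
    then show ?thesis using eventually_at_chart[OF c, of "\<lambda>p. H p = (z p - z x) powi n * g (z p)"] by simp
  qed
  ultimately show "ordeq x n H" by (simp add: ordeq_cong)
next
  let ?h = "\<lambda>\<zeta>. H (inv_into U z \<zeta>)"
  assume H: "ordeq x n H"
  have "ordeq x (-n + n) (\<lambda>p. (z p - z x) powi (-n) * H p)"
    by (intro ordeq_mult ordeq_chart_powi[OF c] H)
  then obtain u where u: "hol_germ A x u" "u x \<noteq> 0" "\<forall>\<^sub>F p in at x. (z p - z x) powi (-n) * H p = u p"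
    unfolding ordeq_def by auto
  have "\<forall>\<^sub>F p in at x. H p = u p * (z p - z x) powi n"
    using u(3) chart_neq[OF c] by eventually_elim (auto simp: power_int_minus field_simps)
  then have "\<forall>\<^sub>F \<zeta> in at (z x). ?h \<zeta> = u (inv_into U z \<zeta>) * (z (inv_into U z \<zeta>) - z x) powi n"
    using eventually_at_chart[OF c, of "\<lambda>p. H p = u p * (z p - z x) powi n"] by simp
  moreover have "\<forall>\<^sub>F \<zeta> in at (z x). \<zeta> \<in> z ` U"
    using chartD(2)[OF c(1)] c(2) by (intro eventually_at_in_open') auto
  ultimately have ev: "\<forall>\<^sub>F \<zeta> in at (z x). ?h \<zeta> = u (inv_into U z \<zeta>) * (\<zeta> - z x) powi n"
    by eventually_elim (simp add: chartD(6)[OF c(1)])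
  have ua: "(\<lambda>\<zeta>. u (inv_into U z \<zeta>)) analytic_on {z x}" using u(1) hol_germ_iff[OF c] by blast
  have ux: "u (inv_into U z (z x)) \<noteq> 0" using u(2) chartD(5)[OF c] by simp
  have "(\<lambda>\<zeta>. u (inv_into U z \<zeta>) * (\<zeta> - z x) powi n) meromorphic_on {z x}"
    by (intro meromorphic_intros analytic_on_imp_meromorphic_on[OF ua])
  then have 1: "?h meromorphic_on {z x}" 
    using meromorphic_on_cong[OF _ refl, of "{z x}" ?h "\<lambda>\<zeta>. u (inv_into U z \<zeta>) * (\<zeta> - z x) powi n"] ev by simp
  have "\<forall>\<^sub>F p in at x. H p \<noteq> 0"
    using \<open>\<forall>\<^sub>F p in at x. H p = u p * (z p - z x) powi n\<close> chart_neq[OF c]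
      hol_germ_nonzero[OF u(1,2), unfolded eventually_nhds_conv_at, THEN conjunct1]
    by eventually_elim simp
  then have "\<forall>\<^sub>F \<zeta> in at (z x). ?h \<zeta> \<noteq> 0" using eventually_at_chart[OF c, of "\<lambda>p. H p \<noteq> 0"] by simp
  then have 2: "\<exists>\<^sub>F \<zeta> in at (z x). ?h \<zeta> \<noteq> 0" by (intro eventually_frequently) auto
  obtain S where S: "open S" "z x \<in> S" "\<And>\<zeta>. \<zeta> \<in> S \<Longrightarrow> \<zeta> \<noteq> z x \<Longrightarrow> ?h \<zeta> = u (inv_into U z \<zeta>) * (\<zeta> - z x) powi n"
    using ev by (auto simp: eventually_at_topological)
  obtain S' where S': "open S'" "z x \<in> S'" "(\<lambda>\<zeta>. u (inv_into U z \<zeta>)) holomorphic_on S'"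
    using ua unfolding analytic_at by blast
  have 3: "zorder ?h (z x) = n"
    by (rule zorder_eqI[of "S \<inter> S'" _ "\<lambda>\<zeta>. u (inv_into U z \<zeta>)"])
      (use S S' ux in \<open>auto intro: holomorphic_on_subset\<close>)
  show ?L using 1 2 3 by blast
qed

lemma has_degree_iff:
  fixes G :: "('x, 'n::finite) triv set"
  shows "has_degree A G d \<longleftrightarrow> (\<exists>\<sigma> ord. (\<forall>(U, g)\<in>G. \<forall>x\<in>U. ordeq x (ord x) (\<lambda>p. det (g p) * \<sigma> p)) \<and>
     d = (\<Sum>x | ord x \<noteq> 0. ord x))"
proof -
  have eq: "(\<forall>(V, z)\<in>A. \<forall>x\<in>U \<inter> V.
           let h = (\<lambda>\<zeta>. det (g (inv_into V z \<zeta>)) * \<sigma> (inv_into V z \<zeta>))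
           in h meromorphic_on {z x} \<and> (\<exists>\<^sub>F \<zeta> in at (z x). h \<zeta> \<noteq> 0) \<and> zorder h (z x) = ord x) \<longleftrightarrow>
      (\<forall>x\<in>U. ordeq x (ord x) (\<lambda>p. det (g p) * \<sigma> p))" (is "?L \<longleftrightarrow> ?R")
    for U and g :: "'x \<Rightarrow> complex^'n^'n" and \<sigma> and ord :: "'x \<Rightarrow> int"
  proof
    assume L: ?L
    show ?R
    proof
      fix x assume x: "x \<in> U"
      obtain V z where c: "(V, z) \<in> A" "x \<in> V" using chart_ex by blast
      show "ordeq x (ord x) (\<lambda>p. det (g p) * \<sigma> p)"
        using bspec[OF L c(1)] x c(2) unfolding meromorphic_ordeq[OF c, symmetric] Let_def by simp
    qed
  next
    assume R: ?R
    show ?L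
    proof (rule ballI, clarify)
      fix V z x assume c: "(V, z) \<in> A" "x \<in> V" and x: "x \<in> U"
      show "let h = (\<lambda>\<zeta>. det (g (inv_into V z \<zeta>)) * \<sigma> (inv_into V z \<zeta>))
           in h meromorphic_on {z x} \<and> (\<exists>\<^sub>F \<zeta> in at (z x). h \<zeta> \<noteq> 0) \<and> zorder h (z x) = ord x"
        using bspec[OF R x] unfolding meromorphic_ordeq[OF c, symmetric] Let_def .
    qed
  qed
  show ?thesis unfolding has_degree_def eq ..
qed

text \<open>At a point near \<open>x\<close> but distinct from it, the coordinate centred at
  \<open>x\<close> and the unit factor are both holomorphic and nonzero.\<close>

lemma ordeq_isolated: "ordeq x n H \<Longrightarrow> \<forall>\<^sub>F p in at x. ordeq p 0 H"
proof -
  assume "ordeq x n H"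
  then obtain c where c: "hol_germ A x c" "c x \<noteq> 0" "\<forall>\<^sub>F p in at x. H p = coord x p powi n * c p"
    unfolding ordeq_def by blast
  have "\<forall>\<^sub>F p in at x. H p = coord x p powi n * c p \<and> coord x p \<noteq> 0"
    using c(3) coord_neq by (rule eventually_conj)
  then obtain S where S: "open S" "x \<in> S"
    "\<And>p. p \<in> S \<Longrightarrow> p \<noteq> x \<Longrightarrow> H p = coord x p powi n * c p \<and> coord x p \<noteq> 0"
    unfolding eventually_at_topological by blast
  have "\<forall>\<^sub>F p in nhds x. hol_germ A p c \<and> c p \<noteq> 0 \<and> hol_germ A p (coord x) \<and> p \<in> S"
    by (intro eventually_conj hol_germ_nhds hol_germ_nonzero c hol_germ_coord eventually_nhds_in_open S)
  then have "\<forall>\<^sub>F p in at x. hol_germ A p c \<and> c p \<noteq> 0 \<and> hol_germ A p (coord x) \<and> p \<in> S"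
    by (simp add: eventually_nhds_conv_at)
  moreover have "\<forall>\<^sub>F p in at x. p \<noteq> x" by (simp add: eventually_at_filter)
  ultimately show ?thesis
  proof eventually_elim
    case (elim p)
    have "ordeq p 0 (\<lambda>q. coord x q powi n * c q)"
      using elim S(3)[of p] by (intro unit_imp_ordeq hol_germ_mult hol_germ_power_int) auto
    moreover have "\<forall>\<^sub>F q in nhds p. q \<in> S - {x}"
      using elim S(1) by (intro eventually_nhds_in_open open_Diff) auto
    then have "\<forall>\<^sub>F q in at p. H q = coord x q powi n * c q"
      using S(3) by (auto simp: eventually_nhds_conv_at elim: eventually_mono)
    ultimately show ?case by (simp add: ordeq_cong)
  qed
qed

text \<open>The identity preserves the filtration, so the scalar comparing the two frames has order
  at least \<lceil>\<gamma> 1 - \<delta> 1\<rceil> and its inverse at least \<lceil>\<delta> 1 -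
  \<gamma> 1\<rceil>. Their product is 1, so these ceilings add up to at most 0; this forces the
  difference to be an integer and both bounds to be attained.\<close>

lemma adapted_rank_one:
  fixes Q R :: "'x \<Rightarrow> complex^1^1" and \<gamma> \<delta> :: "1 \<Rightarrow> real"
  assumes Q: "adapted x S Q \<gamma>" and R: "adapted x S R \<delta>"
  shows "\<exists>n. \<gamma> 1 - \<delta> 1 = of_int n \<and> ordeq x n (\<lambda>p. det (R p ** matrix_inv (Q p)))"
proof -
  let ?a = "\<lambda>p. (R p ** matrix_inv (Q p)) $ 1 $ 1" and ?b = "\<lambda>p. (Q p ** matrix_inv (R p)) $ 1 $ 1"
  define k where "k = \<lceil>\<gamma> 1 - \<delta> 1\<rceil>"
  define l where "l = \<lceil>\<delta> 1 - \<gamma> 1\<rceil>"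
  have id: "\<forall>t. \<forall>s\<in>S t. (\<lambda>p. mat 1 *v s p) \<in> S t" by simp
  have a: "ordge x k ?a"
    using id unfolding adapted_map_iff[OF Q R] k_def by simp
  have b: "ordge x l ?b"
    using id unfolding adapted_map_iff[OF R Q] l_def by simp
  have ab: "\<forall>\<^sub>F p in at x. ?a p * ?b p = 1"
    using adaptedD(1)[OF Q] adaptedD(1)[OF R]
  proof eventually_elim
    case (elim p)
    have "?a p * ?b p = ((R p ** matrix_inv (Q p)) ** (Q p ** matrix_inv (R p))) $ 1 $ 1"
      by (simp add: matrix_matrix_mult_def)
    also have "(R p ** matrix_inv (Q p)) ** (Q p ** matrix_inv (R p)) = R p ** (matrix_inv (Q p) ** Q p) ** matrix_inv (R p)"
      by (simp only: matrix_mul_assoc)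
    also have "\<dots> = mat 1" using elim by (simp add: matrix_inv_works)
    finally show ?case by (simp add: mat_def)
  qed
  have "ordge x (k + l) (\<lambda>_. 1)" using ordge_mult[OF a b] ordge_cong[OF ab] by simp
  moreover have "ordeq x 0 (\<lambda>_. 1)" by (rule unit_imp_ordeq) auto
  ultimately have "k + l \<le> 0" by (rule ordeq_ordge_le[rotated])
  then have kl: "\<gamma> 1 - \<delta> 1 = of_int k" "l = - k" unfolding k_def l_def by linarith+
  obtain c where c: "hol_germ A x c" "\<forall>\<^sub>F p in at x. ?a p = coord x p powi k * c p"
    using a unfolding ordge_def by blast
  obtain d where d: "hol_germ A x d" "\<forall>\<^sub>F p in at x. ?b p = coord x p powi l * d p"
    using b unfolding ordge_def by blast
  have "\<forall>\<^sub>F p in at x. c p * d p = 1"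
    using ab c(2) d(2) coord_neq
    by eventually_elim (simp add: kl power_int_minus field_simps)
  then have "c x * d x = 1" using c(1) d(1) by (intro hol_germ_eq_at) auto
  then have "ordeq x k ?a" unfolding ordeq_def using c by (intro exI[of _ c]) auto
  then show ?thesis using kl by (intro exI[of _ k]) (simp add: det_1)
qed

text \<open>A proper subspace of a line is zero, so a strictly decreasing flag from the line to zero
  leaves room for only one step.\<close>

lemma line_bundle_len:
  fixes L :: "('x, 1) pbundle"
  assumes L: "parabolic_bundle A D L" and x: "x \<in> D"
  shows "len L x = 1"
proof -
  note D = parabolic_bundleD(3-6)[OF L x]
  have ne: "(UNIV :: (complex^1) set) \<noteq> {0}"
  proof
    assume "(UNIV :: (complex^1) set) = {0}"
    then have "axis 1 1 = (0 :: complex^1)" by auto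
    then show False by (simp add: axis_eq_0_iff)
  qed
  have "len L x \<noteq> 0" using D(1,2) ne by auto
  moreover have "\<not> len L x \<ge> 2"
  proof
    assume l: "len L x \<ge> 2"
    have sub: "vec.subspace (flag L x 2)" "vec.subspace (flag L x 3)" using D(3)[of 2] D(3)[of 3] l by auto
    have "flag L x 2 \<subset> UNIV" using D(4)[of 1] l D(1) by (simp add: numeral_2_eq_2)
    moreover have "flag L x 2 = UNIV" if v: "v \<in> flag L x 2" "v \<noteq> 0" for v
    proof -
      have "v $ 1 \<noteq> 0" using v(2) by (auto simp: vec_eq_iff)
      then have "w = (w $ 1 / v $ 1) *s v" for w by (auto simp: vec_eq_iff)
      then show ?thesis using vec.subspace_scale[OF sub(1) v(1)] by (metis UNIV_eq_I)
    qed
    ultimately have "flag L x 2 \<subseteq> {0}" by blast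
    moreover have "flag L x 3 \<subset> flag L x 2" using D(4)[of 2] l by simp
    moreover have "0 \<in> flag L x 3" using vec.subspace_0[OF sub(2)] .
    ultimately show False by blast
  qed
  ultimately show ?thesis by linarith
qed

lemma line_bundle_parabolic_degree:
  fixes L :: "('x, 1) pbundle"
  assumes L: "parabolic_bundle A D L"
  shows "has_parabolic_degree A D L d \<longleftrightarrow> (\<exists>k. has_degree A (trivs L) k \<and> d = of_int k + (\<Sum>x\<in>D. weight L x 1))"
proof -
  have "(\<Sum>j=1..len L x. weight L x j * (real (vec.dim (flag L x j)) - real (vec.dim (flag L x (j + 1))))) = weight L x 1"
    if x: "x \<in> D" for x
  proof -
    have "vec.dim (UNIV :: (complex^1) set) = 1" by (simp only: vec_dim_card) simp
    moreover have "flag L x (1 + 1) = {0}" using parabolic_bundleD(4)[OF L x] line_bundle_len[OF L x] by simp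
    moreover have "vec.dim ({0} :: (complex^1) set) = 0" using vec.dim_singleton by simp
    ultimately show ?thesis
      using parabolic_bundleD(3)[OF L x] line_bundle_len[OF L x] by simp
  qed
  then show ?thesis unfolding has_parabolic_degree_def by simp
qed

end

lemma (in surface) finite_divisor:
  assumes K: "compact (UNIV :: 'x set)" and G: "holomorphic_bundle A G"
    and ord: "\<And>U g x. (U, g) \<in> G \<Longrightarrow> x \<in> U \<Longrightarrow> ordeq x (ord x) (\<lambda>p. det (g p) * \<sigma> p)"
  shows "finite {x. ord x \<noteq> 0}"
proof (rule finite_of_isolated[OF K])
  fix x
  obtain U g where g: "(U, g) \<in> G" "x \<in> U" using triv_ex[OF G] by blast
  have "\<forall>\<^sub>F p in nhds x. p \<in> U" by (rule eventually_nhds_in_open[OF bundleD(1)[OF G g(1)] g(2)])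
  then have "\<forall>\<^sub>F p in at x. p \<in> U" by (simp add: eventually_nhds_conv_at)
  with ordeq_isolated[OF ord[OF g]] show "\<forall>\<^sub>F p in at x. \<not> ord p \<noteq> 0"
    by eventually_elim (use ord[OF g(1)] ordeq_unique in blast)
qed

section \<open>Divisors of pulled-back sections, and the pulled-back structure\<close>

context compact_surface_map
begin

text \<open>Normalising a weight shifts it by an integer, and the order of a section in the
  corresponding trivialisation shifts the opposite way. So order plus weight is intrinsic and is
  multiplied by the multiplicity. Off \<open>D\<close> only the order is present.\<close>

lemma pullback_divisor:
  fixes L :: "('a, 1) pbundle"
  assumes L: "parabolic_bundle AX D L" and M: "parabolic_pullback AY AX f D L M"
    and ord: "\<And>U g x. (U, g) \<in> trivs L \<Longrightarrow> x \<in> U \<Longrightarrow> X.ordeq x (ord x) (\<lambda>p. det (g p) * \<sigma> p)"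
  obtains n where "\<And>V k. (V, k) \<in> trivs M \<Longrightarrow> y \<in> V \<Longrightarrow> Y.ordeq y n (\<lambda>p. det (k p) * \<sigma> (f p))"
    "of_int n + (if f y \<in> D then weight M y 1 else 0) =
      of_int (mult y) * (of_int (ord (f y)) + (if f y \<in> D then weight L (f y) 1 else 0))"
proof -
  have PM: "parabolic_bundle AY (f -` D) M" using M unfolding parabolic_pullback_def by blast
  note G = X.parabolic_bundleD(2)[OF L] and H = Y.parabolic_bundleD(2)[OF PM]
  obtain U g where g: "(U, g) \<in> trivs L" "f y \<in> U" using X.triv_ex[OF G] by blast
  have gi: "\<forall>\<^sub>F p in at y. invertible (g (f p))"
    using eventually_nhds_map[OF X.triv_nhds[OF G g]] by (simp add: eventually_nhds_conv_at eventually_conj_iff)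
  have og: "Y.ordeq y (mult y * ord (f y)) (\<lambda>p. det (g (f p)) * \<sigma> (f p))"
    by (rule ordeq_map[OF ord[OF g]])
  have det_factor: "\<forall>\<^sub>F p in at y. det (k p ** matrix_inv (g (f p))) * (det (g (f p)) * \<sigma> (f p)) = det (k p) * \<sigma> (f p)"
    for k :: "'b \<Rightarrow> complex^1^1"
    using gi
  proof eventually_elim
    case (elim p)
    have "det (matrix_inv (g (f p))) * det (g (f p)) = 1"
      using matrix_inv_works(2)[OF elim] by (metis det_I det_mul)
    then show ?case by (simp add: det_mul)
  qed
  show thesis
  proof (cases "f y \<in> D")
    case False
    have "Y.ordeq y (mult y * ord (f y)) (\<lambda>p. det (k p) * \<sigma> (f p))" if t: "(V, k) \<in> trivs M" "y \<in> V" for V k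
    proof -
      have "Y.hol_mat y (\<lambda>p. k p ** matrix_inv (g (f p)))"
        by (rule compatibleD[OF pullback_compatible[OF L M False] g t])
      moreover have "invertible (k y ** matrix_inv (g (f y)))"
        using Y.bundleD(2)[OF H t] X.bundleD(2)[OF G g] by (simp add: invertible_mult invertible_matrix_inv)
      ultimately have "Y.ordeq y 0 (\<lambda>p. det (k p ** matrix_inv (g (f p))))"
        by (intro Y.unit_imp_ordeq Y.hol_germ_det) (simp_all add: invertible_det_nz)
      from Y.ordeq_mult[OF this og] show ?thesis using Y.ordeq_cong[OF det_factor[of k]] by simp
    qed
    then show thesis by (rule that) (simp_all add: False)
  next
    case True
    obtain C \<alpha> where C: "invertible C" "X.adapted (f y) (par_germs AX L (f y)) (\<lambda>p. C ** g p) \<alpha>"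
      and \<alpha>: "\<exists>j\<in>{1..len L (f y)}. \<alpha> 1 = weight L (f y) j"
      by (rule X.parabolic_adapted[OF L True g]) blast
    have \<alpha>: "\<alpha> 1 = weight L (f y) 1" using \<alpha> X.line_bundle_len[OF L True] by simp
    have yB: "y \<in> f -` D" using True by simp
    have ad: "Y.adapted y (par_germs AY M y) (\<lambda>p. C ** g (f p)) (\<lambda>i. real_of_int (mult y) * \<alpha> i)"
      by (rule pullback_adapted[OF M True C(2)])
    \<comment> \<open>The number under the floor is an integer by the comparison of rank-one frames.
      The formula does not mention a trivialisation of \<open>M\<close>, so one \<open>n\<close>
      serves all of them.\<close>
    define n where "n = mult y * ord (f y) + \<lfloor>of_int (mult y) * weight L (f y) 1 - weight M y 1\<rfloor>"
    have *: "Y.ordeq y n (\<lambda>p. det (k p) * \<sigma> (f p)) \<and>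
        of_int n + weight M y 1 = of_int (mult y) * (of_int (ord (f y)) + weight L (f y) 1)"
      if t: "(V, k) \<in> trivs M" "y \<in> V" for V k
    proof -
      obtain C' \<beta> where C': "invertible C'" "Y.adapted y (par_germs AY M y) (\<lambda>p. C' ** k p) \<beta>"
        and \<beta>: "\<exists>j\<in>{1..len M y}. \<beta> 1 = weight M y j"
        by (rule Y.parabolic_adapted[OF PM yB t]) blast
      have \<beta>: "\<beta> 1 = weight M y 1" using \<beta> Y.line_bundle_len[OF PM yB] by simp
      obtain i where i: "real_of_int (mult y) * \<alpha> 1 - \<beta> 1 = of_int i"
        "Y.ordeq y i (\<lambda>p. det ((C' ** k p) ** matrix_inv (C ** g (f p))))"
        using Y.adapted_rank_one[OF ad C'(2)] by blast
      \<comment> \<open>\<open>C\<close> and \<open>C'\<close> only adjust the trivialisations to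
        the flags; their determinants are nonzero constants and do not change orders.\<close>
      have "Y.ordeq y 0 (\<lambda>_. det C * inverse (det C'))"
        using C(1) C'(1) by (intro Y.unit_imp_ordeq) (auto simp: invertible_det_nz)
      from Y.ordeq_mult[OF this i(2)]
      have "Y.ordeq y i (\<lambda>p. det C * inverse (det C') * det ((C' ** k p) ** matrix_inv (C ** g (f p))))" by simp
      moreover have "\<forall>\<^sub>F p in at y. det C * inverse (det C') * det ((C' ** k p) ** matrix_inv (C ** g (f p))) =
          det (k p ** matrix_inv (g (f p)))"
        using gi
      proof eventually_elim
        case (elim p)
        have 1: "det C * det (matrix_inv C) = 1" using matrix_inv_works(1)[OF C(1)] by (metis det_I det_mul)
        have 2: "inverse (det C') * det C' = 1" using C'(1) by (simp add: invertible_det_nz)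
        have "det C * inverse (det C') * det ((C' ** k p) ** matrix_inv (C ** g (f p))) =
          (inverse (det C') * det C') * (det C * det (matrix_inv C)) * (det (k p) * det (matrix_inv (g (f p))))"
          by (simp only: matrix_inv_mult[OF C(1) elim] det_mul ac_simps)
        then show ?case by (simp only: 1 2 det_mul mult_1)
      qed
      ultimately have "Y.ordeq y i (\<lambda>p. det (k p ** matrix_inv (g (f p))))" by (simp add: Y.ordeq_cong)
      from Y.ordeq_mult[OF this og] have "Y.ordeq y (i + mult y * ord (f y)) (\<lambda>p. det (k p) * \<sigma> (f p))"
        using Y.ordeq_cong[OF det_factor[of k]] by simp
      moreover have "n = i + mult y * ord (f y)" using i(1) unfolding n_def \<alpha> \<beta> by simp
      ultimately show ?thesis using i(1) unfolding \<alpha> \<beta> by (simp add: algebra_simps)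
    qed
    obtain V k where "(V, k) \<in> trivs M" "y \<in> V" using Y.triv_ex[OF H] by blast
    from *[OF this] show thesis by (intro that[of n]) (use * True in auto)
  qed
qed

text \<open>The pulled-back section computes the degree of the bundle underlying \<open>M\<close>.
  Its local contributions, order plus weight, are grouped by the fibres of \<open>f\<close>: each
  group is the contribution of its base point times the constant number of preimages with
  multiplicity, so the total is that number times 0.\<close>

lemma pullback_degree_zero:
  fixes L :: "('a, 1) pbundle"
  assumes K: "compact (UNIV :: 'a set)"
    and L: "parabolic_bundle AX D L" and M: "parabolic_pullback AY AX f D L M"
    and deg: "has_parabolic_degree AX D L 0"
  shows "has_parabolic_degree AY (f -` D) M 0"
proof -
  have PM: "parabolic_bundle AY (f -` D) M" using M unfolding parabolic_pullback_def by blast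
  note G = X.parabolic_bundleD(2)[OF L]
  obtain \<sigma> ord where ord: "\<And>U g x. (U, g) \<in> trivs L \<Longrightarrow> x \<in> U \<Longrightarrow> X.ordeq x (ord x) (\<lambda>p. det (g p) * \<sigma> p)"
    and d0: "0 = of_int (\<Sum>x | ord x \<noteq> 0. ord x) + (\<Sum>x\<in>D. weight L x 1)"
    using deg unfolding X.line_bundle_parabolic_degree[OF L] X.has_degree_iff by blast
  have "\<exists>n. (\<forall>(V, k)\<in>trivs M. y \<in> V \<longrightarrow> Y.ordeq y n (\<lambda>p. det (k p) * \<sigma> (f p))) \<and>
      of_int n + (if f y \<in> D then weight M y 1 else 0) =
      of_int (mult y) * (of_int (ord (f y)) + (if f y \<in> D then weight L (f y) 1 else 0))" for y
    by (rule pullback_divisor[OF L M ord, where y = y]) blast+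
  then have "\<forall>y. \<exists>n. (\<forall>(V, k)\<in>trivs M. y \<in> V \<longrightarrow> Y.ordeq y n (\<lambda>p. det (k p) * \<sigma> (f p))) \<and>
      of_int n + (if f y \<in> D then weight M y 1 else 0) =
      of_int (mult y) * (of_int (ord (f y)) + (if f y \<in> D then weight L (f y) 1 else 0))" ..
  from choice[OF this] obtain ord' where ord': "\<forall>y. (\<forall>(V, k)\<in>trivs M. y \<in> V \<longrightarrow> Y.ordeq y (ord' y) (\<lambda>p. det (k p) * \<sigma> (f p))) \<and>
      of_int (ord' y) + (if f y \<in> D then weight M y 1 else 0) =
      of_int (mult y) * (of_int (ord (f y)) + (if f y \<in> D then weight L (f y) 1 else 0))" ..
  define \<kappa> where "\<kappa> x = of_int (ord x) + (if x \<in> D then weight L x 1 else 0)" for x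
  have fD: "finite D" using X.parabolic_bundleD(1)[OF L] .
  have fo: "finite {x. ord x \<noteq> 0}" by (rule X.finite_divisor[OF K G ord])
  \<comment> \<open>With both the support of the divisor and \<open>D\<close> included, all four
    sums of orders and weights can be taken over \<open>S\<close> or over its preimage.\<close>
  define S where "S = {x. ord x \<noteq> 0} \<union> D"
  have fS: "finite S" unfolding S_def using fD fo by simp
  have fS: "finite S" "finite (f -` S)" by (rule fS, rule finite_vimage_f[OF fS])
  have ord'0: "ord' y = 0" if "y \<notin> f -` S" for y
    using spec[OF ord', of y] that by (simp add: S_def)
  have "of_int (\<Sum>y | ord' y \<noteq> 0. ord' y) + (\<Sum>y\<in>f -` D. weight M y 1) =
      (\<Sum>y\<in>f -` S. of_int (ord' y) + (if f y \<in> D then weight M y 1 else 0))"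
  proof -
    have "(\<Sum>y | ord' y \<noteq> 0. ord' y) = (\<Sum>y\<in>f -` S. ord' y)"
      by (rule sum.mono_neutral_left) (use fS ord'0 in auto)
    moreover have "(\<Sum>y\<in>f -` D. weight M y 1) = (\<Sum>y\<in>f -` S. if f y \<in> D then weight M y 1 else 0)"
      by (rule sum.mono_neutral_cong_left) (use fS in \<open>auto simp: S_def\<close>)
    ultimately show ?thesis by (simp add: sum.distrib)
  qed
  also have "\<dots> = (\<Sum>y\<in>f -` S. of_int (mult y) * \<kappa> (f y))"
    using ord' by (intro sum.cong) (simp_all add: \<kappa>_def)
  also have "\<dots> = (\<Sum>x\<in>S. \<Sum>y\<in>f -` {x}. of_int (mult y) * \<kappa> (f y))"
  proof -
    have "f -` S = (\<Union>x\<in>S. f -` {x})" by auto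
    then show ?thesis using fS(1) finite_fibre by (simp only:) (rule sum.UNION_disjoint, auto)
  qed
  \<comment> \<open>\<open>undefined\<close> serves as an arbitrary base point: the multiplicities
    over any point add up to the degree of \<open>f\<close>.\<close>
  also have "\<dots> = (\<Sum>x\<in>S. of_int (\<Sum>y\<in>f -` {undefined}. mult y) * \<kappa> x)"
  proof (rule sum.cong[OF refl])
    fix x
    have "(\<Sum>y\<in>f -` {x}. of_int (mult y) * \<kappa> (f y)) = of_int (\<Sum>y\<in>f -` {x}. mult y) * \<kappa> x"
      by (simp add: sum_distrib_right)
    then show "(\<Sum>y\<in>f -` {x}. of_int (mult y) * \<kappa> (f y)) = of_int (\<Sum>y\<in>f -` {undefined}. mult y) * \<kappa> x"
      using degree_constant[of x undefined] by simp
  qed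
  also have "\<dots> = of_int (\<Sum>y\<in>f -` {undefined}. mult y) * (\<Sum>x\<in>S. \<kappa> x)"
    by (simp add: sum_distrib_left)
  also have "(\<Sum>x\<in>S. \<kappa> x) = 0"
  proof -
    have "(\<Sum>x | ord x \<noteq> 0. ord x) = (\<Sum>x\<in>S. ord x)"
      by (rule sum.mono_neutral_left) (use fS in \<open>auto simp: S_def\<close>)
    moreover have "(\<Sum>x\<in>D. weight L x 1) = (\<Sum>x\<in>S. if x \<in> D then weight L x 1 else 0)"
      by (rule sum.mono_neutral_cong_left) (use fS in \<open>auto simp: S_def\<close>)
    ultimately show ?thesis using d0 by (simp add: \<kappa>_def sum.distrib)
  qed
  finally have "0 = of_int (\<Sum>y | ord' y \<noteq> 0. ord' y) + (\<Sum>y\<in>f -` D. weight M y 1)" by simp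
  moreover have "has_degree AY (trivs M) (\<Sum>y | ord' y \<noteq> 0. ord' y)"
    unfolding Y.has_degree_iff
    by (intro exI[of _ "\<lambda>p. \<sigma> (f p)"] exI[of _ ord']) (use ord' in blast)
  ultimately show ?thesis unfolding Y.line_bundle_parabolic_degree[OF PM] by blast
qed

text \<open>The form and the isomorphism it induces are maps between bundles built from
  \<open>E\<close> and \<open>L\<close> by duals and tensor products, which commute with pullback.
  Passing from the form to the induced map commutes with composition by \<open>f\<close>, and the
  symmetry condition is pointwise.\<close>

lemma pullback_parabolic_structure:
  fixes E :: "('a, 'n::finite) pbundle" and L :: "('a, 1) pbundle"
  assumes K: "compact (UNIV :: 'a set)" and \<phi>: "parabolic_structure \<kappa> AX D L E \<phi>"
    and F: "parabolic_pullback AY AX f D E F" and M: "parabolic_pullback AY AX f D L M"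
  shows "parabolic_structure \<kappa> AY (f -` D) M F (\<phi> \<circ> f)"
proof -
  have L: "parabolic_bundle AX D L" and E: "parabolic_bundle AX D E" and deg: "has_parabolic_degree AX D L 0"
    and hom: "par_hom AX D (par_tensor (filtered AX E) (filtered AX E)) (filtered AX L) \<phi>"
    and sym: "\<And>p u v. p \<in> - D \<Longrightarrow> \<phi> p *v (u \<otimes>\<^sub>v v) =
        (case \<kappa> of Orthogonal \<Rightarrow> \<phi> p *v (v \<otimes>\<^sub>v u) | Symplectic \<Rightarrow> - (\<phi> p *v (v \<otimes>\<^sub>v u)))"
    and iso: "par_iso AX D (filtered AX E) (par_tensor (par_dual AX E) (filtered AX L)) (form_hat \<phi>)"
    using \<phi> unfolding parabolic_structure_def by blast+
  have PF: "parabolic_bundle AY (f -` D) F" and PM: "parabolic_bundle AY (f -` D) M"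
    using F M unfolding parabolic_pullback_def by blast+
  note pE = pullback_of_filtered[OF E F] and pL = pullback_of_filtered(1)[OF L M]
  note fin = X.parabolic_bundleD(1)[OF E] Y.parabolic_bundleD(1)[OF PF]
  have "par_hom AY (f -` D) (par_tensor (filtered AY F) (filtered AY F)) (filtered AY M) (\<lambda>p. \<phi> (f p))"
    by (rule par_hom_pullback[OF pullback_of_tensor[OF pE(1) pE(1)] pL fin hom])
  moreover have "par_iso AY (f -` D) (filtered AY F) (par_tensor (par_dual AY F) (filtered AY M))
      (\<lambda>p. form_hat \<phi> (f p))"
    by (rule par_iso_pullback[OF pE(1) pullback_of_tensor[OF pE(2) pL] fin iso])
  moreover have "form_hat (\<phi> \<circ> f) = (\<lambda>p. form_hat \<phi> (f p))" by (simp add: form_hat_def fun_eq_iff)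
  moreover have "\<forall>p\<in>- (f -` D). \<forall>u v. (\<phi> \<circ> f) p *v (u \<otimes>\<^sub>v v) =
      (case \<kappa> of Orthogonal \<Rightarrow> (\<phi> \<circ> f) p *v (v \<otimes>\<^sub>v u) | Symplectic \<Rightarrow> - ((\<phi> \<circ> f) p *v (v \<otimes>\<^sub>v u)))"
  proof (intro ballI allI)
    fix p u v assume "p \<in> - (f -` D)"
    then have "f p \<in> - D" by simp
    from sym[OF this, of u v]
    show "(\<phi> \<circ> f) p *v (u \<otimes>\<^sub>v v) = (case \<kappa> of Orthogonal \<Rightarrow> (\<phi> \<circ> f) p *v (v \<otimes>\<^sub>v u)
        | Symplectic \<Rightarrow> - ((\<phi> \<circ> f) p *v (v \<otimes>\<^sub>v u)))" unfolding o_apply .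
  qed
  moreover have "(\<lambda>p. \<phi> (f p)) = \<phi> \<circ> f" by (simp add: o_def)
  ultimately show ?thesis
    unfolding parabolic_structure_def
    using PF PM pullback_degree_zero[OF K L M deg] by simp
qed

end

text \<open>A pullback is fixed only up to isomorphism, so the claim is made for all
  \<open>F\<close> and \<open>M\<close> that are pullbacks, and their existence keeps it from being
  vacuous. Both values of \<open>\<kappa>\<close> are covered at once, since only the sign in the
  symmetry condition depends on it.\<close>

theorem lemma4p3:
  fixes AX :: "'x::t2_space chart set" and AY :: "'y::t2_space chart set"
    and f :: "'y \<Rightarrow> 'x" and D :: "'x set"
    and L :: "('x, 1) pbundle" and E :: "('x, 'n::finite) pbundle"
    and \<phi> :: "'x \<Rightarrow> complex^('n \<times> 'n)^1"
    and \<theta> :: "'x chart \<Rightarrow> 'x \<Rightarrow> complex^'n^'n"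
    and \<kappa> :: form_kind
  assumes "compact_riemann_surface AX" and "compact_riemann_surface AY"
    and "holomorphic_map AY AX f" and "\<not> f constant_on UNIV"
    and "parabolic_structure \<kappa> AX D L E \<phi>"
    and "higgs_field AX D E \<phi> \<theta>"
  shows "(\<exists>F. parabolic_pullback AY AX f D E F) \<and>
         (\<exists>M. parabolic_pullback AY AX f D L M) \<and>
         (\<forall>F M. parabolic_pullback AY AX f D E F \<and> parabolic_pullback AY AX f D L M \<longrightarrow>
            parabolic_structure \<kappa> AY (f -` D) M F (\<phi> \<circ> f) \<and>
            higgs_field AY (f -` D) F (\<phi> \<circ> f) (pullback_higgs AX f \<theta>))"
proof -
  interpret compact_surface_map AX AY f
    using assms(1-4) by unfold_locales (auto simp: compact_riemann_surface_def)
  have K: "compact (UNIV :: 'x set)" using assms(1) by (simp add: compact_riemann_surface_def)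
  have E: "parabolic_bundle AX D E" and L: "parabolic_bundle AX D L"
    using assms(5) by (auto simp: parabolic_structure_def)
  have \<theta>: "parabolic_higgs AX D E \<theta>" "higgs_compatible AX D E \<phi> \<theta>"
    using assms(6) by (auto simp: higgs_field_def)
  show ?thesis
    using pullback_exists[OF E] pullback_exists[OF L] pullback_parabolic_structure[OF K assms(5)]
      pullback_parabolic_higgs[OF E _ \<theta>(1)] pullback_higgs_compatible[OF E \<theta>]
    unfolding higgs_field_def by blast
qed

end
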